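(* There is an absolute constant $C$ such that for all integers $n\ge 1$ and $0\le k\le n$, the Fourier transform on the Johnson graph $J(n,k)$ can be computed using at most $C\,n\binom{n}{k}$ arithmetic operations. That is, given $n$, $k$ and the column vector $[f]_{B_0}$ of an arbitrary function $f\in\mathcal F$ in the delta function basis $B_0$, the column vector $[f]_{B_n}=[B_0]_{B_n}[f]_{B_0}$ of $f$ in a Gelfand-Tsetlin basis $B_n$ of $\mathcal F$ can be computed using $O\!\left(n\binom nk\right)$ arithmetic operations (no change of basis matrix being given in advance).
   Context: Let $X$ be the set of words $w_1\dots w_n$ in the alphabet $\{1,2\}$ with exactly $k$ letters $1$ (the word corresponds to the $k$-subset $\{j: w_j=1\}$ of $\{1,\dots,n\}$; these are the vertices of the Johnson graph $J(n,k)$). The symmetric group $S_n$ acts on $X$ via its action on $k$-subsets. $\mathcal F$ is the space of complex functions on $X$, with $\sigma f=f\circ\sigma^{-1}$ and the inner product for which the delta functions $\delta(x)$, $x\in X$, are orthonormal; $B_0=\{\delta(x)\}_{x\in X}$. For $i\le n$, $S_i\subset S_n$ is the subgroup fixing $i+1,\dots,n$; irreducible representations of $S_i$ are indexed by Young diagrams with $i$ boxes in the usual way ($(i)$ is the trivial representation), and $\mathcal F_{i,\lambda}$ is the $\lambda$-isotypic component of $\mathcal F$ as an $S_i$-module. Write $\lambda\nearrow\mu$ if $\mu$ is obtained from $\lambda$ by adding one box. It is known that $\mathcal F$ is the orthogonal direct sum of the one-dimensional subspaces $\mathcal F_{1,\lambda_1}\cap\dots\cap\mathcal F_{n,\lambda_n}$,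 over all chains $\lambda_1\nearrow\dots\nearrow\lambda_n$ of Young diagrams ($\lambda_i$ having $i$ boxes) with $\lambda_n=(n-a,a)$, $0\le a\le\min(k,n-k)$. A Gelfand-Tsetlin basis $B_n$ of $\mathcal F$ is obtained by choosing a unit vector in each of these subspaces. For bases $B,B'$, $[B]_{B'}$ is the change of basis matrix, whose columns are the elements of $B$ written in the basis $B'$, and $[f]_B$ is the coordinate column vector of $f$ in $B$. Computational model: a single complex multiplication and addition counts as one operation; other elementary algebraic operations on complex numbers (divisions, and the square roots used to normalize vectors) also count as one operation each. Only these algebraic operations are counted; operations involved in storage and bookkeeping (for example reordering rows and columns of a matrix, or handling of combinatorial labels) are not counted. *)

theory Defs
  imports
    "HOL-Analysis.Analysis"
    "HOL-Combinatorics.Permutations"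
    "HOL-Library.Function_Algebras"
    "HOL-Library.Monad_Syntax"
begin

section \<open>Complex function spaces, bases and coordinates\<close>

definition fscale :: "complex \<Rightarrow> ('a \<Rightarrow> complex) \<Rightarrow> 'a \<Rightarrow> complex" where
  "fscale c f = (\<lambda>x. c * f x)"

global_interpretation cfun: vector_space "fscale :: complex \<Rightarrow> ('a \<Rightarrow> complex) \<Rightarrow> 'a \<Rightarrow> complex"
  by unfold_locales (auto simp: fscale_def plus_fun_def algebra_simps)

text \<open>Bases are indexed families, so that coordinates and matrix entries carry labels.\<close>

definition is_basis :: "'i set \<Rightarrow> ('i \<Rightarrow> 'a \<Rightarrow> complex) \<Rightarrow> ('a \<Rightarrow> complex) set \<Rightarrow> bool" where
  "is_basis I B V \<longleftrightarrow> inj_on B I \<and> cfun.independent (B ` I) \<and> cfun.span (B ` I) = V"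

definition coords :: "'i set \<Rightarrow> ('i \<Rightarrow> 'a \<Rightarrow> complex) \<Rightarrow> ('a \<Rightarrow> complex) \<Rightarrow> 'i \<Rightarrow> complex" where
  "coords I B f i = cfun.representation (B ` I) f (B i)"

text \<open>\<open>change_of_basis I' B' B i' i\<close> is the entry in row \<open>i'\<close> and column \<open>i\<close> of
  the matrix usually written \<open>[B]\<^sub>B\<^sub>'\<close>.\<close>

definition change_of_basis ::
    "'j set \<Rightarrow> ('j \<Rightarrow> 'a \<Rightarrow> complex) \<Rightarrow> ('i \<Rightarrow> 'a \<Rightarrow> complex) \<Rightarrow> 'j \<Rightarrow> 'i \<Rightarrow> complex" where
  "change_of_basis I' B' B i' i = coords I' B' (B i) i'"


section \<open>Functions on the vertices of the Johnson graph\<close>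

definition johnson_words :: "nat \<Rightarrow> nat \<Rightarrow> nat list set" where
  "johnson_words n k = {w. length w = n \<and> set w \<subseteq> {1, 2} \<and> count_list w 1 = k}"

text \<open>Positions in a word are numbered from \<open>0\<close>, so the group permuting the first \<open>i\<close> letters
  (and fixing the remaining positions) consists of the permutations of \<open>{..<i}\<close>.\<close>

definition sym_group :: "nat \<Rightarrow> (nat \<Rightarrow> nat) set" where
  "sym_group i = {\<sigma>. \<sigma> permutes {..<i}}"

definition word_act :: "(nat \<Rightarrow> nat) \<Rightarrow> nat list \<Rightarrow> nat list" where
  "word_act \<sigma> w = permute_list (inv \<sigma>) w"

definition word_subset :: "nat list \<Rightarrow> nat set" where
  "word_subset w = {j. j < length w \<and> w ! j = 1}"

text \<open>This is the action on words that corresponds to the natural action on subsets.\<close>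

lemma word_subset_act:
  assumes "\<sigma> \<in> sym_group (length w)"
  shows "word_subset (word_act \<sigma> w) = \<sigma> ` word_subset w"
proof -
  have p: "\<sigma> permutes {..<length w}"
    using assms by (simp add: sym_group_def)
  have lt: "\<sigma> j < length w \<longleftrightarrow> j < length w" "inv \<sigma> j < length w \<longleftrightarrow> j < length w" for j
    using permutes_in_image[OF p] permutes_in_image[OF permutes_inv[OF p]] by auto
  have nth: "word_act \<sigma> w ! j = w ! inv \<sigma> j" if "j < length w" for j
    using that by (simp add: word_act_def permute_list_def)
  have len: "length (word_act \<sigma> w) = length w"
    by (simp add: word_act_def)
  show ?thesis
  proof (intro equalityI subsetI)
    fix j assume "j \<in> word_subset (word_act \<sigma> w)"
    then have "inv \<sigma> j \<in> word_subset w"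
      by (auto simp: word_subset_def len nth lt)
    then have "\<sigma> (inv \<sigma> j) \<in> \<sigma> ` word_subset w"
      by (rule imageI)
    then show "j \<in> \<sigma> ` word_subset w"
      by (simp add: permutes_inverses[OF p])
  next
    fix j assume "j \<in> \<sigma> ` word_subset w"
    then show "j \<in> word_subset (word_act \<sigma> w)"
      by (auto simp: word_subset_def len nth lt permutes_inverses[OF p])
  qed
qed

text \<open>Functions on the vertices are represented by functions on all lists that vanish elsewhere.\<close>

definition johnson_funs :: "nat \<Rightarrow> nat \<Rightarrow> (nat list \<Rightarrow> complex) set" where
  "johnson_funs n k = {f. \<forall>w. w \<notin> johnson_words n k \<longrightarrow> f w = 0}"

definition fun_act :: "(nat \<Rightarrow> nat) \<Rightarrow> (nat list \<Rightarrow> complex) \<Rightarrow> nat list \<Rightarrow> complex" where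
  "fun_act \<sigma> f = f \<circ> word_act (inv \<sigma>)"

definition johnson_inner ::
    "nat \<Rightarrow> nat \<Rightarrow> (nat list \<Rightarrow> complex) \<Rightarrow> (nat list \<Rightarrow> complex) \<Rightarrow> complex" where
  "johnson_inner n k f g = (\<Sum>x\<in>johnson_words n k. f x * cnj (g x))"

definition delta :: "nat list \<Rightarrow> nat list \<Rightarrow> complex" where
  "delta x = (\<lambda>w. if w = x then 1 else 0)"


section \<open>Young diagrams and Specht modules\<close>

text \<open>A diagram is its set of cells \<open>(row, column)\<close>, both numbered from \<open>0\<close>.\<close>

definition young_diagram :: "(nat \<times> nat) set \<Rightarrow> bool" where
  "young_diagram \<mu> \<longleftrightarrow> finite \<mu> \<and>
     (\<forall>r c r' c'. (r, c) \<in> \<mu> \<longrightarrow> r' \<le> r \<longrightarrow> c' \<le> c \<longrightarrow> (r', c') \<in> \<mu>)"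

definition adds_box :: "(nat \<times> nat) set \<Rightarrow> (nat \<times> nat) set \<Rightarrow> bool" where
  "adds_box \<mu> \<nu> \<longleftrightarrow> (\<exists>b. b \<notin> \<mu> \<and> \<nu> = insert b \<mu>)"

definition two_row :: "nat \<Rightarrow> nat \<Rightarrow> (nat \<times> nat) set" where
  "two_row p q = {0} \<times> {..<p} \<union> {1} \<times> {..<q}"

text \<open>A tableau of shape \<open>\<mu>\<close> with \<open>i\<close> boxes is a bijective filling of the cells by \<open>0, \<dots>, i - 1\<close>.
  Its tabloid, i.e. its class modulo row permutations, is the sequence of its row contents.
  The irreducible representation indexed by \<open>\<mu>\<close> is the Specht module: the span of the
  polytabloids inside the functions on tabloids.\<close>

definition tableau :: "(nat \<times> nat) set \<Rightarrow> (nat \<times> nat \<Rightarrow> nat) \<Rightarrow> bool" where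
  "tableau \<mu> t \<longleftrightarrow> bij_betw t \<mu> {..<card \<mu>}"

definition tabloid :: "(nat \<times> nat) set \<Rightarrow> (nat \<times> nat \<Rightarrow> nat) \<Rightarrow> nat \<Rightarrow> nat set" where
  "tabloid \<mu> t r = t ` {b \<in> \<mu>. fst b = r}"

definition column_stabilizer ::
    "(nat \<times> nat) set \<Rightarrow> (nat \<times> nat \<Rightarrow> nat) \<Rightarrow> (nat \<Rightarrow> nat) set" where
  "column_stabilizer \<mu> t = {\<pi> \<in> sym_group (card \<mu>).
     \<forall>c. \<pi> ` t ` {b \<in> \<mu>. snd b = c} = t ` {b \<in> \<mu>. snd b = c}}"

definition polytabloid ::
    "(nat \<times> nat) set \<Rightarrow> (nat \<times> nat \<Rightarrow> nat) \<Rightarrow> (nat \<Rightarrow> nat set) \<Rightarrow> complex" where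
  "polytabloid \<mu> t = (\<lambda>\<tau>. \<Sum>\<pi>\<in>column_stabilizer \<mu> t.
     of_int (sign \<pi>) * (if \<tau> = tabloid \<mu> (\<pi> \<circ> t) then 1 else 0))"

definition specht :: "(nat \<times> nat) set \<Rightarrow> ((nat \<Rightarrow> nat set) \<Rightarrow> complex) set" where
  "specht \<mu> = cfun.span {polytabloid \<mu> t |t. tableau \<mu> t}"

definition tabloid_fun_act ::
    "(nat \<Rightarrow> nat) \<Rightarrow> ((nat \<Rightarrow> nat set) \<Rightarrow> complex) \<Rightarrow> (nat \<Rightarrow> nat set) \<Rightarrow> complex" where
  "tabloid_fun_act \<sigma> g = (\<lambda>\<tau>. g (\<lambda>r. inv \<sigma> ` \<tau> r))"


section \<open>Isotypic components and Gelfand-Tsetlin bases\<close>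

definition isomorphic_modules ::
    "'g set \<Rightarrow> ('g \<Rightarrow> ('a \<Rightarrow> complex) \<Rightarrow> 'a \<Rightarrow> complex) \<Rightarrow> ('a \<Rightarrow> complex) set \<Rightarrow>
     ('g \<Rightarrow> ('b \<Rightarrow> complex) \<Rightarrow> 'b \<Rightarrow> complex) \<Rightarrow> ('b \<Rightarrow> complex) set \<Rightarrow> bool" where
  "isomorphic_modules G actV V actW W \<longleftrightarrow> (\<exists>\<phi>. bij_betw \<phi> V W \<and>
     (\<forall>u\<in>V. \<forall>v\<in>V. \<phi> (u + v) = \<phi> u + \<phi> v) \<and>
     (\<forall>c. \<forall>v\<in>V. \<phi> (fscale c v) = fscale c (\<phi> v)) \<and>
     (\<forall>\<sigma>\<in>G. \<forall>v\<in>V. \<phi> (actV \<sigma> v) = actW \<sigma> (\<phi> v)))"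

definition submodule :: "nat \<Rightarrow> nat \<Rightarrow> nat \<Rightarrow> (nat list \<Rightarrow> complex) set \<Rightarrow> bool" where
  "submodule n k i W \<longleftrightarrow> cfun.subspace W \<and> W \<subseteq> johnson_funs n k \<and>
     (\<forall>\<sigma>\<in>sym_group i. fun_act \<sigma> ` W \<subseteq> W)"

text \<open>The sum of all submodules isomorphic to the irreducible module indexed by \<open>\<mu>\<close>;
  meant for \<open>i \<le> n\<close> and diagrams \<open>\<mu>\<close> with \<open>i\<close> boxes.\<close>

definition isotypic :: "nat \<Rightarrow> nat \<Rightarrow> nat \<Rightarrow> (nat \<times> nat) set \<Rightarrow> (nat list \<Rightarrow> complex) set" where
  "isotypic n k i \<mu> = cfun.span (\<Union>{W. submodule n k i W \<and>
     isomorphic_modules (sym_group i) tabloid_fun_act (specht \<mu>) fun_act W})"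

text \<open>A chain is the list of its members: the diagram with \<open>i\<close> boxes is the entry \<open>i - 1\<close>.\<close>

definition gt_chains :: "nat \<Rightarrow> nat \<Rightarrow> (nat \<times> nat) set list set" where
  "gt_chains n k = {T. length T = n \<and>
     (\<forall>i\<in>{1..n}. young_diagram (T ! (i - 1)) \<and> card (T ! (i - 1)) = i) \<and>
     (\<forall>i\<in>{1..<n}. adds_box (T ! (i - 1)) (T ! i)) \<and>
     (\<exists>a \<le> min k (n - k). T ! (n - 1) = two_row (n - a) a)}"

definition gelfand_tsetlin_basis ::
    "nat \<Rightarrow> nat \<Rightarrow> ((nat \<times> nat) set list \<Rightarrow> nat list \<Rightarrow> complex) \<Rightarrow> bool" where
  "gelfand_tsetlin_basis n k B \<longleftrightarrow>
     is_basis (gt_chains n k) B (johnson_funs n k) \<and>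
     (\<forall>T\<in>gt_chains n k. B T \<in> (\<Inter>i\<in>{1..n}. isotypic n k i (T ! (i - 1))) \<and>
        johnson_inner n k (B T) (B T) = 1)"


section \<open>Straight-line arithmetic programs\<close>

text \<open>The only constants are \<open>0\<close> and \<open>1\<close>; every other number, including entries of change of
  basis matrices, has to be computed from the inputs by counted operations.
  \<open>Result j\<close> refers to the value computed by instruction number \<open>j\<close>.\<close>

datatype 'x operand = Zero | One | Input 'x | Result nat

datatype 'x instr =
    MulAdd "'x operand" "'x operand" "'x operand"
  | Sub "'x operand" "'x operand"
  | Div "'x operand" "'x operand"
  | Sqrt "'x operand"

type_synonym 'x program = "'x instr list"

fun operand_val :: "('x \<Rightarrow> complex option) \<Rightarrow> complex list \<Rightarrow> 'x operand \<Rightarrow> complex option" where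
  "operand_val inp rs Zero = Some 0"
| "operand_val inp rs One = Some 1"
| "operand_val inp rs (Input x) = inp x"
| "operand_val inp rs (Result j) = (if j < length rs then Some (rs ! j) else None)"

text \<open>Division by zero is a run-time failure.\<close>

fun instr_val :: "('x \<Rightarrow> complex option) \<Rightarrow> complex list \<Rightarrow> 'x instr \<Rightarrow> complex option" where
  "instr_val inp rs (MulAdd p q r) = do {
     x \<leftarrow> operand_val inp rs p; y \<leftarrow> operand_val inp rs q; z \<leftarrow> operand_val inp rs r;
     Some (x * y + z) }"
| "instr_val inp rs (Sub p q) = do {
     x \<leftarrow> operand_val inp rs p; y \<leftarrow> operand_val inp rs q; Some (x - y) }"
| "instr_val inp rs (Div p q) = do {
     x \<leftarrow> operand_val inp rs p; y \<leftarrow> operand_val inp rs q;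
     if y = 0 then None else Some (x / y) }"
| "instr_val inp rs (Sqrt p) = do { x \<leftarrow> operand_val inp rs p; Some (csqrt x) }"

fun run :: "('x \<Rightarrow> complex option) \<Rightarrow> 'x program \<Rightarrow> complex list \<Rightarrow> complex list option" where
  "run inp [] rs = Some rs"
| "run inp (c # cs) rs = do { z \<leftarrow> instr_val inp rs c; run inp cs (rs @ [z]) }"

definition operation_count :: "'x program \<Rightarrow> nat" where
  "operation_count P = length P"

text \<open>\<open>out\<close> says where each of the required values is found at the end.\<close>

definition computes ::
    "'x program \<Rightarrow> ('j \<Rightarrow> 'x operand) \<Rightarrow> ('x \<Rightarrow> complex option) \<Rightarrow> 'j set \<Rightarrow> ('j \<Rightarrow> complex) \<Rightarrow> bool" where
  "computes P out inp J v \<longleftrightarrow>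
     (\<exists>rs. run inp P [] = Some rs \<and> (\<forall>j\<in>J. operand_val inp rs (out j) = Some (v j)))"

datatype johnson_label = Param_n | Param_k | Coord "nat list"

definition johnson_input ::
    "nat \<Rightarrow> nat \<Rightarrow> (nat list \<Rightarrow> complex) \<Rightarrow> johnson_label \<Rightarrow> complex option" where
  "johnson_input n k v l = (case l of
       Param_n \<Rightarrow> Some (of_nat n)
     | Param_k \<Rightarrow> Some (of_nat k)
     | Coord x \<Rightarrow> if x \<in> johnson_words n k then Some (v x) else None)"

end

theory Submission
  imports Defs
begin

text \<open>What shapes the construction is the cost model. Programs know only the constants 0 and
  1, so every coefficient has to be cheap to produce. The vectors are therefore left unnormalized,
  with integer coefficients: the second extension is the Gram-Schmidt complement of
  \<open>y + x\<close> in the plane of \<open>x\<close> and \<open>y\<close>, scaled to clear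
  denominators. Squared norms are propagated by the same recursion instead of being evaluated from a
  closed form, and square roots and divisions occur only at the last level. Formally there are
  \<open>2 ^ n\<close> pairs \<open>(t, S)\<close> at every level. Those with a vanishing vector
  cost nothing, because both of their values are the constant 0; the dimension of the function space
  bounds the number of the others. The norm ratio is that of two neighbouring binomial coefficients,
  \<open>i - 2 * a\<close> over \<open>m - a\<close> and over \<open>m - a - 1\<close>. Membership
  in an isotypic component is proved by exhibiting one explicit copy of the Specht module that
  contains the vector; that the vectors form a basis follows from orthogonality and a spanning
  argument.\<close>

text \<open>
  Gelfand-Tsetlin vectors are built one letter at a time. For a path \<open>t\<close> of \<open>i\<close> steps in the
  Young graph and a set \<open>S\<close> of positions \<open>\<ge> i\<close>, let \<open>v t S\<close> be the vector of type \<open>t\<close> supported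
  on the words whose letters \<open>1\<close> from position \<open>i\<close> on are those in \<open>S\<close>. Put \<open>x = v t S\<close> and
  \<open>y = v t (insert i S)\<close> with \<open>i \<notin> S\<close>, let \<open>a\<close> be the length of the second row of \<open>t\<close>, and
  \<open>m = k - card S\<close>. The two extensions of \<open>t\<close> are \<open>y + x\<close> and
  \<open>(i + 1 - a - m) * y - (m - a) * x\<close>; they are orthogonal because the squared norms of \<open>x\<close> and
  \<open>y\<close> have the ratio \<open>(i + 1 - a - m) / (m - a)\<close>. At every level the nonzero vectors are
  orthogonal, hence at most \<open>n choose k\<close> in number, and the inner product of \<open>f\<close> with each of them,
  as well as its squared norm, costs a bounded number of operations given those of the previous level.
  Finally \<open>v t S\<close> is a combination of products of \<open>a\<close> differences \<open>x\<^sub>q - x\<^sub>p\<close> of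
  indicators of positions, which are the images of polytabloids under an equivariant embedding of the
  Specht module, so it lies in the right isotypic component.
\<close>

section \<open>Orthogonal families\<close>

lemma fscale_apply: "fscale c f x = c * f x"
  by (simp add: fscale_def)

lemma sum_fun_apply: "(\<Sum>i\<in>I. f i) x = (\<Sum>i\<in>I. f i x)"
  by (induction I rule: infinite_finite_induct) simp_all

lemma johnson_inner_sum_left:
  "johnson_inner n k (\<Sum>i\<in>I. fscale (c i) (f i)) g = (\<Sum>i\<in>I. c i * johnson_inner n k (f i) g)"
proof (induction I rule: infinite_finite_induct)
  case (insert i I)
  then show ?case
    by (simp add: johnson_inner_def fscale_apply algebra_simps sum.distrib sum_distrib_left)
qed (simp_all add: johnson_inner_def)

lemma orthogonal_family_independent:
  assumes "finite I"
    and orth: "\<And>i j. i \<in> I \<Longrightarrow> j \<in> I \<Longrightarrow> i \<noteq> j \<Longrightarrow> johnson_inner n k (B i) (B j) = 0"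
    and nz: "\<And>i. i \<in> I \<Longrightarrow> johnson_inner n k (B i) (B i) \<noteq> 0"
  shows "inj_on B I" and "cfun.independent (B ` I)"
proof -
  show inj: "inj_on B I"
    by (metis inj_onI nz orth)
  have "u v = 0" if sum0: "(\<Sum>v\<in>B ` I. fscale (u v) v) = 0" and v: "v \<in> B ` I" for u v
  proof -
    from v obtain j where j: "j \<in> I" "v = B j" by auto
    have "(\<Sum>i\<in>I. fscale (u (B i)) (B i)) = 0"
      using sum0 by (simp add: sum.reindex[OF inj])
    then have "(\<Sum>i\<in>I. u (B i) * johnson_inner n k (B i) (B j)) = 0"
      using johnson_inner_sum_left[of n k "\<lambda>i. u (B i)" B I "B j"]
      by (simp add: johnson_inner_def)
    moreover have "(\<Sum>i\<in>I. u (B i) * johnson_inner n k (B i) (B j))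
        = (\<Sum>i\<in>I. if i = j then u (B j) * johnson_inner n k (B j) (B j) else 0)"
      using orth j by (intro sum.cong) auto
    ultimately show ?thesis
      using nz[of j] j \<open>finite I\<close> by simp
  qed
  then show "cfun.independent (B ` I)"
    using \<open>finite I\<close> by (auto simp: cfun.dependent_finite)
qed

text \<open>The second part replaces coordinates, which are defined through
  \<open>cfun.representation\<close>, by inner products; only the latter satisfy a recursion that a
  program can follow.\<close>

lemma orthonormal_basis:
  assumes "finite I"
    and orth: "\<And>i j. i \<in> I \<Longrightarrow> j \<in> I \<Longrightarrow> johnson_inner n k (B i) (B j) = (if i = j then 1 else 0)"
    and span: "cfun.span (B ` I) = V"
  shows "is_basis I B V"
    and "\<And>f i. f \<in> V \<Longrightarrow> i \<in> I \<Longrightarrow> coords I B f i = johnson_inner n k f (B i)"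
proof -
  have inj: "inj_on B I" and ind: "cfun.independent (B ` I)"
    using orthogonal_family_independent[OF \<open>finite I\<close>, of n k B] orth by auto
  show "is_basis I B V"
    using inj ind span by (simp add: is_basis_def)
  fix f j assume f: "f \<in> V" and j: "j \<in> I"
  have "(\<Sum>b\<in>B ` I. fscale (cfun.representation (B ` I) f b) b) = f"
    using cfun.sum_representation_eq[OF ind] f span \<open>finite I\<close> by auto
  then have "f = (\<Sum>i\<in>I. fscale (coords I B f i) (B i))"
    by (simp add: sum.reindex[OF inj] coords_def)
  then have "johnson_inner n k f (B j) = (\<Sum>i\<in>I. coords I B f i * johnson_inner n k (B i) (B j))"
    using johnson_inner_sum_left[of n k "coords I B f" B I "B j"] by simp
  also have "\<dots> = (\<Sum>i\<in>I. if i = j then coords I B f j else 0)"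
    using orth j by (intro sum.cong) auto
  finally show "coords I B f j = johnson_inner n k f (B j)"
    using j \<open>finite I\<close> by simp
qed


section \<open>Words and subsets\<close>

lemma word_subset_subset: "word_subset w \<subseteq> {..<length w}"
  by (auto simp: word_subset_def)

lemma finite_word_subset [simp]: "finite (word_subset w)"
  using finite_subset[OF word_subset_subset] by blast

lemma card_word_subset: "card (word_subset w) = count_list w 1"
proof -
  have "count_list w 1 = length (filter (\<lambda>y. y = 1) w)"
    by (induction w) auto
  then show ?thesis
    by (simp add: length_filter_conv_card word_subset_def)
qed

lemma bij_betw_word_subset:
  "bij_betw word_subset (johnson_words n k) {K. K \<subseteq> {..<n} \<and> card K = k}"
proof (rule bij_betwI')
  fix v w assume v: "v \<in> johnson_words n k" and w: "w \<in> johnson_words n k"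
  have "v = w" if eq: "word_subset v = word_subset w"
  proof (rule nth_equalityI)
    show len: "length v = length w"
      using v w by (simp add: johnson_words_def)
    fix j assume j: "j < length v"
    have "set v \<subseteq> {1, 2}" "set w \<subseteq> {1, 2}"
      using v w by (simp_all add: johnson_words_def)
    then have "v ! j \<in> {1, 2}" "w ! j \<in> {1, 2}"
      using j len nth_mem by (blast, metis nth_mem subsetD)
    moreover have "v ! j = 1 \<longleftrightarrow> w ! j = 1"
      using eq j len by (auto simp: word_subset_def)
    ultimately show "v ! j = w ! j" by auto
  qed
  then show "word_subset v = word_subset w \<longleftrightarrow> v = w" by auto
next
  fix w assume w: "w \<in> johnson_words n k"
  then show "word_subset w \<in> {K. K \<subseteq> {..<n} \<and> card K = k}"
    using word_subset_subset[of w] by (simp add: card_word_subset johnson_words_def)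
next
  fix K assume K: "K \<in> {K. K \<subseteq> {..<n} \<and> card K = k}"
  define w where "w = map (\<lambda>j. if j \<in> K then 1 else 2 :: nat) [0..<n]"
  have "word_subset w = K"
    using K by (auto simp: word_subset_def w_def split: if_splits)
  moreover from this have "w \<in> johnson_words n k"
    using K card_word_subset[of w] by (auto simp: johnson_words_def w_def)
  ultimately show "\<exists>w\<in>johnson_words n k. K = word_subset w" by blast
qed

lemma finite_johnson_words [simp]: "finite (johnson_words n k)"
  using bij_betw_finite[OF bij_betw_word_subset[of n k]] by simp

lemma card_johnson_words: "card (johnson_words n k) = n choose k"
  using bij_betw_same_card[OF bij_betw_word_subset[of n k]] by (simp add: n_subsets)

lemma word_act_in_johnson_words:
  assumes "\<sigma> \<in> sym_group i" "i \<le> n"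
  shows "word_act \<sigma> w \<in> johnson_words n k \<longleftrightarrow> w \<in> johnson_words n k"
proof (cases "length w = n")
  case True
  have "\<sigma> permutes {..<n}"
    using assms by (auto simp: sym_group_def intro: permutes_subset)
  then have "inv \<sigma> permutes {..<length w}"
    by (simp add: permutes_inv True)
  then have "mset (word_act \<sigma> w) = mset w"
    by (simp add: word_act_def)
  then have "set (word_act \<sigma> w) = set w" "count_list (word_act \<sigma> w) 1 = count_list w 1"
    using mset_eq_setD by (blast, metis count_mset)
  then show ?thesis
    by (simp add: johnson_words_def word_act_def)
next
  case False
  then show ?thesis
    by (simp add: johnson_words_def word_act_def)
qed

lemma delta_orthonormal:
  assumes "x \<in> johnson_words n k" "y \<in> johnson_words n k"
  shows "johnson_inner n k (delta x) (delta y) = (if x = y then 1 else 0)"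
proof -
  have "johnson_inner n k (delta x) (delta y)
      = (\<Sum>z\<in>johnson_words n k. if z = x then (if x = y then 1 else 0) else 0)"
    unfolding johnson_inner_def by (intro sum.cong) (auto simp: delta_def)
  then show ?thesis using assms by simp
qed

lemma johnson_funs_expand:
  assumes "f \<in> johnson_funs n k"
  shows "f = (\<Sum>x\<in>johnson_words n k. fscale (f x) (delta x))"
proof
  fix w
  have "(\<Sum>x\<in>johnson_words n k. fscale (f x) (delta x)) w
      = (\<Sum>x\<in>johnson_words n k. f x * delta x w)"
    by (simp add: sum_fun_apply fscale_apply)
  also have "\<dots> = (\<Sum>x\<in>johnson_words n k. if x = w then f w else 0)"
    by (intro sum.cong) (auto simp: delta_def)
  also have "\<dots> = f w"
    using assms by (simp add: johnson_funs_def)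
  finally show "f w = (\<Sum>x\<in>johnson_words n k. fscale (f x) (delta x)) w" by simp
qed

lemma subspace_johnson_funs: "cfun.subspace (johnson_funs n k)"
  by (rule cfun.subspaceI) (auto simp: johnson_funs_def fscale_apply)

lemma span_delta: "cfun.span (delta ` johnson_words n k) = johnson_funs n k"
proof
  show "cfun.span (delta ` johnson_words n k) \<subseteq> johnson_funs n k"
    by (rule cfun.span_minimal[OF _ subspace_johnson_funs]) (auto simp: johnson_funs_def delta_def)
  show "johnson_funs n k \<subseteq> cfun.span (delta ` johnson_words n k)"
  proof
    fix f assume "f \<in> johnson_funs n k"
    then have "f = (\<Sum>x\<in>johnson_words n k. fscale (f x) (delta x))"
      by (rule johnson_funs_expand)
    also have "\<dots> \<in> cfun.span (delta ` johnson_words n k)"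
      by (intro cfun.span_sum cfun.span_scale cfun.span_base) auto
    finally show "f \<in> cfun.span (delta ` johnson_words n k)" .
  qed
qed

lemma coords_delta:
  assumes "f \<in> johnson_funs n k" "x \<in> johnson_words n k"
  shows "coords (johnson_words n k) delta f x = f x"
proof -
  have "coords (johnson_words n k) delta f x = johnson_inner n k f (delta x)"
    by (rule orthonormal_basis(2)[OF finite_johnson_words delta_orthonormal span_delta assms])
  also have "\<dots> = (\<Sum>z\<in>johnson_words n k. if z = x then f x else 0)"
    unfolding johnson_inner_def by (intro sum.cong) (auto simp: delta_def)
  finally show ?thesis using assms by simp
qed

section \<open>A product formula for Gelfand-Tsetlin vectors\<close>

text \<open>A path in the Young graph is a list of booleans, with the last step at the head;
  \<open>True\<close> stands for a box added to the second row.\<close>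

definition row2 :: "bool list \<Rightarrow> nat" where
  "row2 t = count_list t True"

lemma row2_simps [simp]: "row2 [] = 0" "row2 (b # t) = (if b then Suc (row2 t) else row2 t)"
  by (simp_all add: row2_def)

text \<open>These are the lattice words of the standard Young tableaux with at most two
  rows.\<close>

primrec ballot :: "bool list \<Rightarrow> bool" where
  "ballot [] = True"
| "ballot (b # t) = (2 * row2 (b # t) \<le> Suc (length t) \<and> ballot t)"

text \<open>The argument \<open>m\<close> is counted at the new level: it is the number of ones
  among the first \<open>length t + 1\<close> letters, the new letter included.
  \<open>coeff_in\<close> applies if the new letter is a one, \<open>coeff_out\<close>
  otherwise.\<close>

definition coeff_in :: "bool \<Rightarrow> bool list \<Rightarrow> int \<Rightarrow> int" where
  "coeff_in b t m = (if b then int (length t) + 1 - (int (row2 t) + m) else 1)"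

definition coeff_out :: "bool \<Rightarrow> bool list \<Rightarrow> int \<Rightarrow> int" where
  "coeff_out b t m = (if b then int (row2 t) - m else 1)"

text \<open>Where the coefficients come from: let \<open>E\<close> be a function on \<open>a\<close>-subsets of \<open>{..<i}\<close>
  that generates a Specht module, and \<open>V\<close> the function on all subsets that is obtained from it by
  summation over the \<open>a\<close>-subsets of the argument. A step to the second row replaces \<open>E\<close> by
  \<open>(i - 2 * a) * x\<^sub>i * E - U E\<close>, where \<open>U\<close> is the raising operator and
  \<open>x\<^sub>i\<close> adjoins \<open>i\<close>; on \<open>V\<close> this is multiplication by the coefficients above.\<close>

primrec gt_val :: "bool list \<Rightarrow> nat set \<Rightarrow> int" where
  "gt_val [] K = 1"
| "gt_val (b # t) K = (if length t \<in> K then coeff_in b t (int (card (K \<inter> {..length t})))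
     else coeff_out b t (int (card (K \<inter> {..length t})))) * gt_val t K"

section \<open>Support of the values and the ballot condition\<close>

lemma Int_atMost_split:
  "(K :: nat set) \<inter> {..i} = (if i \<in> K then insert i (K \<inter> {..<i}) else K \<inter> {..<i})"
  by (auto simp: less_le)

lemma card_Int_atMost:
  "card ((K :: nat set) \<inter> {..i}) = (if i \<in> K then Suc (card (K \<inter> {..<i})) else card (K \<inter> {..<i}))"
  by (simp add: Int_atMost_split)

lemma gt_val_cong:
  assumes "K \<inter> {..<length t} = L \<inter> {..<length t}"
  shows "gt_val t K = gt_val t L"
  using assms
proof (induction t)
  case (Cons b t)
  have 1: "length t \<in> K \<longleftrightarrow> length t \<in> L"
    using Cons.prems by (auto simp: set_eq_iff)
  have 2: "K \<inter> {..length t} = L \<inter> {..length t}"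
    using Cons.prems by (simp add: lessThan_Suc_atMost)
  have "K \<inter> {..<length t} = (K \<inter> {..<length (b # t)}) \<inter> {..<length t}"
    "L \<inter> {..<length t} = (L \<inter> {..<length (b # t)}) \<inter> {..<length t}" by auto
  then have "K \<inter> {..<length t} = L \<inter> {..<length t}"
    using Cons.prems by simp
  then show ?case
    using Cons.IH 1 2 by simp
qed simp

text \<open>A step to the second row shrinks the admissible range of sizes at both ends, and the
  coefficients are zero exactly there: \<open>coeff_out\<close> at \<open>m = row2 t\<close>, and
  \<open>coeff_in\<close> at \<open>m = length t + 1 - row2 t\<close>.\<close>

lemma gt_val_support:
  assumes "gt_val t K \<noteq> 0"
  shows "row2 t \<le> card (K \<inter> {..<length t}) \<and> card (K \<inter> {..<length t}) + row2 t \<le> length t"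
  using assms
proof (induction t)
  case (Cons b t)
  then have IH: "row2 t \<le> card (K \<inter> {..<length t})"
    "card (K \<inter> {..<length t}) + row2 t \<le> length t" by auto
  then show ?case
    using Cons.prems
    by (auto simp: lessThan_Suc_atMost card_Int_atMost coeff_in_def coeff_out_def split: if_splits)
qed simp

text \<open>Adding the two bounds of \<open>gt_val_support\<close> gives the ballot inequality for
  every initial path. Paths that leave the Young graph thus yield zero vectors and may be carried
  along.\<close>

lemma gt_val_nonzero_imp_ballot: "gt_val t K \<noteq> 0 \<Longrightarrow> ballot t"
proof (induction t)
  case (Cons b t)
  then show ?case
    using gt_val_support[OF Cons.prems] by auto
qed simp

lemma ballot_row2_le: "ballot t \<Longrightarrow> 2 * row2 t \<le> length t"
  by (cases t) auto

lemma ballot_imp_gt_val_nonzero: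
  assumes "ballot t" "row2 t \<le> m" "m + row2 t \<le> length t"
  shows "\<exists>K\<subseteq>{..<length t}. card K = m \<and> gt_val t K \<noteq> 0"
  using assms
proof (induction t arbitrary: m)
  case (Cons b t)
  let ?i = "length t"
  have t: "ballot t" "2 * row2 t \<le> ?i"
    using Cons.prems ballot_row2_le by auto
  have Int: "K \<inter> {..?i} = K" if "K \<subseteq> {..<?i}" for K
    using that by auto
  show ?case
  proof (cases "m + row2 t \<le> ?i")
    case True
    then obtain K where K: "K \<subseteq> {..<?i}" "card K = m" "gt_val t K \<noteq> 0"
      using Cons.IH[of m] t Cons.prems by (auto split: if_splits)
    then have "gt_val (b # t) K \<noteq> 0"
      using Cons.prems Int[OF K(1)] by (auto simp: coeff_out_def split: if_splits)
    then show ?thesis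
      using K by (intro exI[of _ K]) auto
  \<comment> \<open>Here \<open>m + row2 t = Suc ?i\<close>. This is too large for a step to the
    second row, so \<open>b\<close> is false, and the new position has to belong to the set.\<close>
  next
    case False
    with Cons.prems t have b: "\<not> b" and m: "m = Suc (m - 1)" "row2 t \<le> m - 1" "m - 1 + row2 t \<le> ?i"
      by (auto split: if_splits)
    then obtain K where K: "K \<subseteq> {..<?i}" "card K = m - 1" "gt_val t K \<noteq> 0"
      using Cons.IH[of "m - 1"] t by auto
    have "gt_val t (insert ?i K) = gt_val t K"
      by (rule gt_val_cong) auto
    then have "gt_val (b # t) (insert ?i K) \<noteq> 0"
      using b K by (auto simp: coeff_in_def)
    moreover have "card (insert ?i K) = m"
      using K m finite_subset[OF K(1)] by (subst card_insert_disjoint) auto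
    ultimately show ?thesis
      using K by (intro exI[of _ "insert ?i K"]) auto
  qed
qed simp

section \<open>Inner products on layers of subsets of fixed size\<close>

definition gt_ip :: "bool list \<Rightarrow> bool list \<Rightarrow> int \<Rightarrow> int" where
  "gt_ip t t' m = (\<Sum>K | K \<subseteq> {..<length t} \<and> int (card K) = m. gt_val t K * gt_val t' K)"

text \<open>The sets of size \<open>m\<close> are split by membership of the last position; on each
  class the coefficients depend on \<open>m\<close> only. The size is an integer, so that the layer
  below the empty set is simply empty and needs no special case.\<close>

lemma gt_ip_Cons:
  assumes len: "length t' = length t"
  shows "gt_ip (b # t) (b' # t') m =
    coeff_in b t m * coeff_in b' t' m * gt_ip t t' (m - 1) +
    coeff_out b t m * coeff_out b' t' m * gt_ip t t' m"
proof -
  let ?i = "length t" and ?F = "\<lambda>K. gt_val (b # t) K * gt_val (b' # t') K"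
  let ?A = "{K. K \<subseteq> {..<?i} \<and> int (card K) = m}"
  let ?B = "{K. K \<subseteq> {..<?i} \<and> int (card K) = m - 1}"
  have fin: "finite ?A" "finite ?B"
    by (auto intro: finite_subset[of _ "Pow {..<?i}"])
  have fK: "finite K" "?i \<notin> K" if "K \<subseteq> {..<?i}" for K
    using that finite_subset by auto
  have inj: "inj_on (insert ?i) ?B"
    by (rule inj_onI) (metis (mono_tags, lifting) fK(2) insert_ident mem_Collect_eq)
  have "{K. K \<subseteq> {..<Suc ?i} \<and> int (card K) = m} = ?A \<union> insert ?i ` ?B"
  proof (intro equalityI subsetI)
    fix K assume K: "K \<in> {K. K \<subseteq> {..<Suc ?i} \<and> int (card K) = m}"
    then have fin: "finite K" using finite_subset by auto
    show "K \<in> ?A \<union> insert ?i ` ?B"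
    proof (cases "?i \<in> K")
      case True
      then have "card K = Suc (card (K - {?i}))"
        using fin by (metis card.remove)
      moreover have "K - {?i} \<subseteq> {..<?i}" using K by (auto simp: less_Suc_eq)
      ultimately have "K - {?i} \<in> ?B" using K by simp
      then have "insert ?i (K - {?i}) \<in> insert ?i ` ?B" by (rule imageI)
      then show ?thesis using True by (simp add: insert_absorb)
    next
      case False
      then have "K \<subseteq> {..<?i}" using K by (metis (no_types, lifting) lessThan_Suc mem_Collect_eq subset_insert)
      then show ?thesis using K by simp
    qed
  next
    fix K assume "K \<in> ?A \<union> insert ?i ` ?B"
    then show "K \<in> {K. K \<subseteq> {..<Suc ?i} \<and> int (card K) = m}"
      using fK by (auto simp: lessThan_Suc)
  qed
  then have "gt_ip (b # t) (b' # t') m = (\<Sum>K\<in>?A \<union> insert ?i ` ?B. ?F K)"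
    by (simp only: gt_ip_def list.size add_Suc_right add_0_right)
  also have "\<dots> = (\<Sum>K\<in>?A. ?F K) + (\<Sum>K\<in>insert ?i ` ?B. ?F K)"
    using fin fK by (intro sum.union_disjoint) auto
  also have "(\<Sum>K\<in>insert ?i ` ?B. ?F K) = (\<Sum>K\<in>?B. ?F (insert ?i K))"
    using inj by (simp add: sum.reindex)
  also have "\<dots> = (\<Sum>K\<in>?B. coeff_in b t m * coeff_in b' t' m * (gt_val t K * gt_val t' K))"
  proof (rule sum.cong)
    fix K assume K: "K \<in> ?B"
    then have 1: "insert ?i K \<inter> {..?i} = insert ?i K" by auto
    have 2: "gt_val t (insert ?i K) = gt_val t K" "gt_val t' (insert ?i K) = gt_val t' K"
      by (rule gt_val_cong, auto simp: len)+
    have "int (card (insert ?i K)) = m" using K fK by auto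
    then show "?F (insert ?i K) = coeff_in b t m * coeff_in b' t' m * (gt_val t K * gt_val t' K)"
      by (simp add: 1 2 len)
  qed simp
  also have "\<dots> = coeff_in b t m * coeff_in b' t' m * gt_ip t t' (m - 1)"
    by (simp add: gt_ip_def sum_distrib_left)
  also have "(\<Sum>K\<in>?A. ?F K) = (\<Sum>K\<in>?A. coeff_out b t m * coeff_out b' t' m * (gt_val t K * gt_val t' K))"
  proof (rule sum.cong)
    fix K assume K: "K \<in> ?A"
    then have "K \<inter> {..?i} = K" by auto
    then show "?F K = coeff_out b t m * coeff_out b' t' m * (gt_val t K * gt_val t' K)"
      using K fK by (auto simp: len)
  qed simp
  also have "\<dots> = coeff_out b t m * coeff_out b' t' m * gt_ip t t' m"
    by (simp add: gt_ip_def sum_distrib_left)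
  finally show ?thesis by simp
qed

lemma gt_ip_Nil: "gt_ip [] [] m = (if m = 0 then 1 else 0)"
proof -
  have "{K :: nat set. K \<subseteq> {..<length ([] :: bool list)} \<and> int (card K) = m} = (if m = 0 then {{}} else {})"
    by auto
  then show ?thesis by (simp add: gt_ip_def)
qed

text \<open>With \<open>i = length t\<close> and \<open>a = row2 t\<close>, the squared norm in
  layer \<open>m\<close> is proportional to the binomial coefficient \<open>i - 2 * a\<close> over
  \<open>m - a\<close>. The multiplied form also holds at and beyond the ends of the range. In the
  induction, a step to the first row adds the norms of two neighbouring layers, as in Pascal's rule;
  after a step to the second row the norms in layers \<open>m\<close> and \<open>m - 1\<close> are
  both explicit multiples of the single norm \<open>y\<close>.\<close>

lemma gt_ip_ratio:
  "(m - int (row2 t)) * gt_ip t t m = (int (length t) + 1 - int (row2 t) - m) * gt_ip t t (m - 1)"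
proof (induction t arbitrary: m)
  case Nil
  show ?case by (simp add: gt_ip_Nil)
next
  case (Cons b t)
  define i a where "i = int (length t)" and "a = int (row2 t)"
  define x y z where "x = gt_ip t t m" and "y = gt_ip t t (m - 1)" and "z = gt_ip t t (m - 1 - 1)"
  have 1: "(m - a) * x = (i + 1 - a - m) * y"
    using Cons.IH[of m] by (simp add: x_def y_def i_def a_def)
  have 2: "(m - 1 - a) * y = (i + 1 - a - (m - 1)) * z"
    using Cons.IH[of "m - 1"] by (simp add: z_def y_def i_def a_def)
  show ?case
  proof (cases b)
    case True
    have "gt_ip (b # t) (b # t) m = (i + 1 - (a + m)) * (i + 1 - (a + m)) * y + (a - m) * (a - m) * x"
      using True by (simp add: gt_ip_Cons coeff_in_def coeff_out_def x_def y_def i_def a_def)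
    \<comment> \<open>Grouped so that equation 1 makes the second summand a multiple of
      \<open>y\<close>; the factors \<open>i + 1 - a - m\<close> and \<open>m - a\<close> then add
      up to \<open>i + 1 - 2 * a\<close>.\<close>
    also have "(a - m) * (a - m) * x = (m - a) * ((m - a) * x)" by algebra
    also have "(i + 1 - (a + m)) * (i + 1 - (a + m)) * y + (m - a) * ((m - a) * x)
        = (i + 1 - 2 * a) * (i + 1 - a - m) * y"
      unfolding 1 by algebra
    finally have 3: "gt_ip (b # t) (b # t) m = (i + 1 - 2 * a) * (i + 1 - a - m) * y" .
    have "gt_ip (b # t) (b # t) (m - 1) = (i + 1 - (a + (m - 1))) * (i + 1 - (a + (m - 1))) * z
        + (a - (m - 1)) * (a - (m - 1)) * y"
      using True by (simp add: gt_ip_Cons coeff_in_def coeff_out_def z_def y_def i_def a_def)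
    also have "\<dots> = (i + 1 - (a + (m - 1))) * ((i + 1 - a - (m - 1)) * z)
        + (a - (m - 1)) * (a - (m - 1)) * y" by algebra
    also have "\<dots> = (i + 1 - 2 * a) * (m - 1 - a) * y"
      unfolding 2[symmetric] by algebra
    finally have 4: "gt_ip (b # t) (b # t) (m - 1) = (i + 1 - 2 * a) * (m - 1 - a) * y" .
    have r: "int (row2 (b # t)) = a + 1" "int (length (b # t)) = i + 1"
      using True by (simp_all add: i_def a_def)
    show ?thesis
      unfolding 3 4 r by algebra
  next
    case False
    have 3: "gt_ip (b # t) (b # t) m = x + y" "gt_ip (b # t) (b # t) (m - 1) = y + z"
      using False by (simp_all add: gt_ip_Cons coeff_in_def coeff_out_def x_def y_def z_def)
    have r: "int (row2 (b # t)) = a" "int (length (b # t)) = i + 1"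
      using False by (simp_all add: i_def a_def)
    show ?thesis
      unfolding 3 r using 1 2 by algebra
  qed
qed

lemma gt_ip_commute: "length t' = length t \<Longrightarrow> gt_ip t t' m = gt_ip t' t m"
  by (simp add: gt_ip_def mult.commute)

text \<open>If the paths differ before the last step, the inner products in both layers vanish by
  induction. If they differ in the last step only, the cross term is the difference of the two sides
  of \<open>gt_ip_ratio\<close>.\<close>

lemma gt_ip_orthogonal:
  assumes "length t = length t'" "t \<noteq> t'"
  shows "gt_ip t t' m = 0"
  using assms
proof (induction t t' arbitrary: m rule: list_induct2)
  case (Cons b t b' t')
  show ?case
  proof (cases "t = t'")
    case False
    then show ?thesis using Cons by (simp add: gt_ip_Cons)
  next
    case True
    have "gt_ip (True # t) (False # t) m = 0"
      using gt_ip_ratio[of m t]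
      by (simp add: gt_ip_Cons coeff_in_def coeff_out_def algebra_simps)
    then show ?thesis
      using True Cons.prems gt_ip_commute[of "True # t" "False # t"] by (cases b; cases b') auto
  qed
qed simp

lemma gt_ip_pos:
  assumes "K \<subseteq> {..<length t}" "int (card K) = m" "gt_val t K \<noteq> 0"
  shows "gt_ip t t m > 0"
  unfolding gt_ip_def using assms
  by (intro sum_pos2[where i = K]) (auto intro: finite_subset[of _ "Pow {..<length t}"] simp: zero_less_mult_iff)

section \<open>Vectors on words with a prescribed suffix\<close>

definition suffix_lift ::
    "nat \<Rightarrow> nat \<Rightarrow> nat \<Rightarrow> nat set \<Rightarrow> (nat set \<Rightarrow> complex) \<Rightarrow> nat list \<Rightarrow> complex" where
  "suffix_lift n k i S h w =
     (if w \<in> johnson_words n k \<and> word_subset w \<inter> {i..} = S then h (word_subset w) else 0)"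

definition gt_vec :: "nat \<Rightarrow> nat \<Rightarrow> bool list \<Rightarrow> nat set \<Rightarrow> nat list \<Rightarrow> complex" where
  "gt_vec n k t S = suffix_lift n k (length t) S (\<lambda>K. of_int (gt_val t K))"

lemma suffix_lift_in_johnson_funs: "suffix_lift n k i S h \<in> johnson_funs n k"
  by (simp add: suffix_lift_def johnson_funs_def)

lemma gt_vec_in_johnson_funs: "gt_vec n k t S \<in> johnson_funs n k"
  by (simp add: gt_vec_def suffix_lift_in_johnson_funs)

lemma card_word_subset_split:
  assumes "w \<in> johnson_words n k" "word_subset w \<inter> {i..} = S"
  shows "card (word_subset w \<inter> {..<i}) + card S = k"
proof -
  have "word_subset w = (word_subset w \<inter> {..<i}) \<union> (word_subset w \<inter> {i..})"
    by auto
  also have "card \<dots> = card (word_subset w \<inter> {..<i}) + card (word_subset w \<inter> {i..})"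
    by (rule card_Un_disjoint) auto
  finally have "card (word_subset w) = card (word_subset w \<inter> {..<i}) + card (word_subset w \<inter> {i..})" .
  then show ?thesis
    using assms by (simp add: card_word_subset johnson_words_def)
qed

text \<open>The coefficients of \<open>gt_val\<close> depend on the set through the number of ones
  up to position \<open>length t\<close>. On the words selected by \<open>S\<close> this number is
  \<open>k - card S\<close>, so they become scalars and the recursion is linear in the
  vectors.\<close>

lemma gt_vec_Cons:
  assumes S: "S \<subseteq> {Suc (length t)..}"
  shows "gt_vec n k (b # t) S =
    fscale (of_int (coeff_in b t (int k - int (card S)))) (gt_vec n k t (insert (length t) S)) +
    fscale (of_int (coeff_out b t (int k - int (card S)))) (gt_vec n k t S)"
proof
  fix w
  let ?i = "length t" and ?K = "word_subset w"
  show "gt_vec n k (b # t) S w =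
    (fscale (of_int (coeff_in b t (int k - int (card S)))) (gt_vec n k t (insert (length t) S)) +
    fscale (of_int (coeff_out b t (int k - int (card S)))) (gt_vec n k t S)) w"
  proof (cases "w \<in> johnson_words n k \<and> ?K \<inter> {Suc ?i..} = S")
    case True
    then have "card (?K \<inter> {..<Suc ?i}) + card S = k"
      by (intro card_word_subset_split) auto
    then have m: "int (card (?K \<inter> {..?i})) = int k - int (card S)"
      by (simp add: lessThan_Suc_atMost)
    have "{?i..} = insert ?i {Suc ?i..}" by auto
    then have "?K \<inter> {?i..} = (if ?i \<in> ?K then insert ?i S else S)"
      by (simp add: Int_insert_right True)
    moreover have "?i \<notin> S" using S by auto
    ultimately show ?thesis
      using True m by (auto simp: gt_vec_def suffix_lift_def fscale_apply)
  next
    case False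
    have "?K \<inter> {Suc ?i..} = S" if "?K \<inter> {?i..} = insert ?i S \<or> ?K \<inter> {?i..} = S"
    proof -
      have "?K \<inter> {Suc ?i..} = (?K \<inter> {?i..}) \<inter> {Suc ?i..}" by auto
      then show ?thesis using that S by auto
    qed
    with False show ?thesis
      by (auto simp: gt_vec_def suffix_lift_def fscale_apply)
  qed
qed

text \<open>Different suffix sets have disjoint supports. For equal ones, deleting \<open>S\<close>
  identifies the relevant words with the subsets of \<open>{..<i}\<close> of size
  \<open>k - card S\<close>, and \<open>gt_val\<close> does not see the deleted part.\<close>

lemma gt_vec_inner:
  assumes "length t = i" "length t' = i" "i \<le> n" "S \<subseteq> {i..<n}" "S' \<subseteq> {i..<n}"
  shows "johnson_inner n k (gt_vec n k t S) (gt_vec n k t' S') =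
    (if S = S' then of_int (gt_ip t t' (int k - int (card S))) else 0)"
proof (cases "S = S'")
  case False
  then show ?thesis
    using assms unfolding johnson_inner_def
    by (auto intro!: sum.neutral simp: gt_vec_def suffix_lift_def split: if_splits)
next
  case True
  let ?G = "\<lambda>K. gt_val t K * gt_val t' K"
  let ?A = "{K. K \<subseteq> {..<n} \<and> card K = k}"
  let ?B = "{K. K \<subseteq> {..<i} \<and> int (card K) = int k - int (card S)}"
  let ?h = "\<lambda>K. if K \<inter> {i..} = S then of_int (?G K) else (0 :: complex)"
  have finS: "finite S" using assms(4) finite_subset by blast
  have "johnson_inner n k (gt_vec n k t S) (gt_vec n k t' S') = (\<Sum>w\<in>johnson_words n k. ?h (word_subset w))"
    using assms(1,2) True unfolding johnson_inner_def
    by (intro sum.cong) (auto simp: gt_vec_def suffix_lift_def)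
  also have "\<dots> = (\<Sum>K\<in>?A. ?h K)"
    by (rule sum.reindex_bij_betw[OF bij_betw_word_subset])
  also have "\<dots> = (\<Sum>K\<in>{K \<in> ?A. K \<inter> {i..} = S}. of_int (?G K))"
    by (rule sum.inter_filter[symmetric]) (auto intro: finite_subset[of _ "Pow {..<n}"])
  also have "\<dots> = (\<Sum>K\<in>?B. of_int (?G K))"
  proof (rule sum.reindex_bij_witness[of _ "\<lambda>K. K \<union> S" "\<lambda>K. K \<inter> {..<i}"])
    fix K assume K: "K \<in> {K \<in> ?A. K \<inter> {i..} = S}"
    then have finK: "finite K" using finite_subset by blast
    show eq: "K \<inter> {..<i} \<union> S = K" using K by auto
    have "card (K \<inter> {..<i} \<union> S) = card (K \<inter> {..<i}) + card S"
      using finS finK assms(4) by (intro card_Un_disjoint) auto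
    then show "K \<inter> {..<i} \<in> ?B"
      using K eq by auto
    show "of_int (?G (K \<inter> {..<i})) = of_int (?G K)"
      using assms(1,2) gt_val_cong[of "K \<inter> {..<i}" t K] gt_val_cong[of "K \<inter> {..<i}" t' K] by auto
  next
    fix K assume K: "K \<in> ?B"
    then have finK: "finite K" using finite_subset by blast
    show "(K \<union> S) \<inter> {..<i} = K" using K assms(4) by auto
    have "K \<inter> S = {}" using K assms(4) by fastforce
    then have "card (K \<union> S) = card K + card S"
      using finS finK by (intro card_Un_disjoint)
    moreover have "K \<union> S \<subseteq> {..<n}" using K assms(3,4) by fastforce
    moreover have "(K \<union> S) \<inter> {i..} = S" using K assms(4) by auto
    ultimately show "K \<union> S \<in> {K \<in> ?A. K \<inter> {i..} = S}" using K by auto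
  qed
  also have "\<dots> = of_int (gt_ip t t' (int k - int (card S)))"
    using assms(1) by (simp add: gt_ip_def)
  finally show ?thesis using True by simp
qed

lemma gt_vec_nonzero:
  assumes "gt_vec n k t S \<noteq> 0"
  shows "gt_ip t t (int k - int (card S)) > 0" and "card S \<le> k" and "ballot t"
    and "row2 t \<le> k - card S" and "k - card S + row2 t \<le> length t"
proof -
  let ?i = "length t"
  from assms obtain w where "gt_vec n k t S w \<noteq> 0"
    by (auto simp: fun_eq_iff)
  then have w: "w \<in> johnson_words n k" "word_subset w \<inter> {?i..} = S" "gt_val t (word_subset w) \<noteq> 0"
    by (auto simp: gt_vec_def suffix_lift_def split: if_splits)
  have c: "card (word_subset w \<inter> {..<?i}) + card S = k"
    using w by (intro card_word_subset_split)
  have "gt_val t (word_subset w \<inter> {..<?i}) = gt_val t (word_subset w)"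
    by (rule gt_val_cong) auto
  with w c show "gt_ip t t (int k - int (card S)) > 0"
    by (intro gt_ip_pos[of "word_subset w \<inter> {..<?i}"]) auto
  show "card S \<le> k" using c by simp
  show "ballot t" using w gt_val_nonzero_imp_ballot by blast
  show "row2 t \<le> k - card S" "k - card S + row2 t \<le> ?i"
    using gt_val_support[OF w(3)] c by auto
qed

lemma gt_vec_full_nonzero:
  assumes "ballot t" "row2 t \<le> k" "k + row2 t \<le> length t"
  shows "gt_vec (length t) k t {} \<noteq> 0"
proof -
  obtain K where K: "K \<subseteq> {..<length t}" "card K = k" "gt_val t K \<noteq> 0"
    using ballot_imp_gt_val_nonzero[OF assms] by blast
  then obtain w where w: "w \<in> johnson_words (length t) k" "word_subset w = K"
    using bij_betw_imp_surj_on[OF bij_betw_word_subset[of "length t" k]]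
    by (metis (mono_tags, lifting) imageE mem_Collect_eq)
  then have "word_subset w \<inter> {length t..} = {}" using K by auto
  with w K have "gt_vec (length t) k t {} w \<noteq> 0"
    by (simp add: gt_vec_def suffix_lift_def)
  then show ?thesis by (metis zero_fun_apply)
qed

section \<open>Number of nonzero vectors and spanning\<close>

definition gt_index :: "nat \<Rightarrow> nat \<Rightarrow> nat \<Rightarrow> (bool list \<times> nat set) set" where
  "gt_index n k i = {(t, S). length t = i \<and> S \<subseteq> {i..<n} \<and> gt_vec n k t S \<noteq> 0}"

lemma finite_gt_index: "finite (gt_index n k i)"
proof -
  have "finite ({t :: bool list. set t \<subseteq> UNIV \<and> length t = i} \<times> Pow {i..<n})"
    by (intro finite_cartesian_product finite_lists_length_eq) auto
  then show ?thesis
    by (rule finite_subset[rotated]) (auto simp: gt_index_def)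
qed

text \<open>Nonzero orthogonal vectors are independent, and the space has a spanning set of
  \<open>n choose k\<close> delta functions. This dimension argument replaces any counting of paths
  and suffix sets.\<close>

lemma card_gt_index_le:
  assumes "i \<le> n"
  shows "card (gt_index n k i) \<le> n choose k"
proof -
  let ?B = "\<lambda>(t, S). gt_vec n k t S"
  have orth: "johnson_inner n k (?B p) (?B q) = 0"
    if pq: "p \<in> gt_index n k i" "q \<in> gt_index n k i" "p \<noteq> q" for p q
  proof -
    obtain t S t' S' where "p = (t, S)" "length t = i" "S \<subseteq> {i..<n}"
      and "q = (t', S')" "length t' = i" "S' \<subseteq> {i..<n}"
      using pq by (auto simp: gt_index_def)
    moreover from this have "gt_ip t t' m = 0" if "S = S'" for m
      using that pq(3) by (intro gt_ip_orthogonal) auto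
    ultimately show ?thesis using assms by (simp add: gt_vec_inner)
  qed
  have nz: "johnson_inner n k (?B p) (?B p) \<noteq> 0" if p: "p \<in> gt_index n k i" for p
  proof -
    obtain t S where tS: "p = (t, S)" "length t = i" "S \<subseteq> {i..<n}" "gt_vec n k t S \<noteq> 0"
      using p by (auto simp: gt_index_def)
    then show ?thesis
      using gt_vec_nonzero(1)[OF tS(4)] assms by (simp add: gt_vec_inner)
  qed
  have inj: "inj_on ?B (gt_index n k i)" and ind: "cfun.independent (?B ` gt_index n k i)"
    using orthogonal_family_independent[OF finite_gt_index orth nz] by auto
  have "?B ` gt_index n k i \<subseteq> cfun.span (delta ` johnson_words n k)"
    using gt_vec_in_johnson_funs by (auto simp: span_delta)
  then have "card (?B ` gt_index n k i) \<le> card (delta ` johnson_words n k)"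
    using cfun.independent_span_bound[OF _ ind] by auto
  also have "\<dots> \<le> n choose k"
    using card_image_le[OF finite_johnson_words] by (metis card_johnson_words)
  finally show ?thesis
    using card_image[OF inj] by simp
qed

lemma gt_vec_Nil:
  assumes "w \<in> johnson_words n k"
  shows "gt_vec n k [] (word_subset w) = delta w"
proof
  fix v
  show "gt_vec n k [] (word_subset w) v = delta w v"
    using assms bij_betw_word_subset[of n k]
    by (auto simp: gt_vec_def suffix_lift_def delta_def bij_betw_def inj_on_def)
qed

text \<open>Undoing the steps in \<open>u\<close> one at a time only changes the suffix set. This
  transports membership in the isotypic component at level \<open>length t\<close> to all longer
  paths.\<close>

lemma gt_vec_append_in_span:
  assumes "length (u @ t) \<le> n" "S \<subseteq> {length (u @ t)..<n}"
  shows "gt_vec n k (u @ t) S \<in> cfun.span {gt_vec n k t S' |S'. S' \<subseteq> {length t..<n}}"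
  using assms
proof (induction u arbitrary: S)
  case Nil
  then show ?case by (auto intro!: cfun.span_base)
next
  case (Cons b u)
  have S: "S \<subseteq> {Suc (length (u @ t))..}" using Cons.prems by auto
  have "gt_vec n k (u @ t) (insert (length (u @ t)) S) \<in> cfun.span {gt_vec n k t S' |S'. S' \<subseteq> {length t..<n}}"
    "gt_vec n k (u @ t) S \<in> cfun.span {gt_vec n k t S' |S'. S' \<subseteq> {length t..<n}}"
    using Cons.prems by (auto intro!: Cons.IH)
  then show ?case
    unfolding append_Cons gt_vec_Cons[OF S] by (intro cfun.span_add cfun.span_scale)
qed

text \<open>The two one-step extensions of \<open>t\<close> span the same space as the two vectors of \<open>t\<close>:
  the determinant of the coefficients is \<open>i + 1 - 2 * a\<close>, and where it vanishes so do the vectors.\<close>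

lemma gt_vec_in_span_Suc:
  assumes "length t = i" "i < n" "S \<subseteq> {i..<n}"
  shows "gt_vec n k t S \<in> cfun.span {gt_vec n k t' S' |t' S'. length t' = Suc i \<and> S' \<subseteq> {Suc i..<n}}"
    (is "_ \<in> cfun.span ?G")
proof (cases "gt_vec n k t S = 0")
  case True
  then show ?thesis by (simp add: cfun.span_zero)
next
  case False
  define S0 where "S0 = S - {i}"
  define m where "m = int k - int (card S0)"
  define \<alpha> \<beta> where "\<alpha> = (of_int (int i + 1 - (int (row2 t) + m)) :: complex)"
    and "\<beta> = (of_int (m - int (row2 t)) :: complex)"
  define x y where "x = gt_vec n k t S0" and "y = gt_vec n k t (insert i S0)"
  define F G where "F = gt_vec n k (False # t) S0" and "G = gt_vec n k (True # t) S0"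
  have S0: "S0 \<subseteq> {Suc (length t)..}" "S0 \<subseteq> {Suc i..<n}"
    using assms unfolding S0_def by (auto simp: Suc_le_eq le_eq_less_or_eq)
  have F: "F = y + x"
    using gt_vec_Cons[OF S0(1), of n k False] assms
    by (simp add: F_def x_def y_def coeff_in_def coeff_out_def fun_eq_iff fscale_apply)
  have "G = fscale \<alpha> y + fscale (- \<beta>) x"
    using gt_vec_Cons[OF S0(1), of n k True] assms
    by (simp add: G_def x_def y_def coeff_in_def coeff_out_def \<alpha>_def \<beta>_def m_def)
  then have G: "G v = \<alpha> * y v - \<beta> * x v" for v by (simp add: fscale_apply)
  have FG: "F \<in> cfun.span ?G" "G \<in> cfun.span ?G"
    using S0 assms unfolding F_def G_def by (auto intro!: cfun.span_base exI)
  have "2 * row2 t \<le> i"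
    using gt_vec_nonzero(4,5)[OF False] assms by simp
  then have nz: "(of_int (int i + 1 - 2 * int (row2 t)) :: complex) \<noteq> 0"
    unfolding of_int_eq_0_iff by linarith
  have ab: "\<alpha> + \<beta> = of_int (int i + 1 - 2 * int (row2 t))"
    by (simp add: \<alpha>_def \<beta>_def)
  then have nz': "\<alpha> + \<beta> \<noteq> 0" using nz by simp
  have "x v * (\<alpha> + \<beta>) = \<alpha> * F v - G v" "y v * (\<alpha> + \<beta>) = G v + \<beta> * F v" for v
    by (simp_all add: F G algebra_simps)
  then have x: "x = fscale (1 / (\<alpha> + \<beta>)) (fscale \<alpha> F - G)" and y: "y = fscale (1 / (\<alpha> + \<beta>)) (G + fscale \<beta> F)"
    using nz' by (auto simp: fun_eq_iff eq_divide_eq fscale_apply)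
  have "x \<in> cfun.span ?G"
    by (subst x) (intro cfun.span_scale cfun.span_diff FG)
  moreover have "y \<in> cfun.span ?G"
    by (subst y) (intro cfun.span_scale cfun.span_add FG)
  moreover have "S = S0 \<or> S = insert i S0" unfolding S0_def by auto
  ultimately show ?thesis unfolding x_def y_def by auto
qed

text \<open>Level 0 consists of the delta functions (and zero), and passing to the next level never
  shrinks the span.\<close>

lemma span_gt_vec:
  "cfun.span {gt_vec n k t {} |t. length t = n \<and> gt_vec n k t {} \<noteq> 0} = johnson_funs n k"
proof
  show "cfun.span {gt_vec n k t {} |t. length t = n \<and> gt_vec n k t {} \<noteq> 0} \<subseteq> johnson_funs n k"
    by (rule cfun.span_minimal[OF _ subspace_johnson_funs]) (auto simp: gt_vec_in_johnson_funs)
  let ?G = "\<lambda>i. {gt_vec n k t S |t S. length t = i \<and> S \<subseteq> {i..<n}}"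
  have "cfun.span (?G 0) \<subseteq> cfun.span (?G i)" if "i \<le> n" for i
    using that
  proof (induction i)
    case (Suc i)
    have "?G i \<subseteq> cfun.span (?G (Suc i))"
      using gt_vec_in_span_Suc[of _ i n _ k] Suc.prems by auto
    then have "cfun.span (?G i) \<subseteq> cfun.span (?G (Suc i))"
      by (rule cfun.span_minimal[OF _ cfun.subspace_span])
    then show ?case using Suc by simp
  qed simp
  from this[OF order_refl] have 1: "cfun.span (?G 0) \<subseteq> cfun.span (?G n)" .
  \<comment> \<open>At level \<open>n\<close> the only suffix set is empty, and discarding zero
    vectors does not change the span.\<close>
  have "?G n \<subseteq> insert 0 {gt_vec n k t {} |t. length t = n \<and> gt_vec n k t {} \<noteq> 0}"
    by auto
  from cfun.span_mono[OF this]
  have 2: "cfun.span (?G n) \<subseteq> cfun.span {gt_vec n k t {} |t. length t = n \<and> gt_vec n k t {} \<noteq> 0}"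
    by (simp only: cfun.span_insert_0)
  have "delta ` johnson_words n k \<subseteq> ?G 0"
  proof
    fix f assume "f \<in> delta ` johnson_words n k"
    then obtain w where w: "w \<in> johnson_words n k" "f = delta w" by auto
    then have "f = gt_vec n k [] (word_subset w)" by (simp only: gt_vec_Nil)
    moreover have "word_subset w \<subseteq> {0..<n}"
      using word_subset_subset[of w] w by (auto simp: johnson_words_def)
    ultimately show "f \<in> ?G 0" by blast
  qed
  from cfun.span_mono[OF this] have "johnson_funs n k \<subseteq> cfun.span (?G 0)"
    by (simp only: span_delta)
  with 1 2 show "johnson_funs n k \<subseteq> cfun.span {gt_vec n k t {} |t. length t = n \<and> gt_vec n k t {} \<noteq> 0}"
    by (meson subset_trans)
qed

section \<open>Column stabilizers of two-row tableaux\<close>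

definition points :: "(nat \<times> nat) list \<Rightarrow> nat set" where
  "points ps = fst ` set ps \<union> snd ` set ps"

text \<open>The pairs stand for the columns of length two of a two-row tableau, the entry of the
  first row coming first. \<open>pair_fun\<close> is the corresponding polytabloid, transported to
  functions on subsets.\<close>

definition pairing :: "nat \<Rightarrow> (nat \<times> nat) list \<Rightarrow> bool" where
  "pairing i ps \<longleftrightarrow> distinct (map fst ps @ map snd ps) \<and> points ps \<subseteq> {..<i}"

definition pair_fun :: "(nat \<times> nat) list \<Rightarrow> nat set \<Rightarrow> complex" where
  "pair_fun ps K = (\<Prod>(x, y)\<leftarrow>ps. of_bool (y \<in> K) - of_bool (x \<in> K))"

lemma points_simps [simp]:
  "points [] = {}" "points ((x, y) # ps) = insert x (insert y (points ps))"
  by (auto simp: points_def)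

lemma finite_points [simp]: "finite (points ps)"
  by (simp add: points_def)

lemma pairing_Nil [simp]: "pairing i []"
  by (simp add: pairing_def)

lemma pairing_Cons:
  "pairing i ((x, y) # ps) \<longleftrightarrow>
     x \<noteq> y \<and> x < i \<and> y < i \<and> x \<notin> points ps \<and> y \<notin> points ps \<and> pairing i ps"
  by (auto simp: pairing_def points_def)

lemma pair_fun_simps [simp]:
  "pair_fun [] K = 1"
  "pair_fun ((x, y) # ps) K = (of_bool (y \<in> K) - of_bool (x \<in> K)) * pair_fun ps K"
  by (simp_all add: pair_fun_def)

lemma card_points: "pairing i ps \<Longrightarrow> card (points ps) = 2 * length ps"
proof (induction ps)
  case (Cons p ps)
  then show ?case by (cases p) (simp add: pairing_Cons)
qed simp

lemma card_points_Int:
  assumes "pairing i ps" "pair_fun ps K \<noteq> 0"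
  shows "card (points ps \<inter> K) = length ps"
  using assms
proof (induction ps)
  case (Cons p ps)
  obtain x y where p: "p = (x, y)" by fastforce
  have 1: "x \<noteq> y" "x \<notin> points ps" "y \<notin> points ps" "card (points ps \<inter> K) = length ps"
    using Cons by (auto simp: p pairing_Cons)
  have "y \<in> K \<longleftrightarrow> x \<notin> K"
    using Cons.prems by (auto simp: p)
  then show ?case
    using 1 by (cases "x \<in> K") (auto simp: p Int_insert_left)
qed simp

lemma pairing_mono: "pairing i ps \<Longrightarrow> i \<le> j \<Longrightarrow> pairing j ps"
  by (auto simp: pairing_def)

text \<open>A step to the second row sends \<open>pair_fun ps\<close> to the sum of
  \<open>pair_fun ((r, i) # ps)\<close> over the points \<open>r\<close> below
  \<open>i = length t\<close> outside \<open>ps\<close>. Where the product is nonzero,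
  \<open>K\<close> contains exactly one point of each pair, so the number of free points in
  \<open>K\<close> is determined by the size of \<open>K\<close>, and the sum of the new factors is
  \<open>coeff_in\<close> or \<open>coeff_out\<close>.\<close>

lemma gt_val_in_span_pair_fun:
  "(\<lambda>K. of_int (gt_val t K)) \<in> cfun.span {pair_fun ps |ps. pairing (length t) ps \<and> length ps = row2 t}"
proof (induction t)
  case Nil
  have "(\<lambda>K. of_int (gt_val [] K)) = pair_fun []"
    by (simp add: fun_eq_iff)
  then show ?case by (auto intro!: cfun.span_base exI[of _ "[]"])
next
  case (Cons b t)
  let ?G = "\<lambda>t. {pair_fun ps |ps. pairing (length t) ps \<and> length ps = row2 t}"
  let ?i = "length t"
  show ?case
  proof (cases b)
    case False
    then have "(\<lambda>K. of_int (gt_val (b # t) K)) = (\<lambda>K. complex_of_int (gt_val t K))"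
      by (simp add: coeff_in_def coeff_out_def fun_eq_iff)
    moreover have "?G t \<subseteq> ?G (b # t)"
      using False pairing_mono[of ?i] by auto
    then have "cfun.span (?G t) \<subseteq> cfun.span (?G (b # t))"
      by (rule cfun.span_mono)
    ultimately show ?thesis using Cons.IH by auto
  next
    case True
    define c where "c K = (if ?i \<in> K then coeff_in True t (int (card (K \<inter> {..?i})))
      else coeff_out True t (int (card (K \<inter> {..?i}))))" for K
    have gen: "(\<lambda>K. of_int (c K) * pair_fun ps K) \<in> cfun.span (?G (b # t))"
      if ps: "pairing ?i ps" "length ps = row2 t" for ps
    proof -
      let ?R = "{..<?i} - points ps"
      have sub: "points ps \<subseteq> {..<?i}" using ps by (simp add: pairing_def)
      have cR: "card ?R = ?i - 2 * row2 t" "2 * row2 t \<le> ?i"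
        using card_points[OF ps(1)] ps(2) card_Diff_subset[OF _ sub] card_mono[OF _ sub] by auto
      have "(\<lambda>K. of_int (c K) * pair_fun ps K) = (\<Sum>r\<in>?R. pair_fun ((r, ?i) # ps))"
      proof
        fix K
        have "(\<Sum>r\<in>?R. pair_fun ((r, ?i) # ps)) K =
            (\<Sum>r\<in>?R. of_bool (?i \<in> K) - of_bool (r \<in> K)) * pair_fun ps K"
          by (simp add: sum_fun_apply sum_distrib_right)
        also have "(\<Sum>r\<in>?R. of_bool (?i \<in> K) - of_bool (r \<in> K)) =
            of_nat (card ?R) * of_bool (?i \<in> K) - (of_nat (card (?R \<inter> K)) :: complex)"
          by (simp add: sum_subtractf of_bool_def sum.If_cases Int_def)
        also have "\<dots> * pair_fun ps K = of_int (c K) * pair_fun ps K"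
        proof (cases "pair_fun ps K = 0")
          case False
          have "K \<inter> {..<?i} = (points ps \<inter> K) \<union> (?R \<inter> K)" using sub by auto
          also have "card \<dots> = card (points ps \<inter> K) + card (?R \<inter> K)"
            by (rule card_Un_disjoint) auto
          finally have "card (K \<inter> {..<?i}) = row2 t + card (?R \<inter> K)"
            using card_points_Int[OF ps(1) False] ps(2) by simp
          then show ?thesis
            using cR by (auto simp: c_def coeff_in_def coeff_out_def card_Int_atMost of_nat_diff)
        qed simp
        finally show "of_int (c K) * pair_fun ps K = (\<Sum>r\<in>?R. pair_fun ((r, ?i) # ps)) K" ..
      qed
      also have "\<dots> \<in> cfun.span (?G (b # t))"
      proof (intro cfun.span_sum cfun.span_base)
        fix r assume "r \<in> ?R"
        then have "pairing (length (b # t)) ((r, ?i) # ps)"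
          using ps sub pairing_mono[of ?i ps "Suc ?i"] by (auto simp: pairing_Cons)
        then show "pair_fun ((r, ?i) # ps) \<in> ?G (b # t)"
          using ps True by (intro CollectI exI[of _ "(r, ?i) # ps"]) auto
      qed
      finally show ?thesis .
    qed
    \<comment> \<open>Multiplication by \<open>c\<close> is linear, so the formula on generators
      extends to their span.\<close>
    have "(\<lambda>K. of_int (c K) * g K) \<in> cfun.span (?G (b # t))" if "g \<in> cfun.span (?G t)" for g
      using that
    proof (rule cfun.span_induct)
      show "cfun.subspace {g. (\<lambda>K. of_int (c K) * g K) \<in> cfun.span (?G (b # t))}"
      proof (rule cfun.subspaceI)
        have "(\<lambda>K. of_int (c K) * (0 :: nat set \<Rightarrow> complex) K) = 0" by (simp add: fun_eq_iff)
        then show "0 \<in> {g. (\<lambda>K. of_int (c K) * g K) \<in> cfun.span (?G (b # t))}"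
          by (simp only: mem_Collect_eq cfun.span_zero)
      next
        fix g h assume gh: "g \<in> {g. (\<lambda>K. of_int (c K) * g K) \<in> cfun.span (?G (b # t))}"
          "h \<in> {g. (\<lambda>K. of_int (c K) * g K) \<in> cfun.span (?G (b # t))}"
        have "(\<lambda>K. of_int (c K) * (g + h) K) = (\<lambda>K. of_int (c K) * g K) + (\<lambda>K. of_int (c K) * h K)"
          by (simp add: fun_eq_iff algebra_simps)
        then show "g + h \<in> {g. (\<lambda>K. of_int (c K) * g K) \<in> cfun.span (?G (b # t))}"
          using gh cfun.span_add by (simp only: mem_Collect_eq)
      next
        fix z g assume g: "g \<in> {g. (\<lambda>K. of_int (c K) * g K) \<in> cfun.span (?G (b # t))}"
        have "(\<lambda>K. of_int (c K) * fscale z g K) = fscale z (\<lambda>K. of_int (c K) * g K)"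
          by (simp add: fun_eq_iff fscale_apply algebra_simps)
        then show "fscale z g \<in> {g. (\<lambda>K. of_int (c K) * g K) \<in> cfun.span (?G (b # t))}"
          using g cfun.span_scale by (simp only: mem_Collect_eq)
      qed
    qed (use gen in auto)
    from this[OF Cons.IH] show ?thesis
      using True by (simp add: c_def of_int_mult[symmetric] del: of_int_mult)
  qed
qed

section \<open>Signed sums over products of disjoint transpositions\<close>

abbreviation swap :: "nat \<Rightarrow> nat \<Rightarrow> nat \<Rightarrow> nat" where
  "swap \<equiv> Transposition.transpose"

definition pair_stab :: "nat \<Rightarrow> (nat \<times> nat) list \<Rightarrow> (nat \<Rightarrow> nat) set" where
  "pair_stab i ps = {\<pi> \<in> sym_group i. (\<forall>(x, y)\<in>set ps. \<pi> ` {x, y} = {x, y}) \<and>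
     (\<forall>z. z \<notin> points ps \<longrightarrow> \<pi> z = z)}"

lemma finite_sym_group [simp]: "finite (sym_group i)"
  by (simp add: sym_group_def finite_permutations)

lemma finite_pair_stab [simp]: "finite (pair_stab i ps)"
  by (rule finite_subset[of _ "sym_group i"]) (auto simp: pair_stab_def)

lemma pair_stab_Nil: "pair_stab i [] = {id}"
  by (auto simp: pair_stab_def sym_group_def permutes_id)

lemma sign_compose_transpose:
  assumes "\<pi> \<in> sym_group i" "x \<noteq> y"
  shows "sign (\<pi> \<circ> swap x y) = - sign \<pi>"
proof -
  have "permutation \<pi>"
    using assms by (auto simp: sym_group_def permutation_permutes)
  then show ?thesis
    using assms by (simp add: sign_compose permutation_swap_id sign_swap_id)
qed

lemma pair_stab_transpose:
  assumes "pairing i ps" "(x, y) \<in> set ps" "\<pi> \<in> pair_stab i ps"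
  shows "\<pi> \<circ> swap x y \<in> pair_stab i ps"
proof -
  have xy: "x \<in> points ps" "y \<in> points ps" "x < i" "y < i"
    using assms(1,2) by (force simp: points_def pairing_def)+
  have "\<pi> \<circ> swap x y \<in> sym_group i"
    using assms(3) xy by (auto simp: pair_stab_def sym_group_def intro!: permutes_compose permutes_swap_id)
  moreover have "(\<pi> \<circ> swap x y) z = z" if "z \<notin> points ps" for z
    using that xy assms(3) by (auto simp: pair_stab_def Transposition.transpose_def)
  moreover have "(\<pi> \<circ> swap x y) ` {u, v} = {u, v}" if uv: "(u, v) \<in> set ps" for u v
  proof -
    have "swap x y ` {u, v} = {u, v}"
    proof (cases "(u, v) = (x, y)")
      case False
      have d: "inj_on fst (set ps)" "inj_on snd (set ps)" "fst ` set ps \<inter> snd ` set ps = {}"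
        using assms(1) by (auto simp: pairing_def distinct_map)
      have "u \<noteq> x" "v \<noteq> y"
        using inj_onD[OF d(1) _ uv assms(2)] inj_onD[OF d(2) _ uv assms(2)] False by auto
      moreover have "u \<in> fst ` set ps" "v \<in> snd ` set ps" "x \<in> fst ` set ps" "y \<in> snd ` set ps"
        using uv assms(2) by force+
      then have "u \<noteq> y" "v \<noteq> x" using d(3) by auto
      ultimately show ?thesis by (simp add: Transposition.transpose_def)
    qed (auto simp: Transposition.transpose_def)
    then have "(\<pi> \<circ> swap x y) ` {u, v} = \<pi> ` {u, v}"
      by (metis image_comp)
    moreover have "\<forall>(x, y)\<in>set ps. \<pi> ` {x, y} = {x, y}"
      using assms(3) by (simp add: pair_stab_def)
    from bspec[OF this uv] have "\<pi> ` {u, v} = {u, v}" by simp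
    ultimately show ?thesis by (simp only:)
  qed
  ultimately show ?thesis by (auto simp: pair_stab_def)
qed

lemma pair_stab_mono:
  assumes "pairing i (p # ps)" "\<pi> \<in> pair_stab i ps"
  shows "\<pi> \<in> pair_stab i (p # ps)"
  using assms by (cases p) (auto simp: pair_stab_def pairing_Cons)

text \<open>A member of the larger stabilizer preserves \<open>{x, y}\<close>. Either it fixes both
  points and already belongs to the smaller stabilizer, or it exchanges them and is brought there by
  the transposition. Signed sums can thus be treated one column at a time.\<close>

lemma pair_stab_Cons:
  assumes ps: "pairing i ((x, y) # ps)"
  shows "pair_stab i ((x, y) # ps) = pair_stab i ps \<union> (\<lambda>\<pi>. \<pi> \<circ> swap x y) ` pair_stab i ps"
proof
  show "pair_stab i ps \<union> (\<lambda>\<pi>. \<pi> \<circ> swap x y) ` pair_stab i ps \<subseteq> pair_stab i ((x, y) # ps)"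
    using pair_stab_mono[OF ps] pair_stab_transpose[OF ps] by auto
  have fix_imp: "\<pi> \<in> pair_stab i ps" if "\<pi> \<in> pair_stab i ((x, y) # ps)" "\<pi> x = x" "\<pi> y = y" for \<pi>
    using that unfolding pair_stab_def by auto
  show "pair_stab i ((x, y) # ps) \<subseteq> pair_stab i ps \<union> (\<lambda>\<pi>. \<pi> \<circ> swap x y) ` pair_stab i ps"
  proof
    fix \<pi> assume pi: "\<pi> \<in> pair_stab i ((x, y) # ps)"
    then have "\<pi> ` {x, y} = {x, y}" by (simp add: pair_stab_def)
    then consider "\<pi> x = x" "\<pi> y = y" | "\<pi> x = y" "\<pi> y = x"
      by (auto simp: doubleton_eq_iff)
    then show "\<pi> \<in> pair_stab i ps \<union> (\<lambda>\<pi>. \<pi> \<circ> swap x y) ` pair_stab i ps"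
    proof cases
      case 1
      then show ?thesis using fix_imp pi by blast
    next
      case 2
      have "\<pi> \<circ> swap x y \<in> pair_stab i ps"
        using 2 by (intro fix_imp pair_stab_transpose[OF ps _ pi]) auto
      moreover have "\<pi> = (\<pi> \<circ> swap x y) \<circ> swap x y"
        by (simp add: comp_assoc)
      ultimately show ?thesis by blast
    qed
  qed
qed

lemma pair_stab_fix: "\<pi> \<in> pair_stab i ps \<Longrightarrow> z \<notin> points ps \<Longrightarrow> \<pi> z = z"
  by (simp add: pair_stab_def)

lemma pair_stab_sym_group: "\<pi> \<in> pair_stab i ps \<Longrightarrow> \<pi> \<in> sym_group i"
  by (simp add: pair_stab_def)

lemma sum_pair_stab_Cons:
  fixes F :: "(nat \<Rightarrow> nat) \<Rightarrow> complex"
  assumes ps: "pairing i ((x, y) # ps)"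
  shows "(\<Sum>\<pi>\<in>pair_stab i ((x, y) # ps). of_int (sign \<pi>) * F \<pi>) =
    (\<Sum>\<pi>\<in>pair_stab i ps. of_int (sign \<pi>) * (F \<pi> - F (\<pi> \<circ> swap x y)))"
proof -
  let ?f = "\<lambda>\<pi>. \<pi> \<circ> swap x y" and ?C = "pair_stab i ps"
  have xy: "x \<noteq> y" "x \<notin> points ps" "y \<notin> points ps" using ps by (auto simp: pairing_Cons)
  have disj: "?C \<inter> ?f ` ?C = {}"
  proof (rule ccontr)
    assume "?C \<inter> ?f ` ?C \<noteq> {}"
    then obtain \<pi> where "\<pi> \<in> ?C" "?f \<pi> \<in> ?C" by auto
    then have "?f \<pi> x = x" "\<pi> y = y" using pair_stab_fix xy by blast+
    then show False using xy by simp
  qed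
  have inj: "inj_on ?f ?C"
    by (rule inj_on_inverseI[of _ ?f]) (simp add: comp_assoc)
  have "(\<Sum>\<pi>\<in>pair_stab i ((x, y) # ps). of_int (sign \<pi>) * F \<pi>) =
    (\<Sum>\<pi>\<in>?C. of_int (sign \<pi>) * F \<pi>) + (\<Sum>\<pi>\<in>?f ` ?C. of_int (sign \<pi>) * F \<pi>)"
    unfolding pair_stab_Cons[OF ps] using disj by (intro sum.union_disjoint) auto
  also have "(\<Sum>\<pi>\<in>?f ` ?C. of_int (sign \<pi>) * F \<pi>) = (\<Sum>\<pi>\<in>?C. - of_int (sign \<pi>) * F (?f \<pi>))"
    unfolding sum.reindex[OF inj]
  proof (rule sum.cong)
    fix \<pi> assume "\<pi> \<in> ?C"
    then have "sign (?f \<pi>) = - sign \<pi>"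
      using sign_compose_transpose xy(1) pair_stab_sym_group by blast
    then show "((\<lambda>\<pi>. of_int (sign \<pi>) * F \<pi>) \<circ> ?f) \<pi> = - of_int (sign \<pi>) * F (?f \<pi>)"
      by simp
  qed simp
  finally show ?thesis
    by (simp add: sum.distrib[symmetric] algebra_simps)
qed

text \<open>The stabilizer is a product of groups of order two, one for each pair, so the signed sum
  factors; every pair contributes the difference of the indicators of its two points.\<close>

lemma pair_fun_eq_sum:
  assumes "pairing i ps"
  shows "(\<Sum>\<pi>\<in>pair_stab i ps. of_int (sign \<pi>) * of_bool (\<pi> ` snd ` set ps \<subseteq> K)) = pair_fun ps K"
  using assms
proof (induction ps)
  case Nil
  then show ?case by (simp add: pair_stab_Nil)
next
  case (Cons p ps)
  obtain x y where p: "p = (x, y)" by fastforce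
  have xy: "x \<noteq> y" "x \<notin> points ps" "y \<notin> points ps" "pairing i ps"
    using Cons.prems by (auto simp: p pairing_Cons)
  \<comment> \<open>Since \<open>\<pi>\<close> fixes \<open>x\<close> and \<open>y\<close>,
    composing with the transposition only replaces \<open>y\<close> by \<open>x\<close> in the image
    of the second components.\<close>
  have eq: "of_bool (\<pi> ` snd ` set (p # ps) \<subseteq> K) - of_bool ((\<pi> \<circ> swap x y) ` snd ` set (p # ps) \<subseteq> K)
      = (of_bool (y \<in> K) - of_bool (x \<in> K)) * (of_bool (\<pi> ` snd ` set ps \<subseteq> K) :: complex)"
    if "\<pi> \<in> pair_stab i ps" for \<pi>
  proof -
    have pi: "\<pi> x = x" "\<pi> y = y" using pair_stab_fix[OF that] xy by auto
    then have "(\<pi> \<circ> swap x y) y = x" by simp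
    moreover note pi
    moreover have "swap x y ` snd ` set ps = snd ` set ps"
      using xy(2,3) by (intro image_cong[where g = id, simplified]) (auto simp: points_def Transposition.transpose_def)
    then have "(\<pi> \<circ> swap x y) ` snd ` set ps = \<pi> ` snd ` set ps"
      by (metis image_comp)
    ultimately show ?thesis
      by (auto simp: p simp del: comp_apply)
  qed
  have "(\<Sum>\<pi>\<in>pair_stab i (p # ps). of_int (sign \<pi>) * of_bool (\<pi> ` snd ` set (p # ps) \<subseteq> K)) =
    (\<Sum>\<pi>\<in>pair_stab i ps. of_int (sign \<pi>) * (of_bool (\<pi> ` snd ` set (p # ps) \<subseteq> K)
      - of_bool ((\<pi> \<circ> swap x y) ` snd ` set (p # ps) \<subseteq> K)) :: complex)"
    using sum_pair_stab_Cons[OF Cons.prems[unfolded p]] by (simp only: p)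
  also have "\<dots> = (\<Sum>\<pi>\<in>pair_stab i ps. (of_bool (y \<in> K) - of_bool (x \<in> K)) *
      (of_int (sign \<pi>) * of_bool (\<pi> ` snd ` set ps \<subseteq> K)))"
    by (intro sum.cong) (simp_all only: eq mult.left_commute)
  also have "\<dots> = pair_fun (p # ps) K"
    using Cons.IH[OF xy(4)] by (simp add: p sum_distrib_left[symmetric])
  finally show ?case .
qed

text \<open>Composition with the transposition of \<open>x\<close> and \<open>y\<close> is a
  sign-reversing involution of the stabilizer, and it leaves the image of \<open>A\<close> unchanged
  because \<open>A\<close> avoids both points.\<close>

lemma sum_pair_stab_eq_0:
  fixes G :: "nat set \<Rightarrow> complex"
  assumes ps: "pairing i ps" and xy: "(x, y) \<in> set ps" "x \<notin> A" "y \<notin> A"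
  shows "(\<Sum>\<pi>\<in>pair_stab i ps. of_int (sign \<pi>) * G (\<pi> ` A)) = 0"
proof -
  let ?f = "\<lambda>\<pi>. \<pi> \<circ> swap x y"
  have neq: "x \<noteq> y"
    using ps xy(1) unfolding pairing_def by (force simp: disjoint_iff)
  have A: "swap x y ` A = A"
    using xy(2,3) by (intro image_cong[where g = id, simplified]) (auto simp: Transposition.transpose_def)
  have "(\<Sum>\<pi>\<in>pair_stab i ps. of_int (sign \<pi>) * G (\<pi> ` A)) =
    (\<Sum>\<pi>\<in>pair_stab i ps. of_int (sign (?f \<pi>)) * G (?f \<pi> ` A))"
    by (rule sum.reindex_bij_witness[of _ ?f ?f]) (auto simp: comp_assoc pair_stab_transpose[OF ps xy(1)])
  also have "\<dots> = (\<Sum>\<pi>\<in>pair_stab i ps. - (of_int (sign \<pi>) * G (\<pi> ` A)))"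
  proof (rule sum.cong)
    fix \<pi> assume "\<pi> \<in> pair_stab i ps"
    then have "sign (?f \<pi>) = - sign \<pi>"
      using sign_compose_transpose neq pair_stab_sym_group by blast
    moreover have "?f \<pi> ` A = \<pi> ` A"
      using A by (metis image_comp)
    ultimately show "of_int (sign (?f \<pi>)) * G (?f \<pi> ` A) = - (of_int (sign \<pi>) * G (\<pi> ` A))"
      by simp
  qed simp
  finally show ?thesis by (simp add: sum_negf)
qed

section \<open>Two-row Specht modules inside the function space\<close>

text \<open>A two-row tabloid is determined by its second row \<open>A\<close>; this encodes it in
  the format of \<open>tabloid\<close>, with empty rows from index 2 on.\<close>

definition rows_of :: "nat \<Rightarrow> nat set \<Rightarrow> nat \<Rightarrow> nat set" where
  "rows_of i A = (\<lambda>r. if r = 0 then {..<i} - A else if r = 1 then A else {})"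

definition column_pairs :: "nat \<Rightarrow> (nat \<times> nat \<Rightarrow> nat) \<Rightarrow> (nat \<times> nat) list" where
  "column_pairs a t = map (\<lambda>c. (t (0, c), t (1, c))) [0..<a]"

lemma two_row_iff: "(r, c) \<in> two_row p q \<longleftrightarrow> r = 0 \<and> c < p \<or> r = 1 \<and> c < q"
  by (auto simp: two_row_def)

lemma finite_two_row [simp]: "finite (two_row p q)"
  by (simp add: two_row_def)

lemma card_two_row [simp]: "card (two_row p q) = p + q"
  unfolding two_row_def by (subst card_Un_disjoint) (auto simp: card_cartesian_product)

lemma rows_of_inject: "rows_of i A = rows_of i B \<longleftrightarrow> A = B"
  by (auto simp: rows_of_def dest: fun_cong[of _ _ "1 :: nat"])

lemma length_column_pairs [simp]: "length (column_pairs a t) = a"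
  by (simp add: column_pairs_def)

lemma snd_column_pairs: "snd ` set (column_pairs a t) = (\<lambda>c. t (1, c)) ` {..<a}"
  by (auto simp: column_pairs_def image_image atLeast0LessThan)

lemma fst_column_pairs: "fst ` set (column_pairs a t) = (\<lambda>c. t (0, c)) ` {..<a}"
  by (auto simp: column_pairs_def image_image atLeast0LessThan)

lemma rows_of_image:
  assumes "\<sigma> \<in> sym_group i"
  shows "(\<lambda>r. \<sigma> ` rows_of i A r) = rows_of i (\<sigma> ` A)"
proof -
  have "\<sigma> permutes {..<i}" using assms by (simp add: sym_group_def)
  then have "\<sigma> ` {..<i} = {..<i}" "inj \<sigma>"
    by (auto simp: permutes_image permutes_inj)
  then have "\<sigma> ` ({..<i} - A) = {..<i} - \<sigma> ` A"
    by (simp add: image_set_diff)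
  then show ?thesis by (auto simp: rows_of_def fun_eq_iff)
qed

lemma sym_group_inv: "\<sigma> \<in> sym_group i \<Longrightarrow> inv \<sigma> \<in> sym_group i"
  by (simp add: sym_group_def permutes_inv)

lemma sym_group_bij: "\<sigma> \<in> sym_group i \<Longrightarrow> bij \<sigma>"
  by (auto simp: sym_group_def permutes_bij)

lemma card_image_sym_group:
  assumes "\<pi> \<in> sym_group j"
  shows "card (\<pi> ` A) = card A"
  using sym_group_bij[OF assms] by (intro card_image) (auto simp: bij_def intro: inj_on_subset)

lemma image_sym_group_subset:
  assumes "\<pi> \<in> sym_group j" "A \<subseteq> {..<j}"
  shows "\<pi> ` A \<subseteq> {..<j}"
  using assms permutes_image[of \<pi> "{..<j}"] by (auto simp: sym_group_def)

context
  fixes i a :: nat and \<mu> :: "(nat \<times> nat) set"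
  assumes ia: "2 * a \<le> i"
  defines "\<mu> \<equiv> two_row (i - a) a"
begin

lemma card_shape: "card \<mu> = i"
  using ia by (simp add: \<mu>_def)

lemma pairing_column_pairs:
  assumes t: "tableau \<mu> t"
  shows "pairing i (column_pairs a t)"
proof -
  have bij: "bij_betw t \<mu> {..<i}" using t by (simp add: tableau_def card_shape)
  then have inj: "inj_on t \<mu>" by (simp add: bij_betw_def)
  have mem: "(0, c) \<in> \<mu>" "(1, c) \<in> \<mu>" if "c < a" for c
    using that ia by (auto simp: \<mu>_def two_row_iff)
  have "inj_on (\<lambda>c. t (0, c)) {0..<a}" "inj_on (\<lambda>c. t (1, c)) {0..<a}"
    by (rule inj_onI; use inj_on_eq_iff[OF inj mem(1) mem(1)] inj_on_eq_iff[OF inj mem(2) mem(2)] in auto)+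
  moreover have "t (0, c) \<noteq> t (1, d)" if "c < a" "d < a" for c d
    using inj_onD[OF inj, of "(0, c)" "(1, d)"] mem that by auto
  moreover have "t (0, c) < i" "t (1, c) < i" if "c < a" for c
    using bij_betwE[OF bij] mem[OF that] by auto
  ultimately show ?thesis
    unfolding pairing_def points_def fst_column_pairs snd_column_pairs
    by (auto simp: column_pairs_def distinct_map o_def)
qed

lemma column_stabilizer_two_row:
  assumes t: "tableau \<mu> t"
  shows "column_stabilizer \<mu> t = pair_stab i (column_pairs a t)"
proof -
  have bij: "bij_betw t \<mu> {..<i}" using t by (simp add: tableau_def card_shape)
  have col: "t ` {b \<in> \<mu>. snd b = c} =
    (if c < a then {t (0, c), t (1, c)} else if c < i - a then {t (0, c)} else {})" for c
  proof -
    have "{b \<in> \<mu>. snd b = c} = (if c < a then {(0, c), (1, c)} else if c < i - a then {(0, c)} else {})"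
      using ia by (auto simp: \<mu>_def two_row_iff)
    then show ?thesis by simp
  qed
  \<comment> \<open>The points outside the columns of length two are of two kinds, fixed for
    different reasons: numbers from \<open>i\<close> on by the permutation group, entries of columns
    of length one by the stabilizer condition.\<close>
  have rest: "z \<notin> points (column_pairs a t) \<longleftrightarrow> z \<ge> i \<or> (\<exists>c. a \<le> c \<and> c < i - a \<and> z = t (0, c))" for z
  proof -
    have inj: "inj_on t \<mu>" and im: "t ` \<mu> = {..<i}" using bij by (auto simp: bij_betw_def)
    have eq: "t b = t b' \<longleftrightarrow> b = b'" if "b \<in> \<mu>" "b' \<in> \<mu>" for b b'
      using inj_on_eq_iff[OF inj that] .
    have mem: "(0, c) \<in> \<mu>" "(1, c) \<in> \<mu>" if "c < a" for c
      using that ia by (auto simp: \<mu>_def two_row_iff)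
    have mem': "(0, c) \<in> \<mu>" if "c < i - a" for c
      using that by (auto simp: \<mu>_def two_row_iff)
    have pts: "z \<in> points (column_pairs a t) \<longleftrightarrow> (\<exists>c<a. z = t (0, c) \<or> z = t (1, c))"
      unfolding points_def fst_column_pairs snd_column_pairs by auto
    show ?thesis
    proof
      assume z: "z \<notin> points (column_pairs a t)"
      show "z \<ge> i \<or> (\<exists>c. a \<le> c \<and> c < i - a \<and> z = t (0, c))"
      proof (cases "z < i")
        case True
        then have "z \<in> t ` \<mu>" using im by simp
        then obtain r c where b: "(r, c) \<in> \<mu>" "z = t (r, c)" by auto
        then have "r = 0 \<and> c < i - a \<or> r = 1 \<and> c < a" by (simp add: \<mu>_def two_row_iff)
        then show ?thesis using z b pts by (metis not_less)
      qed auto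
    next
      assume "z \<ge> i \<or> (\<exists>c. a \<le> c \<and> c < i - a \<and> z = t (0, c))"
      then show "z \<notin> points (column_pairs a t)"
      proof
        assume "z \<ge> i"
        then show ?thesis using pairing_column_pairs[OF t] by (auto simp: pairing_def)
      next
        assume "\<exists>c. a \<le> c \<and> c < i - a \<and> z = t (0, c)"
        then obtain c where c: "a \<le> c" "c < i - a" "z = t (0, c)" by blast
        then have "z \<noteq> t (0, d)" "z \<noteq> t (1, d)" if "d < a" for d
          using eq mem[OF that] mem'[OF c(2)] that by auto
        then show ?thesis using pts by blast
      qed
    qed
  qed
  show ?thesis
  proof (intro equalityI subsetI)
    fix \<pi> assume pi: "\<pi> \<in> column_stabilizer \<mu> t"
    then have sg: "\<pi> \<in> sym_group i"
      and st: "\<And>c. \<pi> ` t ` {b \<in> \<mu>. snd b = c} = t ` {b \<in> \<mu>. snd b = c}"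
      by (auto simp: column_stabilizer_def card_shape)
    have "\<pi> ` {t (0, c), t (1, c)} = {t (0, c), t (1, c)}" if "c < a" for c
      using st[of c] that unfolding col by simp
    moreover have "\<pi> (t (0, c)) = t (0, c)" if "a \<le> c" "c < i - a" for c
      using st[of c] that unfolding col by simp
    moreover have "\<pi> z = z" if "z \<ge> i" for z
      using sg that by (auto simp: sym_group_def intro: permutes_not_in)
    ultimately show "\<pi> \<in> pair_stab i (column_pairs a t)"
      unfolding pair_stab_def using sg rest by (auto simp: column_pairs_def)
  next
    fix \<pi> assume pi: "\<pi> \<in> pair_stab i (column_pairs a t)"
    then have st: "\<forall>(x, y)\<in>set (column_pairs a t). \<pi> ` {x, y} = {x, y}"
      by (simp add: pair_stab_def)
    have "\<pi> ` {t (0, c), t (1, c)} = {t (0, c), t (1, c)}" if "c < a" for c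
    proof -
      have "(t (0, c), t (1, c)) \<in> set (column_pairs a t)"
        using that by (auto simp: column_pairs_def)
      from bspec[OF st this] show ?thesis by simp
    qed
    moreover have "\<pi> (t (0, c)) = t (0, c)" if "a \<le> c" "c < i - a" for c
      by (rule pair_stab_fix[OF pi]) (use that rest in blast)
    ultimately have "\<pi> ` t ` {b \<in> \<mu>. snd b = c} = t ` {b \<in> \<mu>. snd b = c}" for c
      unfolding col by simp
    then show "\<pi> \<in> column_stabilizer \<mu> t"
      using pair_stab_sym_group[OF pi] by (simp add: column_stabilizer_def card_shape)
  qed
qed

lemma tabloid_two_row:
  assumes t: "tableau \<mu> t" and pi: "\<pi> \<in> sym_group i"
  shows "tabloid \<mu> (\<pi> \<circ> t) = rows_of i (\<pi> ` snd ` set (column_pairs a t))"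
proof
  fix r
  have bij: "bij_betw t \<mu> {..<i}" using t by (simp add: tableau_def card_shape)
  have inj: "inj_on t \<mu>" and im: "t ` \<mu> = {..<i}" using bij by (auto simp: bij_betw_def)
  let ?R = "\<lambda>r. {b \<in> \<mu>. fst b = r}"
  have 1: "t ` ?R 1 = snd ` set (column_pairs a t)"
  proof -
    have "?R 1 = (\<lambda>c. (1, c)) ` {..<a}" by (auto simp: \<mu>_def two_row_iff)
    then show ?thesis by (simp add: snd_column_pairs image_image)
  qed
  have 0: "t ` ?R 0 = {..<i} - t ` ?R 1"
  proof -
    have "?R 0 = \<mu> - ?R 1" by (auto simp: \<mu>_def two_row_iff)
    then show ?thesis
      using inj_on_image_set_diff[OF inj, of \<mu> "?R 1"] im by auto
  qed
  have 2: "?R r = {}" if "r \<noteq> 0" "r \<noteq> 1"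
    using that by (auto simp: \<mu>_def two_row_iff)
  have "t ` ?R r = rows_of i (t ` ?R 1) r"
    using 0 2 by (cases "r = 0"; cases "r = 1") (auto simp: rows_of_def)
  then have "\<pi> ` t ` ?R r = \<pi> ` rows_of i (t ` ?R 1) r" by simp
  also have "\<dots> = rows_of i (\<pi> ` t ` ?R 1) r"
    using fun_cong[OF rows_of_image[OF pi]] .
  finally show "tabloid \<mu> (\<pi> \<circ> t) r = rows_of i (\<pi> ` snd ` set (column_pairs a t)) r"
    unfolding tabloid_def 1 by (simp only: image_comp)
qed

lemma polytabloid_two_row:
  assumes t: "tableau \<mu> t"
  shows "polytabloid \<mu> t \<tau> = (\<Sum>\<pi>\<in>pair_stab i (column_pairs a t).
    of_int (sign \<pi>) * (if \<tau> = rows_of i (\<pi> ` snd ` set (column_pairs a t)) then 1 else 0))"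
  unfolding polytabloid_def column_stabilizer_two_row[OF t]
  by (intro sum.cong refl) (simp add: tabloid_two_row[OF t] pair_stab_sym_group)

text \<open>The pairs fill the columns of length two, and any bijection \<open>h\<close> distributes
  the remaining points over the rest of the first row. Hence every \<open>pair_fun\<close> comes
  from a polytabloid.\<close>

lemma ex_tableau_column_pairs:
  assumes ps: "pairing i ps" "length ps = a"
  shows "\<exists>t. tableau \<mu> t \<and> column_pairs a t = ps"
proof -
  have sub: "points ps \<subseteq> {..<i}" using ps by (simp add: pairing_def)
  have "card ({a..<i - a}) = card ({..<i} - points ps)"
    using card_points[OF ps(1)] ps(2) by (simp add: card_Diff_subset[OF _ sub])
  then obtain h where h: "bij_betw h {a..<i - a} ({..<i} - points ps)"
    using finite_same_card_bij[of "{a..<i - a}" "{..<i} - points ps"] by auto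
  define t where "t b = (if fst b = (1 :: nat) then snd (ps ! snd b)
    else if snd b < a then fst (ps ! snd b) else h (snd b))" for b
  have d: "distinct (map fst ps)" "distinct (map snd ps)" "fst ` set ps \<inter> snd ` set ps = {}"
    using ps(1) by (auto simp: pairing_def)
  have f: "bij_betw ((!) (map fst ps)) {..<a} (fst ` set ps)"
    using bij_betw_nth[OF d(1), of "{..<a}"] ps(2) by auto
  have s: "bij_betw ((!) (map snd ps)) {..<a} (snd ` set ps)"
    using bij_betw_nth[OF d(2), of "{..<a}"] ps(2) by auto
  have "bij_betw (\<lambda>b. h (snd b)) ({0 :: nat} \<times> {a..<i - a}) ({..<i} - points ps)"
    by (rule bij_betw_trans[OF _ h, of snd, unfolded comp_def]) (auto intro!: bij_betwI'[of _ _ _])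
  then have 1: "bij_betw t ({0} \<times> {a..<i - a}) ({..<i} - points ps)"
    by (rule bij_betw_cong[THEN iffD1, rotated]) (auto simp: t_def)
  have "bij_betw (\<lambda>b. map fst ps ! snd b) ({0 :: nat} \<times> {..<a}) (fst ` set ps)"
    by (rule bij_betw_trans[OF _ f, of snd, unfolded comp_def]) (auto intro!: bij_betwI'[of _ _ _])
  then have 2: "bij_betw t ({0} \<times> {..<a}) (fst ` set ps)"
    by (rule bij_betw_cong[THEN iffD1, rotated]) (auto simp: t_def ps(2))
  have "bij_betw (\<lambda>b. map snd ps ! snd b) ({1 :: nat} \<times> {..<a}) (snd ` set ps)"
    by (rule bij_betw_trans[OF _ s, of snd, unfolded comp_def]) (auto intro!: bij_betwI'[of _ _ _])
  then have 3: "bij_betw t ({1} \<times> {..<a}) (snd ` set ps)"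
    by (rule bij_betw_cong[THEN iffD1, rotated]) (auto simp: t_def ps(2))
  have "bij_betw t ({0} \<times> {a..<i - a} \<union> ({0} \<times> {..<a} \<union> {1} \<times> {..<a}))
      (({..<i} - points ps) \<union> (fst ` set ps \<union> snd ` set ps))"
    using d(3) by (intro bij_betw_combine 1 2 3) (auto simp: points_def)
  moreover have "({..<i} - points ps) \<union> (fst ` set ps \<union> snd ` set ps) = {..<i}"
    using sub by (auto simp: points_def)
  moreover have "{0} \<times> {a..<i - a} \<union> ({0} \<times> {..<a} \<union> {1} \<times> {..<a}) = \<mu>"
    using ia by (auto simp: \<mu>_def two_row_def)
  ultimately have "tableau \<mu> t" by (simp add: tableau_def card_shape)
  moreover have "column_pairs a t = ps"
    using ps(2) by (intro nth_equalityI) (auto simp: column_pairs_def t_def)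
  ultimately show ?thesis by blast
qed

text \<open>Elements of the Specht module are functions on the whole type of row sequences. This
  reduces the proof that one of them is zero to the finitely many arguments
  \<open>rows_of i A\<close>.\<close>

lemma specht_support:
  assumes "g \<in> specht \<mu>" "g \<tau> \<noteq> 0"
  shows "\<exists>A \<subseteq> {..<i}. card A = a \<and> \<tau> = rows_of i A"
proof (rule ccontr)
  assume *: "\<not> ?thesis"
  have "g \<tau> = 0"
    using assms(1) unfolding specht_def
  proof (rule cfun.span_induct)
    show "cfun.subspace {g. g \<tau> = 0}"
      by (rule cfun.subspaceI) (auto simp: fscale_apply)
  next
    fix g assume "g \<in> {polytabloid \<mu> t |t. tableau \<mu> t}"
    then obtain t where t: "tableau \<mu> t" "g = polytabloid \<mu> t" by blast
    let ?ps = "column_pairs a t" and ?Y = "snd ` set (column_pairs a t)"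
    have p: "pairing i ?ps" by (rule pairing_column_pairs[OF t(1)])
    have Y: "?Y \<subseteq> {..<i}" "card ?Y = a"
    proof -
      show "?Y \<subseteq> {..<i}" using p by (auto simp: pairing_def points_def)
      have "distinct (map snd ?ps)" using p by (simp add: pairing_def)
      from distinct_card[OF this] show "card ?Y = a" by simp
    qed
    have "\<tau> \<noteq> rows_of i (\<pi> ` ?Y)" if "\<pi> \<in> pair_stab i ?ps" for \<pi>
    proof -
      have pi: "\<pi> permutes {..<i}" using pair_stab_sym_group[OF that] by (simp add: sym_group_def)
      have "\<pi> ` ?Y \<subseteq> {..<i}" using Y(1) permutes_image[OF pi] by blast
      moreover have "card (\<pi> ` ?Y) = a"
        using card_image[OF inj_on_subset[OF permutes_inj[OF pi]]] Y(2) by auto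
      ultimately show ?thesis using * by blast
    qed
    then show "g \<tau> = 0"
      unfolding t(2) polytabloid_two_row[OF t(1)] by (intro sum.neutral) auto
  qed
  then show False using assms(2) by simp
qed

lemma second_row_column_pairs:
  assumes t: "tableau \<mu> t"
  shows "snd ` set (column_pairs a t) \<subseteq> {..<i}" "card (snd ` set (column_pairs a t)) = a"
proof -
  have p: "pairing i (column_pairs a t)" by (rule pairing_column_pairs[OF t])
  show "snd ` set (column_pairs a t) \<subseteq> {..<i}" using p by (auto simp: pairing_def points_def)
  have "distinct (map snd (column_pairs a t))" using p by (simp add: pairing_def)
  from distinct_card[OF this] show "card (snd ` set (column_pairs a t)) = a" by simp
qed

text \<open>Evaluating the vanishing subset sums on the column stabilizer orbit of the second row of a
  tableau, enlarged by \<open>m - a\<close> points of the columns of length one, leaves only the pairing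
  with the polytabloid: an \<open>a\<close>-subset other than the second row misses a column, and a
  transposition of that column cancels its contribution.\<close>

lemma specht_subset_sums_inject:
  assumes g: "g \<in> specht \<mu>" and m: "a \<le> m" "m + a \<le> i"
    and zero: "\<And>K. K \<subseteq> {..<i} \<Longrightarrow> card K = m \<Longrightarrow> (\<Sum>A | A \<subseteq> K \<and> card A = a. g (rows_of i A)) = 0"
  shows "g = 0"
proof -
  let ?X = "{A. A \<subseteq> {..<i} \<and> card A = a}"
  have finX: "finite ?X" by (rule finite_subset[of _ "Pow {..<i}"]) auto
  have orth: "(\<Sum>A\<in>?X. g (rows_of i A) * cnj (polytabloid \<mu> t (rows_of i A))) = 0"
    if t: "tableau \<mu> t" for t
  proof -
    define ps Y where "ps = column_pairs a t" and "Y = snd ` set ps"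
    let ?C = "pair_stab i ps"
    have p: "pairing i ps" unfolding ps_def by (rule pairing_column_pairs[OF t])
    have lps: "length ps = a" by (simp add: ps_def)
    have Y: "Y \<subseteq> {..<i}" "card Y = a" "Y \<subseteq> points ps"
      using second_row_column_pairs[OF t] by (auto simp: Y_def ps_def points_def)
    have finY: "finite Y" using Y(1) finite_subset by blast
    have sub: "points ps \<subseteq> {..<i}" using p by (simp add: pairing_def)
    \<comment> \<open>The columns of length two occupy \<open>2 * a\<close> points;
      \<open>m + a \<le> i\<close> says that \<open>m - a\<close> further ones are left.\<close>
    have "m - a \<le> card ({..<i} - points ps)"
      using m card_points[OF p] lps by (simp add: card_Diff_subset[OF _ sub])
    then obtain M where M: "M \<subseteq> {..<i} - points ps" "card M = m - a"
      using obtain_subset_with_card_n by metis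
    have finM: "finite M" using M(1) finite_subset by blast
    define B where "B = Y \<union> M"
    have "card B = card Y + card M"
      unfolding B_def using Y(3) M(1) by (intro card_Un_disjoint finY finM) auto
    then have B: "B \<subseteq> {..<i}" "card B = m" "finite B"
      using Y M m finY finM by (auto simp: B_def)
    let ?XB = "{A. A \<subseteq> B \<and> card A = a}"
    have finXB: "finite ?XB" by (rule finite_subset[of _ "Pow B"]) (auto simp: B(3))
    have "(\<Sum>A | A \<subseteq> \<pi> ` B \<and> card A = a. g (rows_of i A)) = (\<Sum>A\<in>?XB. g (rows_of i (\<pi> ` A)))"
      if "\<pi> \<in> ?C" for \<pi>
    proof -
      have sg: "\<pi> \<in> sym_group i" by (rule pair_stab_sym_group[OF that])
      have inj: "inj \<pi>" using sym_group_bij[OF sg] by (simp add: bij_def)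
      have "{A. A \<subseteq> \<pi> ` B \<and> card A = a} = image \<pi> ` ?XB"
        using card_image_sym_group[OF sg] by (auto simp: subset_image_iff)
      moreover have "inj_on (image \<pi>) ?XB"
        by (rule inj_onI) (simp only: inj_image_eq_iff[OF inj])
      ultimately show ?thesis by (simp add: sum.reindex)
    qed
    moreover have "(\<Sum>A | A \<subseteq> \<pi> ` B \<and> card A = a. g (rows_of i A)) = 0" if "\<pi> \<in> ?C" for \<pi>
      using image_sym_group_subset card_image_sym_group pair_stab_sym_group[OF that] B
      by (intro zero) auto
    ultimately have "(\<Sum>A\<in>?XB. g (rows_of i (\<pi> ` A))) = 0" if "\<pi> \<in> ?C" for \<pi>
      using that by simp
    then have "0 = (\<Sum>\<pi>\<in>?C. of_int (sign \<pi>) * (\<Sum>A\<in>?XB. g (rows_of i (\<pi> ` A))))"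
      by simp
    also have "\<dots> = (\<Sum>A\<in>?XB. \<Sum>\<pi>\<in>?C. of_int (sign \<pi>) * g (rows_of i (\<pi> ` A)))"
      by (simp add: sum_distrib_left sum.swap[of _ ?XB])
    also have "\<dots> = (\<Sum>A\<in>?XB. if A = Y then (\<Sum>\<pi>\<in>?C. of_int (sign \<pi>) * g (rows_of i (\<pi> ` Y))) else 0)"
    proof (rule sum.cong)
      fix A assume A: "A \<in> ?XB"
      have "(\<Sum>\<pi>\<in>?C. of_int (sign \<pi>) * g (rows_of i (\<pi> ` A))) = 0" if "A \<noteq> Y"
      proof -
        \<comment> \<open>Both sets have size \<open>a\<close>. For a missing \<open>y\<close>, the
          other entry \<open>x\<close> of its column lies neither in \<open>Y\<close> nor in
          \<open>M\<close>, hence not in \<open>A\<close>.\<close>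
        have "\<not> Y \<subseteq> A"
          using that A Y(2) B(3) card_subset_eq[of A Y] by (auto intro: finite_subset)
        then obtain y where y: "y \<in> Y" "y \<notin> A" by blast
        then obtain x where xy: "(x, y) \<in> set ps" by (auto simp: Y_def)
        from xy have "x \<in> points ps" by (force simp: points_def)
        moreover have "x \<notin> Y" using p xy by (force simp: pairing_def Y_def disjoint_iff)
        ultimately have "x \<notin> A" using A M(1) by (auto simp: B_def)
        then show ?thesis by (rule sum_pair_stab_eq_0[OF p xy _ y(2), where G = "\<lambda>A. g (rows_of i A)"])
      qed
      then show "(\<Sum>\<pi>\<in>?C. of_int (sign \<pi>) * g (rows_of i (\<pi> ` A))) =
          (if A = Y then (\<Sum>\<pi>\<in>?C. of_int (sign \<pi>) * g (rows_of i (\<pi> ` Y))) else 0)" by simp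
    qed simp
    also have "\<dots> = (\<Sum>\<pi>\<in>?C. of_int (sign \<pi>) * g (rows_of i (\<pi> ` Y)))"
      using finXB Y(2) by (simp add: B_def)
    also have "\<dots> = (\<Sum>\<pi>\<in>?C. \<Sum>A\<in>?X. of_int (sign \<pi>) * (if rows_of i A = rows_of i (\<pi> ` Y) then g (rows_of i A) else 0))"
    proof (rule sum.cong)
      fix \<pi> assume "\<pi> \<in> ?C"
      then have sg: "\<pi> \<in> sym_group i" by (rule pair_stab_sym_group)
      have "\<pi> ` Y \<in> ?X"
        using image_sym_group_subset[OF sg Y(1)] card_image_sym_group[OF sg, of Y] Y(2) by simp
      then show "of_int (sign \<pi>) * g (rows_of i (\<pi> ` Y)) =
          (\<Sum>A\<in>?X. of_int (sign \<pi>) * (if rows_of i A = rows_of i (\<pi> ` Y) then g (rows_of i A) else 0))"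
        using finX by (simp add: rows_of_inject sum_distrib_left[symmetric])
    qed simp
    also have "\<dots> = (\<Sum>A\<in>?X. \<Sum>\<pi>\<in>?C. of_int (sign \<pi>) * (if rows_of i A = rows_of i (\<pi> ` Y) then g (rows_of i A) else 0))"
      by (rule sum.swap)
    also have "\<dots> = (\<Sum>A\<in>?X. g (rows_of i A) * cnj (polytabloid \<mu> t (rows_of i A)))"
      unfolding polytabloid_two_row[OF t] Y_def ps_def
      by (intro sum.cong refl) (auto simp: sum_distrib_left intro!: sum.cong)
    finally show ?thesis by simp
  qed
  have "(\<Sum>A\<in>?X. g (rows_of i A) * cnj (h (rows_of i A))) = 0" if "h \<in> specht \<mu>" for h
    using that unfolding specht_def
  proof (rule cfun.span_induct)
    show "cfun.subspace {h. (\<Sum>A\<in>?X. g (rows_of i A) * cnj (h (rows_of i A))) = 0}"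
    proof (rule cfun.subspaceI; (simp add: algebra_simps sum.distrib; fail)?)
      fix c h assume "h \<in> {h. (\<Sum>A\<in>?X. g (rows_of i A) * cnj (h (rows_of i A))) = 0}"
      moreover have "(\<Sum>A\<in>?X. g (rows_of i A) * cnj (fscale c h (rows_of i A))) =
          cnj c * (\<Sum>A\<in>?X. g (rows_of i A) * cnj (h (rows_of i A)))"
        by (simp add: fscale_apply sum_distrib_left algebra_simps)
      ultimately show "fscale c h \<in> {h. (\<Sum>A\<in>?X. g (rows_of i A) * cnj (h (rows_of i A))) = 0}"
        by simp
    qed
  qed (use orth in auto)
  \<comment> \<open>The function \<open>g\<close> belongs to the module to which it is orthogonal,
    so its own squared norm is zero.\<close>
  from this[OF g] have "(\<Sum>A\<in>?X. complex_of_real ((cmod (g (rows_of i A)))\<^sup>2)) = 0"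
    by (simp add: complex_norm_square del: of_real_power)
  then have "complex_of_real (\<Sum>A\<in>?X. (cmod (g (rows_of i A)))\<^sup>2) = 0"
    by (simp only: of_real_sum)
  then have "\<forall>A\<in>?X. (cmod (g (rows_of i A)))\<^sup>2 = 0"
    using finX by (simp only: of_real_eq_0_iff) (subst (asm) sum_nonneg_eq_0_iff, auto)
  then have "g \<tau> = 0" for \<tau>
    using specht_support[OF g, of \<tau>] by auto
  then show ?thesis by (simp add: fun_eq_iff)
qed

end

text \<open>Conjugation by \<open>\<sigma>\<close> carries the column stabilizer of \<open>t\<close>
  to that of \<open>\<sigma> \<circ> t\<close> and preserves signs.\<close>

lemma tabloid_fun_act_polytabloid:
  assumes t: "tableau \<mu> t" and sg: "\<sigma> \<in> sym_group (card \<mu>)"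
  shows "tableau \<mu> (\<sigma> \<circ> t)"
    and "tabloid_fun_act \<sigma> (polytabloid \<mu> t) = polytabloid \<mu> (\<sigma> \<circ> t)"
proof -
  let ?N = "card \<mu>"
  have p: "\<sigma> permutes {..<?N}" using sg by (simp add: sym_group_def)
  have bij: "bij \<sigma>" by (rule sym_group_bij[OF sg])
  show "tableau \<mu> (\<sigma> \<circ> t)"
    using t bij_betw_trans[OF _ permutes_imp_bij[OF p]] by (simp add: tableau_def)
  have inv: "inv \<sigma> (\<sigma> x) = x" "\<sigma> (inv \<sigma> x) = x" for x
    using permutes_inverses[OF p] by auto
  have im: "inv \<sigma> ` \<sigma> ` A = A" "\<sigma> ` inv \<sigma> ` A = A" for A
    by (simp_all add: image_image inv)
  let ?C = "column_stabilizer \<mu> t" and ?C' = "column_stabilizer \<mu> (\<sigma> \<circ> t)"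
  have pin: "inv \<sigma> permutes {..<?N}" by (rule permutes_inv[OF p])
  have 1: "\<sigma> \<circ> \<pi> \<circ> inv \<sigma> \<in> ?C'" if "\<pi> \<in> ?C" for \<pi>
  proof -
    have "\<sigma> \<circ> \<pi> \<circ> inv \<sigma> \<in> sym_group ?N"
      using that p pin by (auto simp: column_stabilizer_def sym_group_def intro!: permutes_compose)
    moreover have "(\<sigma> \<circ> \<pi> \<circ> inv \<sigma>) ` (\<sigma> \<circ> t) ` X = \<sigma> ` \<pi> ` t ` X" for X
      by (simp add: image_image inv)
    ultimately show ?thesis
      using that unfolding column_stabilizer_def
      by (simp only: mem_Collect_eq) (simp add: image_comp)
  qed
  have 2: "inv \<sigma> \<circ> \<pi> \<circ> \<sigma> \<in> ?C" if "\<pi> \<in> ?C'" for \<pi>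
  proof -
    have "inv \<sigma> \<circ> \<pi> \<circ> \<sigma> \<in> sym_group ?N"
      using that p pin by (auto simp: column_stabilizer_def sym_group_def intro!: permutes_compose)
    moreover have "(inv \<sigma> \<circ> \<pi> \<circ> \<sigma>) ` t ` {b \<in> \<mu>. snd b = c} = t ` {b \<in> \<mu>. snd b = c}" for c
    proof -
      have "\<pi> ` (\<sigma> \<circ> t) ` {b \<in> \<mu>. snd b = c} = (\<sigma> \<circ> t) ` {b \<in> \<mu>. snd b = c}"
        using that by (simp add: column_stabilizer_def)
      then have "inv \<sigma> ` \<pi> ` (\<sigma> \<circ> t) ` {b \<in> \<mu>. snd b = c} = inv \<sigma> ` (\<sigma> \<circ> t) ` {b \<in> \<mu>. snd b = c}"
        by (rule arg_cong)
      then show ?thesis by (simp add: image_image inv)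
    qed
    ultimately show ?thesis by (simp add: column_stabilizer_def)
  qed
  show "tabloid_fun_act \<sigma> (polytabloid \<mu> t) = polytabloid \<mu> (\<sigma> \<circ> t)"
  proof
    fix \<tau>
    show "tabloid_fun_act \<sigma> (polytabloid \<mu> t) \<tau> = polytabloid \<mu> (\<sigma> \<circ> t) \<tau>"
      unfolding tabloid_fun_act_def polytabloid_def
    proof (rule sum.reindex_bij_witness[of _ "\<lambda>\<pi>. inv \<sigma> \<circ> \<pi> \<circ> \<sigma>" "\<lambda>\<pi>. \<sigma> \<circ> \<pi> \<circ> inv \<sigma>"])
      fix \<pi> assume pi: "\<pi> \<in> ?C"
      then have pp: "\<pi> permutes {..<?N}" by (simp add: column_stabilizer_def sym_group_def)
      then have "permutation \<pi>" "permutation \<sigma>" "permutation (inv \<sigma>)"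
        using p pin by (auto simp: permutation_permutes)
      then have sgn: "sign (\<sigma> \<circ> \<pi> \<circ> inv \<sigma>) = sign \<pi>"
        by (simp add: sign_compose permutation_compose sign_inverse)
      have "(\<lambda>r. inv \<sigma> ` \<tau> r) = tabloid \<mu> (\<pi> \<circ> t) \<longleftrightarrow> \<tau> = tabloid \<mu> (\<sigma> \<circ> \<pi> \<circ> inv \<sigma> \<circ> (\<sigma> \<circ> t))"
      proof -
        have tb: "tabloid \<mu> (\<sigma> \<circ> \<pi> \<circ> inv \<sigma> \<circ> (\<sigma> \<circ> t)) r = \<sigma> ` tabloid \<mu> (\<pi> \<circ> t) r" for r
          by (simp add: tabloid_def image_image inv)
        show ?thesis
          unfolding fun_eq_iff tb by (metis im)
      qed
      then show "of_int (sign (\<sigma> \<circ> \<pi> \<circ> inv \<sigma>)) *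
          (if \<tau> = tabloid \<mu> (\<sigma> \<circ> \<pi> \<circ> inv \<sigma> \<circ> (\<sigma> \<circ> t)) then 1 else 0) =
          (of_int (sign \<pi>) * (if (\<lambda>r. inv \<sigma> ` \<tau> r) = tabloid \<mu> (\<pi> \<circ> t) then 1 else 0) :: complex)"
        by (simp only: sgn)
      show "inv \<sigma> \<circ> (\<sigma> \<circ> \<pi> \<circ> inv \<sigma>) \<circ> \<sigma> = \<pi>" by (simp add: fun_eq_iff inv)
      show "\<sigma> \<circ> \<pi> \<circ> inv \<sigma> \<in> ?C'" by (rule 1[OF pi])
    next
      fix \<pi> assume "\<pi> \<in> ?C'"
      then show "inv \<sigma> \<circ> \<pi> \<circ> \<sigma> \<in> ?C" by (rule 2)
      show "\<sigma> \<circ> (inv \<sigma> \<circ> \<pi> \<circ> \<sigma>) \<circ> inv \<sigma> = \<pi>" by (simp add: fun_eq_iff inv)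
    qed
  qed
qed

lemma tabloid_fun_act_specht:
  assumes "\<sigma> \<in> sym_group (card \<mu>)" "g \<in> specht \<mu>"
  shows "tabloid_fun_act \<sigma> g \<in> specht \<mu>"
  using assms(2) unfolding specht_def
proof (rule cfun.span_induct)
  let ?P = "{polytabloid \<mu> t |t. tableau \<mu> t}"
  show "cfun.subspace {g. tabloid_fun_act \<sigma> g \<in> cfun.span ?P}"
  proof (rule cfun.subspaceI)
    have "tabloid_fun_act \<sigma> 0 = 0" by (simp add: tabloid_fun_act_def fun_eq_iff)
    then show "0 \<in> {g. tabloid_fun_act \<sigma> g \<in> cfun.span ?P}"
      by (simp only: mem_Collect_eq cfun.span_zero)
  next
    fix g h assume "g \<in> {g. tabloid_fun_act \<sigma> g \<in> cfun.span ?P}" "h \<in> {g. tabloid_fun_act \<sigma> g \<in> cfun.span ?P}"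
    moreover have "tabloid_fun_act \<sigma> (g + h) = tabloid_fun_act \<sigma> g + tabloid_fun_act \<sigma> h"
      by (simp add: tabloid_fun_act_def fun_eq_iff)
    ultimately show "g + h \<in> {g. tabloid_fun_act \<sigma> g \<in> cfun.span ?P}"
      using cfun.span_add by (simp only: mem_Collect_eq)
  next
    fix c g assume "g \<in> {g. tabloid_fun_act \<sigma> g \<in> cfun.span ?P}"
    moreover have "tabloid_fun_act \<sigma> (fscale c g) = fscale c (tabloid_fun_act \<sigma> g)"
      by (simp add: tabloid_fun_act_def fun_eq_iff fscale_apply)
    ultimately show "fscale c g \<in> {g. tabloid_fun_act \<sigma> g \<in> cfun.span ?P}"
      using cfun.span_scale by (simp only: mem_Collect_eq)
  qed
  fix g assume "g \<in> ?P"
  then show "tabloid_fun_act \<sigma> g \<in> cfun.span ?P"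
    using tabloid_fun_act_polytabloid[OF _ assms(1)] by (auto intro!: cfun.span_base)
qed

section \<open>Equivariant embeddings into functions on words\<close>

definition specht_map ::
    "nat \<Rightarrow> nat \<Rightarrow> nat \<Rightarrow> nat \<Rightarrow> nat set \<Rightarrow> ((nat \<Rightarrow> nat set) \<Rightarrow> complex) \<Rightarrow> nat list \<Rightarrow> complex" where
  "specht_map n k i a S g =
     suffix_lift n k i S (\<lambda>K. \<Sum>A | A \<subseteq> K \<inter> {..<i} \<and> card A = a. g (rows_of i A))"

lemma specht_map_add: "specht_map n k i a S (g + h) = specht_map n k i a S g + specht_map n k i a S h"
  by (auto simp: specht_map_def suffix_lift_def fun_eq_iff sum.distrib)

lemma specht_map_scale: "specht_map n k i a S (fscale c g) = fscale c (specht_map n k i a S g)"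
  by (auto simp: specht_map_def suffix_lift_def fun_eq_iff fscale_apply sum_distrib_left)

text \<open>Only positions below \<open>i\<close> are moved, so the suffix set stays in place, while
  the subsets \<open>A\<close> in the defining sum are permuted.\<close>

lemma specht_map_act:
  assumes sg: "\<sigma> \<in> sym_group i" and "i \<le> n"
  shows "specht_map n k i a S (tabloid_fun_act \<sigma> g) = fun_act \<sigma> (specht_map n k i a S g)"
proof
  fix w
  let ?v = "word_act (inv \<sigma>) w"
  have sg': "inv \<sigma> \<in> sym_group i" by (rule sym_group_inv[OF sg])
  have p: "inv \<sigma> permutes {..<i}" using sg' by (simp add: sym_group_def)
  have mem: "?v \<in> johnson_words n k \<longleftrightarrow> w \<in> johnson_words n k"
    by (rule word_act_in_johnson_words[OF sg' \<open>i \<le> n\<close>])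
  show "specht_map n k i a S (tabloid_fun_act \<sigma> g) w = fun_act \<sigma> (specht_map n k i a S g) w"
  proof (cases "w \<in> johnson_words n k")
    case False
    then show ?thesis using mem by (simp add: specht_map_def suffix_lift_def fun_act_def)
  next
    case True
    let ?K = "word_subset w"
    have "inv \<sigma> \<in> sym_group (length w)"
      using sg' True \<open>i \<le> n\<close> by (auto simp: sym_group_def johnson_words_def intro: permutes_subset)
    then have K: "word_subset ?v = inv \<sigma> ` ?K" by (rule word_subset_act)
    have inj: "inj (inv \<sigma>)" by (rule permutes_inj[OF p])
    have lo: "inv \<sigma> ` {..<i} = {..<i}" by (rule permutes_image[OF p])
    have hi: "inv \<sigma> ` {i..} = {i..}"
      using permutes_not_in[OF p] by (intro image_cong[where g = id, simplified]) auto
    have hiK: "inv \<sigma> ` ?K \<inter> {i..} = ?K \<inter> {i..}"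
    proof -
      have "inv \<sigma> ` ?K \<inter> {i..} = inv \<sigma> ` (?K \<inter> {i..})"
        using hi image_Int[OF inj] by metis
      also have "\<dots> = ?K \<inter> {i..}"
        using permutes_not_in[OF p] by (intro image_cong[where g = id, simplified]) auto
      finally show ?thesis .
    qed
    have loK: "inv \<sigma> ` ?K \<inter> {..<i} = inv \<sigma> ` (?K \<inter> {..<i})"
      using lo image_Int[OF inj] by metis
    let ?X = "{A. A \<subseteq> ?K \<inter> {..<i} \<and> card A = a}"
    have X: "{A. A \<subseteq> inv \<sigma> ` (?K \<inter> {..<i}) \<and> card A = a} = image (inv \<sigma>) ` ?X"
      using card_image_sym_group[OF sg'] by (auto simp: subset_image_iff)
    have "inj_on (image (inv \<sigma>)) ?X"
      by (rule inj_onI) (simp only: inj_image_eq_iff[OF inj])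
    then have "(\<Sum>A | A \<subseteq> inv \<sigma> ` ?K \<inter> {..<i} \<and> card A = a. g (rows_of i A)) =
        (\<Sum>A\<in>?X. g (rows_of i (inv \<sigma> ` A)))"
      unfolding loK X by (simp add: sum.reindex)
    also have "\<dots> = (\<Sum>A\<in>?X. tabloid_fun_act \<sigma> g (rows_of i A))"
      by (simp add: tabloid_fun_act_def rows_of_image[OF sg'])
    finally show ?thesis
      using True mem by (simp add: specht_map_def suffix_lift_def fun_act_def K hiK)
  qed
qed

text \<open>In the sum over subsets of \<open>K\<close>, the term of \<open>\<pi>\<close> survives
  exactly if the image of the second row lies in \<open>K\<close>; the rest is
  \<open>pair_fun_eq_sum\<close>.\<close>

lemma specht_map_polytabloid:
  assumes ia: "2 * a \<le> i" and t: "tableau (two_row (i - a) a) t"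
  shows "specht_map n k i a S (polytabloid (two_row (i - a) a) t) =
    suffix_lift n k i S (pair_fun (column_pairs a t))"
proof -
  define ps Y where "ps = column_pairs a t" and "Y = snd ` set ps"
  have p: "pairing i ps" unfolding ps_def by (rule pairing_column_pairs[OF ia t])
  have Y: "Y \<subseteq> {..<i}" "card Y = a"
    using second_row_column_pairs[OF ia t] by (auto simp: Y_def ps_def)
  have "(\<Sum>A | A \<subseteq> K \<inter> {..<i} \<and> card A = a. polytabloid (two_row (i - a) a) t (rows_of i A)) = pair_fun ps K"
    for K
  proof -
    let ?X = "{A. A \<subseteq> K \<inter> {..<i} \<and> card A = a}"
    have finX: "finite ?X" by (rule finite_subset[of _ "Pow {..<i}"]) auto
    have "(\<Sum>A\<in>?X. polytabloid (two_row (i - a) a) t (rows_of i A)) =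
        (\<Sum>A\<in>?X. \<Sum>\<pi>\<in>pair_stab i ps. of_int (sign \<pi>) * (if A = \<pi> ` Y then 1 else 0))"
      by (simp only: polytabloid_two_row[OF ia t] rows_of_inject ps_def Y_def)
    also have "\<dots> = (\<Sum>\<pi>\<in>pair_stab i ps. \<Sum>A\<in>?X. of_int (sign \<pi>) * (if A = \<pi> ` Y then 1 else 0))"
      by (rule sum.swap)
    also have "\<dots> = (\<Sum>\<pi>\<in>pair_stab i ps. of_int (sign \<pi>) * of_bool (\<pi> ` snd ` set ps \<subseteq> K))"
    proof (rule sum.cong)
      fix \<pi> assume "\<pi> \<in> pair_stab i ps"
      then have sg: "\<pi> \<in> sym_group i" by (rule pair_stab_sym_group)
      have "\<pi> ` Y \<in> ?X \<longleftrightarrow> \<pi> ` Y \<subseteq> K"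
        using image_sym_group_subset[OF sg Y(1)] card_image_sym_group[OF sg, of Y] Y(2) by auto
      then show "(\<Sum>A\<in>?X. of_int (sign \<pi>) * (if A = \<pi> ` Y then 1 else 0)) =
          of_int (sign \<pi>) * (of_bool (\<pi> ` snd ` set ps \<subseteq> K) :: complex)"
        using finX by (simp add: sum_distrib_left[symmetric] Y_def[symmetric])
    qed simp
    also have "\<dots> = pair_fun ps K" by (rule pair_fun_eq_sum[OF p])
    finally show ?thesis .
  qed
  then show ?thesis
    by (simp add: specht_map_def ps_def)
qed

text \<open>The map is the inclusion matrix from \<open>a\<close>-subsets to subsets of size
  \<open>k - card S\<close>. Each \<open>K\<close> of that size is the lower part of a word with
  ones \<open>K \<union> S\<close>, so equal images mean equal subset sums, and
  \<open>specht_subset_sums_inject\<close> applies to the difference.\<close>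

lemma specht_map_inj:
  assumes "i \<le> n" "S \<subseteq> {i..<n}" "card S \<le> k" "a \<le> k - card S" "k - card S + a \<le> i"
  shows "inj_on (specht_map n k i a S) (specht (two_row (i - a) a))"
proof (rule inj_onI)
  let ?\<mu> = "two_row (i - a) a" and ?\<phi> = "specht_map n k i a S" and ?m = "k - card S"
  have ia: "2 * a \<le> i" using assms by linarith
  fix g h assume g: "g \<in> specht ?\<mu>" and h: "h \<in> specht ?\<mu>" and eq: "?\<phi> g = ?\<phi> h"
  have "g - h \<in> specht ?\<mu>"
    using g h unfolding specht_def by (rule cfun.span_diff)
  moreover have "(\<Sum>A | A \<subseteq> K \<and> card A = a. (g - h) (rows_of i A)) = 0"
    if K: "K \<subseteq> {..<i}" "card K = ?m" for K
  proof -
    have fin: "finite K" "finite S" using K(1) assms(2) finite_subset by blast+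
    have "K \<inter> S = {}" using K(1) assms(2) by fastforce
    then have "card (K \<union> S) = k" using fin K(2) assms(3) by (simp add: card_Un_disjoint)
    moreover have "K \<union> S \<subseteq> {..<n}" using K(1) assms(1,2) by fastforce
    ultimately have "K \<union> S \<in> word_subset ` johnson_words n k"
      using bij_betw_imp_surj_on[OF bij_betw_word_subset[of n k]] by blast
    then obtain w where w: "w \<in> johnson_words n k" "word_subset w = K \<union> S" by auto
    have "(K \<union> S) \<inter> {i..} = S" "(K \<union> S) \<inter> {..<i} = K" using K(1) assms(2) by fastforce+
    then have "?\<phi> f w = (\<Sum>A | A \<subseteq> K \<and> card A = a. f (rows_of i A))" for f
      using w by (simp only: specht_map_def suffix_lift_def simp_thms if_True)
    then show ?thesis using fun_cong[OF eq, of w] by (simp add: sum_subtractf)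
  qed
  ultimately have "g - h = 0"
    using specht_subset_sums_inject[OF ia _ assms(4,5)] by blast
  then show "g = h" by simp
qed

text \<open>A nonzero vector satisfies the size bounds that make the embedding injective, so the
  image \<open>W\<close> is one of the submodules generating the isotypic component; the zero vector
  lies in any span.\<close>

lemma gt_vec_in_isotypic:
  assumes "length t = i" "i \<le> n" "S \<subseteq> {i..<n}"
  shows "gt_vec n k t S \<in> isotypic n k i (two_row (i - row2 t) (row2 t))"
proof (cases "gt_vec n k t S = 0")
  case True
  then show ?thesis by (simp add: isotypic_def cfun.span_zero)
next
  case False
  define a where "a = row2 t"
  let ?\<mu> = "two_row (i - a) a" and ?\<phi> = "specht_map n k i a S"
  have nz: "card S \<le> k" "a \<le> k - card S" "k - card S + a \<le> i"
    using gt_vec_nonzero[OF False] assms(1) by (simp_all add: a_def)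
  then have ia: "2 * a \<le> i" by linarith
  have card: "card ?\<mu> = i" using ia by simp
  define W where "W = ?\<phi> ` specht ?\<mu>"
  have sub: "cfun.subspace W"
  proof (rule cfun.subspaceI)
    have "?\<phi> 0 = 0" by (simp add: specht_map_def suffix_lift_def fun_eq_iff)
    moreover have "0 \<in> specht ?\<mu>" unfolding specht_def by (rule cfun.span_zero)
    ultimately show "0 \<in> W" unfolding W_def by (metis imageI)
  next
    fix x y assume "x \<in> W" "y \<in> W"
    then obtain g h where "g \<in> specht ?\<mu>" "x = ?\<phi> g" "h \<in> specht ?\<mu>" "y = ?\<phi> h"
      unfolding W_def by blast
    then have "x + y = ?\<phi> (g + h)" "g + h \<in> specht ?\<mu>"
      using cfun.span_add by (simp_all only: specht_map_add specht_def)
    then show "x + y \<in> W" unfolding W_def by blast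
  next
    fix c x assume "x \<in> W"
    then obtain g where "g \<in> specht ?\<mu>" "x = ?\<phi> g"
      unfolding W_def by blast
    then have "fscale c x = ?\<phi> (fscale c g)" "fscale c g \<in> specht ?\<mu>"
      using cfun.span_scale by (simp_all only: specht_map_scale specht_def)
    then show "fscale c x \<in> W" unfolding W_def by blast
  qed
  have "submodule n k i W"
    unfolding submodule_def
  proof (intro conjI ballI subsetI)
    show "cfun.subspace W" by (rule sub)
    show "x \<in> johnson_funs n k" if "x \<in> W" for x
      using that by (auto simp: W_def specht_map_def suffix_lift_in_johnson_funs)
    fix \<sigma> x assume sg: "\<sigma> \<in> sym_group i" and "x \<in> fun_act \<sigma> ` W"
    then obtain g where g: "g \<in> specht ?\<mu>" "x = fun_act \<sigma> (?\<phi> g)" by (auto simp: W_def)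
    then have "x = ?\<phi> (tabloid_fun_act \<sigma> g)" by (simp add: specht_map_act[OF sg assms(2)])
    moreover have "tabloid_fun_act \<sigma> g \<in> specht ?\<mu>"
      using sg g(1) by (intro tabloid_fun_act_specht) (simp_all only: card)
    ultimately show "x \<in> W" unfolding W_def by blast
  qed
  moreover have "isomorphic_modules (sym_group i) tabloid_fun_act (specht ?\<mu>) fun_act W"
    unfolding isomorphic_modules_def
  proof (intro exI[of _ ?\<phi>] conjI ballI allI)
    show "bij_betw ?\<phi> (specht ?\<mu>) W"
      unfolding W_def using specht_map_inj[OF assms(2,3) nz] by (rule inj_on_imp_bij_betw)
  qed (simp_all only: specht_map_add specht_map_scale specht_map_act[OF _ assms(2)])
  ultimately have "W \<subseteq> isotypic n k i ?\<mu>"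
    unfolding isotypic_def by (blast intro: cfun.span_base)
  moreover have "suffix_lift n k i S h \<in> W"
    if "h \<in> cfun.span {pair_fun ps |ps. pairing (length t) ps \<and> length ps = row2 t}" for h
    using that
  proof (rule cfun.span_induct)
    show "cfun.subspace {h. suffix_lift n k i S h \<in> W}"
    proof (rule cfun.subspaceI)
      have "suffix_lift n k i S 0 = 0" by (simp add: suffix_lift_def fun_eq_iff)
      then show "0 \<in> {h. suffix_lift n k i S h \<in> W}"
        using cfun.subspace_0[OF sub] by (simp only: mem_Collect_eq)
    next
      fix g h assume "g \<in> {h. suffix_lift n k i S h \<in> W}" "h \<in> {h. suffix_lift n k i S h \<in> W}"
      moreover have "suffix_lift n k i S (g + h) = suffix_lift n k i S g + suffix_lift n k i S h"
        by (simp add: suffix_lift_def fun_eq_iff)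
      ultimately show "g + h \<in> {h. suffix_lift n k i S h \<in> W}"
        using cfun.subspace_add[OF sub] by (simp only: mem_Collect_eq)
    next
      fix c g assume "g \<in> {h. suffix_lift n k i S h \<in> W}"
      moreover have "suffix_lift n k i S (fscale c g) = fscale c (suffix_lift n k i S g)"
        by (simp add: suffix_lift_def fun_eq_iff fscale_apply)
      ultimately show "fscale c g \<in> {h. suffix_lift n k i S h \<in> W}"
        using cfun.subspace_scale[OF sub] by (simp only: mem_Collect_eq)
    qed
    fix h assume "h \<in> {pair_fun ps |ps. pairing (length t) ps \<and> length ps = row2 t}"
    then obtain ps where ps: "pairing i ps" "length ps = a" "h = pair_fun ps"
      using assms(1) by (auto simp: a_def)
    obtain u where u: "tableau ?\<mu> u" "column_pairs a u = ps"
      using ex_tableau_column_pairs[OF ia ps(1,2)] by blast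
    have "polytabloid ?\<mu> u \<in> specht ?\<mu>"
      unfolding specht_def using u(1) by (intro cfun.span_base) blast
    then have "?\<phi> (polytabloid ?\<mu> u) \<in> W" unfolding W_def by (rule imageI)
    then show "suffix_lift n k i S h \<in> W"
      by (simp only: specht_map_polytabloid[OF ia u(1)] u(2) ps(3))
  qed
  from this[OF gt_val_in_span_pair_fun] have "gt_vec n k t S \<in> W"
    by (simp only: gt_vec_def assms(1))
  ultimately show ?thesis by (auto simp: a_def)
qed

lemma gt_vec_append_in_isotypic:
  assumes "length (u @ t) = n"
  shows "gt_vec n k (u @ t) {} \<in> isotypic n k (length t) (two_row (length t - row2 t) (row2 t))"
proof -
  let ?V = "isotypic n k (length t) (two_row (length t - row2 t) (row2 t))"
  have "{gt_vec n k t S |S. S \<subseteq> {length t..<n}} \<subseteq> ?V"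
    using gt_vec_in_isotypic[of t "length t" n] assms by auto
  then have "cfun.span {gt_vec n k t S |S. S \<subseteq> {length t..<n}} \<subseteq> ?V"
    by (rule cfun.span_minimal) (simp only: isotypic_def cfun.subspace_span)
  then show ?thesis
    using gt_vec_append_in_span[of u t n "{}" k] assms by auto
qed

section \<open>Chains of Young diagrams\<close>

definition path_shape :: "bool list \<Rightarrow> (nat \<times> nat) set" where
  "path_shape t = two_row (length t - row2 t) (row2 t)"

primrec path_chain :: "bool list \<Rightarrow> (nat \<times> nat) set list" where
  "path_chain [] = []"
| "path_chain (b # t) = path_chain t @ [path_shape (b # t)]"

lemma length_path_chain [simp]: "length (path_chain t) = length t"
  by (induction t) auto

text \<open>The last step is at the head, so the first \<open>i\<close> steps of a path are the
  final \<open>i\<close> entries \<open>t\<close> of the list.\<close>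

lemma path_chain_nth:
  "length t = i \<Longrightarrow> 0 < i \<Longrightarrow> path_chain (u @ t) ! (i - 1) = path_shape t"
proof (induction u)
  case Nil
  then show ?case by (cases t) (auto simp: nth_append)
next
  case (Cons b u)
  then have "i - 1 < length (path_chain (u @ t))" by auto
  then show ?case using Cons by (simp add: nth_append)
qed

lemma row2_le_length: "row2 t \<le> length t"
  by (simp add: row2_def count_le_length)

lemma two_row_inject:
  assumes "two_row p q = two_row p' q'"
  shows "q = q'"
proof -
  have "{c. (1, c) \<in> two_row p q} = {..<q}" for p q
    by (auto simp: two_row_iff)
  then have "{..<q} = {..<q'}"
    using assms by metis
  then show ?thesis by simp
qed

lemma inj_path_chain: "inj path_chain"
proof (rule injI)
  show "t = t'" if "path_chain t = path_chain t'" for t t'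
    using that
  proof (induction t arbitrary: t')
    case Nil
    then show ?case by (cases t') auto
  next
    case (Cons b t)
    then obtain b' u where t': "t' = b' # u" by (cases t') auto
    then have "t = u" using Cons by auto
    moreover have "row2 (b # t) = row2 (b' # u)"
      using Cons.prems t' by (auto simp: path_shape_def dest: two_row_inject simp del: row2_simps)
    ultimately show ?case using t' by (auto split: if_splits)
  qed
qed

lemma young_diagram_two_row: "young_diagram (two_row p q) \<longleftrightarrow> q \<le> p"
proof
  assume y: "young_diagram (two_row p q)"
  show "q \<le> p"
  proof (rule ccontr)
    assume "\<not> q \<le> p"
    then have "(1, p) \<in> two_row p q" by (simp add: two_row_iff)
    with y have "(0, p) \<in> two_row p q"
      unfolding young_diagram_def by (meson le_refl zero_le)
    then show False by (simp add: two_row_iff)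
  qed
qed (auto simp: young_diagram_def two_row_iff)

text \<open>The removed cell ends its row: otherwise the last cell of the row would remain, and a
  diagram containing it also contains the cells to its left.\<close>

lemma young_diagram_remove_box:
  assumes y: "young_diagram E" and b: "b \<notin> E" "two_row p q = insert b E"
  shows "p > 0 \<and> E = two_row (p - 1) q \<or> q > 0 \<and> E = two_row p (q - 1)"
proof -
  have mem: "x \<in> E" if "x \<in> two_row p q" "x \<noteq> b" for x
    using that b by auto
  have E: "E = two_row p q - {b}" using b by auto
  have down: "(r, c') \<in> E \<Longrightarrow> c \<le> c' \<Longrightarrow> (r, c) \<in> E" for r c c'
    using y unfolding young_diagram_def by blast
  obtain r c where rc: "b = (r, c)" by fastforce
  have "b \<in> two_row p q" using b by auto
  then consider "r = 0" "c < p" | "r = 1" "c < q" by (auto simp: rc two_row_iff)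
  then show ?thesis
  proof cases
    case 1
    have "c = p - 1"
    proof (rule ccontr)
      assume "c \<noteq> p - 1"
      then have "(0, p - 1) \<in> E" using 1 by (intro mem) (auto simp: rc two_row_iff)
      then have "(0, c) \<in> E" using 1 by (intro down[of 0 "p - 1" c]) auto
      then show False using b(1) rc 1 by simp
    qed
    then have "E = two_row (p - 1) q" using 1 unfolding E by (auto simp: rc two_row_iff)
    then show ?thesis using 1 by auto
  next
    case 2
    have "c = q - 1"
    proof (rule ccontr)
      assume "c \<noteq> q - 1"
      then have "(1, q - 1) \<in> E" using 2 by (intro mem) (auto simp: rc two_row_iff)
      then have "(1, c) \<in> E" using 2 by (intro down[of 1 "q - 1" c]) auto
      then show False using b(1) rc 2 by simp
    qed
    then have "E = two_row p (q - 1)" using 2 unfolding E by (auto simp: rc two_row_iff)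
    then show ?thesis using 2 by auto
  qed
qed

text \<open>Two rows are prescribed for the last diagram only; removing a box preserves this form,
  so the steps can be read off from the end. The ballot inequality says that the respective last
  shape is a Young diagram.\<close>

lemma path_chain_surj:
  assumes "length T = Suc m"
    and "\<And>i. i \<le> m \<Longrightarrow> young_diagram (T ! i) \<and> card (T ! i) = Suc i"
    and "\<And>i. i < m \<Longrightarrow> adds_box (T ! i) (T ! Suc i)"
    and "T ! m = two_row (Suc m - a) a"
  shows "\<exists>t. length t = Suc m \<and> ballot t \<and> row2 t = a \<and> path_chain t = T"
  using assms
proof (induction m arbitrary: T a)
  case 0
  have "a \<le> Suc 0 - a" using "0.prems"(2)[of 0] "0.prems"(4) young_diagram_two_row by simp
  then have "a = 0" by simp
  moreover obtain D where T: "T = [D]" using "0.prems"(1) by (cases T) auto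
  ultimately have "D = two_row 1 0" using "0.prems"(4) by simp
  then show ?case
    using \<open>a = 0\<close> T by (intro exI[of _ "[False]"]) (simp add: path_shape_def)
next
  case (Suc m)
  let ?a = "Suc (Suc m) - a"
  define T' where "T' = butlast T"
  have len: "length T' = Suc m" using Suc.prems(1) by (simp add: T'_def)
  have nth: "T' ! i = T ! i" if "i \<le> m" for i
    using that len by (simp add: T'_def nth_butlast)
  have T: "T = T' @ [two_row ?a a]"
    using Suc.prems(1,4) by (metis T'_def append_butlast_last_id last_conv_nth
        diff_Suc_1 length_0_conv nat.distinct(1))
  have ya: "a \<le> ?a" using Suc.prems(2)[of "Suc m"] Suc.prems(4) young_diagram_two_row by simp
  have y: "young_diagram (T ! m)" "card (T ! m) = Suc m" using Suc.prems(2)[of m] by auto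
  obtain b where "b \<notin> T ! m" "two_row ?a a = insert b (T ! m)"
    using Suc.prems(3)[of m] Suc.prems(4) by (auto simp: adds_box_def)
  from young_diagram_remove_box[OF y(1) this] obtain a' c where
    a': "T ! m = two_row (Suc m - a') a'" "a = (if c then Suc a' else a')"
  proof
    assume h: "?a > 0 \<and> T ! m = two_row (?a - 1) a"
    then show ?thesis using ya by (intro that[of a False]) auto
  next
    assume h: "a > 0 \<and> T ! m = two_row ?a (a - 1)"
    then have eq: "?a = Suc m - (a - 1)" by auto
    have "T ! m = two_row (Suc m - (a - 1)) (a - 1)" using h by (simp only: eq)
    then show ?thesis using h by (intro that[of "a - 1" True]) simp_all
  qed
  have "\<exists>t. length t = Suc m \<and> ballot t \<and> row2 t = a' \<and> path_chain t = T'"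
    using Suc.prems(2,3) len a'(1) by (intro Suc.IH) (auto simp: nth)
  then obtain t where t: "length t = Suc m" "ballot t" "row2 t = a'" "path_chain t = T'" by blast
  then have "row2 (c # t) = a" using a'(2) by simp
  moreover from this have "ballot (c # t)" using t ya by simp
  moreover have "path_chain (c # t) = T"
    using \<open>row2 (c # t) = a\<close> t T by (simp add: path_shape_def del: row2_simps)
  ultimately show ?case using t(1) by (intro exI[of _ "c # t"]) auto
qed

lemma ballot_append: "ballot (u @ t) \<Longrightarrow> ballot t"
  by (induction u) auto

lemma path_chain_in_gt_chains:
  assumes "length t = n" "ballot t" "row2 t \<le> min k (n - k)" "n \<ge> 1"
  shows "path_chain t \<in> gt_chains n k"
proof -
  have split: "\<exists>u s. t = u @ s \<and> length s = i" if "i \<le> n" for i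
    using that assms(1) by (intro exI[of _ "take (n - i) t"] exI[of _ "drop (n - i) t"]) auto
  have 1: "young_diagram (path_chain t ! (i - 1)) \<and> card (path_chain t ! (i - 1)) = i"
    if i: "i \<in> {1..n}" for i
  proof -
    obtain u s where s: "t = u @ s" "length s = i" using split[of i] i by auto
    then have "path_chain t ! (i - 1) = path_shape s"
      using path_chain_nth[OF s(2), of u] i by simp
    moreover have "2 * row2 s \<le> length s"
      using assms(2) s by (auto intro!: ballot_row2_le dest: ballot_append)
    ultimately show ?thesis using s(2) by (simp add: path_shape_def young_diagram_two_row)
  qed
  have 2: "adds_box (path_chain t ! (i - 1)) (path_chain t ! i)" if i: "i \<in> {1..<n}" for i
  proof -
    obtain u s where s: "t = u @ s" "length s = Suc i" using split[of "Suc i"] i by auto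
    then obtain b r where r: "s = b # r" "length r = i" by (cases s) auto
    have "path_chain t ! i = path_shape (b # r)"
      using path_chain_nth[OF s(2), of u] s(1) r(1) by simp
    moreover have "path_chain t ! (i - 1) = path_shape r"
      using path_chain_nth[OF r(2), of "u @ [b]"] s(1) r(1) i by simp
    moreover have "adds_box (path_shape r) (path_shape (b # r))"
    proof (cases b)
      case True
      then have "path_shape (b # r) = insert (1, row2 r) (path_shape r)"
        by (auto simp: path_shape_def two_row_def)
      then show ?thesis unfolding adds_box_def
        by (intro exI[of _ "(1, row2 r)"]) (simp add: path_shape_def two_row_iff)
    next
      case False
      then have "path_shape (b # r) = insert (0, length r - row2 r) (path_shape r)"
        using row2_le_length[of r] by (auto simp: path_shape_def two_row_def)
      then show ?thesis unfolding adds_box_def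
        by (intro exI[of _ "(0, length r - row2 r)"]) (simp add: path_shape_def two_row_iff)
    qed
    ultimately show ?thesis by simp
  qed
  have "path_chain t ! (n - 1) = two_row (n - row2 t) (row2 t)"
    using path_chain_nth[OF assms(1), of "[]"] assms(1,4) by (simp add: path_shape_def)
  then show ?thesis
    using 1 2 assms by (auto simp: gt_chains_def)
qed

text \<open>A full vector is nonzero exactly for ballot paths with \<open>row2 t \<le> k\<close> and
  \<open>k + row2 t \<le> n\<close>, which are the conditions on a chain and its final shape.
  Nonvanishing can therefore serve as the index condition throughout.\<close>

lemma gt_chains_eq:
  assumes "n \<ge> 1" "k \<le> n"
  shows "gt_chains n k = path_chain ` {t. length t = n \<and> gt_vec n k t {} \<noteq> 0}"
proof (intro equalityI subsetI)
  fix T assume T: "T \<in> gt_chains n k"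
  obtain m where m: "n = Suc m" using assms(1) by (cases n) auto
  obtain a where a: "a \<le> min k (n - k)" "T ! (n - 1) = two_row (n - a) a"
    using T by (auto simp: gt_chains_def)
  have y: "young_diagram (T ! (i - 1)) \<and> card (T ! (i - 1)) = i" if "i \<in> {1..n}" for i
    using T that by (simp add: gt_chains_def)
  have b: "adds_box (T ! (i - 1)) (T ! i)" if "i \<in> {1..<n}" for i
    using T that by (simp add: gt_chains_def)
  have "\<exists>t. length t = Suc m \<and> ballot t \<and> row2 t = a \<and> path_chain t = T"
  proof (rule path_chain_surj)
    show "length T = Suc m" using T m by (simp add: gt_chains_def)
    show "young_diagram (T ! i) \<and> card (T ! i) = Suc i" if "i \<le> m" for i
      using y[of "Suc i"] that m by simp
    show "adds_box (T ! i) (T ! Suc i)" if "i < m" for i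
      using b[of "Suc i"] that m by simp
    show "T ! m = two_row (Suc m - a) a" using a(2) m by simp
  qed
  then obtain t where t: "length t = n" "ballot t" "row2 t = a" "path_chain t = T"
    using m by blast
  then have "row2 t \<le> k" "k + row2 t \<le> length t"
    using a(1) assms(2) by auto
  then have "gt_vec n k t {} \<noteq> 0"
    using gt_vec_full_nonzero[OF t(2)] t(1) by simp
  then show "T \<in> path_chain ` {t. length t = n \<and> gt_vec n k t {} \<noteq> 0}"
    using t by blast
next
  fix T assume "T \<in> path_chain ` {t. length t = n \<and> gt_vec n k t {} \<noteq> 0}"
  then obtain t where t: "T = path_chain t" "length t = n" "gt_vec n k t {} \<noteq> 0" by auto
  then show "T \<in> gt_chains n k"
    unfolding t(1) using gt_vec_nonzero(3,4,5)[OF t(3)] t(2) assms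
    by (intro path_chain_in_gt_chains) auto
qed

section \<open>The normalized basis indexed by chains\<close>

definition gt_basis :: "nat \<Rightarrow> nat \<Rightarrow> (nat \<times> nat) set list \<Rightarrow> nat list \<Rightarrow> complex" where
  "gt_basis n k T = (let t = inv path_chain T in
     fscale (1 / csqrt (of_int (gt_ip t t (int k)))) (gt_vec n k t {}))"

lemma gt_basis_path_chain:
  "gt_basis n k (path_chain t) = fscale (1 / csqrt (of_int (gt_ip t t (int k)))) (gt_vec n k t {})"
  by (simp add: gt_basis_def inv_f_f[OF inj_path_chain])

lemma csqrt_of_int_pos: "m > 0 \<Longrightarrow> csqrt (of_int m) = of_real (sqrt (of_int m))"
  using csqrt_of_real_nonneg[of "complex_of_int m"] by simp

lemma cnj_gt_vec [simp]: "cnj (gt_vec n k t S w) = gt_vec n k t S w"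
  by (simp add: gt_vec_def suffix_lift_def)

text \<open>Coordinates are inner products with a conjugated second argument. Real basis vectors
  turn them into plain sums of products, which suits programs without a conjugation
  instruction.\<close>

lemma cnj_gt_basis:
  assumes "gt_vec n k t {} \<noteq> 0"
  shows "cnj (gt_basis n k (path_chain t) w) = gt_basis n k (path_chain t) w"
  using gt_vec_nonzero(1)[OF assms]
  by (simp add: gt_basis_path_chain fscale_apply csqrt_of_int_pos)

lemma gt_basis_orthonormal:
  assumes "length t = n" "length t' = n" "gt_vec n k t {} \<noteq> 0" "gt_vec n k t' {} \<noteq> 0"
  shows "johnson_inner n k (gt_basis n k (path_chain t)) (gt_basis n k (path_chain t')) =
    (if t = t' then 1 else 0)"
proof -
  let ?c = "\<lambda>t. csqrt (of_int (gt_ip t t (int k)))"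
  have pos: "gt_ip t t (int k) > 0" "gt_ip t' t' (int k) > 0"
    using assms gt_vec_nonzero(1) by fastforce+
  have "johnson_inner n k (gt_basis n k (path_chain t)) (gt_basis n k (path_chain t')) =
    johnson_inner n k (gt_vec n k t {}) (gt_vec n k t' {}) / (?c t * ?c t')"
    unfolding johnson_inner_def sum_divide_distrib using pos
    by (intro sum.cong) (simp_all add: gt_basis_path_chain fscale_apply csqrt_of_int_pos)
  also have "\<dots> = of_int (gt_ip t t' (int k)) / (?c t * ?c t')"
    using assms by (simp add: gt_vec_inner)
  also have "\<dots> = (if t = t' then 1 else 0)"
  proof (cases "t = t'")
    case True
    have "?c t * ?c t = of_int (gt_ip t t (int k))"
      using power2_csqrt[of "of_int (gt_ip t t (int k))"] by (simp add: power2_eq_square)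
    then show ?thesis using True pos by simp
  qed (use assms gt_ip_orthogonal in auto)
  finally show ?thesis .
qed

context
  fixes n k :: nat
  assumes nk: "n \<ge> 1" "k \<le> n"
begin

lemma finite_gt_chains: "finite (gt_chains n k)"
proof -
  have "{t. length t = n \<and> gt_vec n k t {} \<noteq> 0} \<subseteq> {t :: bool list. set t \<subseteq> UNIV \<and> length t = n}" by auto
  then have "finite {t. length t = n \<and> gt_vec n k t {} \<noteq> 0}"
    by (rule finite_subset) (rule finite_lists_length_eq, simp)
  then show ?thesis by (simp add: gt_chains_eq[OF nk])
qed

lemma gt_basis_chains_orthonormal:
  assumes "T \<in> gt_chains n k" "T' \<in> gt_chains n k"
  shows "johnson_inner n k (gt_basis n k T) (gt_basis n k T') = (if T = T' then 1 else 0)"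
proof -
  obtain t t' where "T = path_chain t" "length t = n" "gt_vec n k t {} \<noteq> 0"
    and "T' = path_chain t'" "length t' = n" "gt_vec n k t' {} \<noteq> 0"
    using assms by (auto simp: gt_chains_eq[OF nk])
  then show ?thesis
    by (simp add: gt_basis_orthonormal inj_eq[OF inj_path_chain])
qed

lemma span_gt_basis: "cfun.span (gt_basis n k ` gt_chains n k) = johnson_funs n k"
proof
  show "cfun.span (gt_basis n k ` gt_chains n k) \<subseteq> johnson_funs n k"
  proof (rule cfun.span_minimal[OF _ subspace_johnson_funs])
    show "gt_basis n k ` gt_chains n k \<subseteq> johnson_funs n k"
      using cfun.subspace_scale[OF subspace_johnson_funs gt_vec_in_johnson_funs]
      by (auto simp only: gt_chains_eq[OF nk] gt_basis_path_chain)
  qed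
  have "{gt_vec n k t {} |t. length t = n \<and> gt_vec n k t {} \<noteq> 0} \<subseteq> cfun.span (gt_basis n k ` gt_chains n k)"
  proof
    fix f assume "f \<in> {gt_vec n k t {} |t. length t = n \<and> gt_vec n k t {} \<noteq> 0}"
    then obtain t where t: "f = gt_vec n k t {}" "length t = n" "gt_vec n k t {} \<noteq> 0" by blast
    let ?c = "csqrt (of_int (gt_ip t t (int k)))"
    have "gt_ip t t (int k) \<noteq> 0" using gt_vec_nonzero(1)[OF t(3)] by simp
    then have "f = fscale ?c (gt_basis n k (path_chain t))"
      by (simp add: t(1) gt_basis_path_chain fun_eq_iff fscale_apply)
    moreover have "path_chain t \<in> gt_chains n k"
      using t by (auto simp: gt_chains_eq[OF nk])
    ultimately show "f \<in> cfun.span (gt_basis n k ` gt_chains n k)"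
      using cfun.span_scale cfun.span_base imageI by metis
  qed
  then have "cfun.span {gt_vec n k t {} |t. length t = n \<and> gt_vec n k t {} \<noteq> 0}
      \<subseteq> cfun.span (gt_basis n k ` gt_chains n k)"
    by (rule cfun.span_minimal[OF _ cfun.subspace_span])
  then show "johnson_funs n k \<subseteq> cfun.span (gt_basis n k ` gt_chains n k)"
    by (simp only: span_gt_vec)
qed

lemma gt_basis_is_basis: "is_basis (gt_chains n k) (gt_basis n k) (johnson_funs n k)"
proof (rule orthonormal_basis(1)[of "gt_chains n k" n k "gt_basis n k"])
  show "johnson_inner n k (gt_basis n k i) (gt_basis n k j) = (if i = j then 1 else 0)"
    if "i \<in> gt_chains n k" "j \<in> gt_chains n k" for i j
    using that by (rule gt_basis_chains_orthonormal)
qed (use finite_gt_chains span_gt_basis in simp_all)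

lemma coords_gt_basis:
  assumes "f \<in> johnson_funs n k" "T \<in> gt_chains n k"
  shows "coords (gt_chains n k) (gt_basis n k) f T = (\<Sum>w\<in>johnson_words n k. f w * gt_basis n k T w)"
proof -
  have "coords (gt_chains n k) (gt_basis n k) f T = johnson_inner n k f (gt_basis n k T)"
  proof (rule orthonormal_basis(2)[of "gt_chains n k" n k "gt_basis n k" "johnson_funs n k"])
    show "johnson_inner n k (gt_basis n k i) (gt_basis n k j) = (if i = j then 1 else 0)"
      if "i \<in> gt_chains n k" "j \<in> gt_chains n k" for i j
      using that by (rule gt_basis_chains_orthonormal)
  qed (use finite_gt_chains span_gt_basis assms in simp_all)
  then show ?thesis
    using assms(2) by (auto simp: johnson_inner_def gt_chains_eq[OF nk] cnj_gt_basis)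
qed

lemma gelfand_tsetlin_gt_basis: "gelfand_tsetlin_basis n k (gt_basis n k)"
  unfolding gelfand_tsetlin_basis_def
proof (rule conjI[OF gt_basis_is_basis], rule ballI, rule conjI, rule INT_I)
  fix T assume T: "T \<in> gt_chains n k"
  fix i assume i: "i \<in> {1..n}"
  obtain t where t: "T = path_chain t" "length t = n"
    using T by (auto simp: gt_chains_eq[OF nk])
  obtain u s where s: "t = u @ s" "length s = i"
    using t i by (metis append_take_drop_id length_drop atLeastAtMost_iff diff_diff_cancel)
  have "T ! (i - 1) = two_row (length s - row2 s) (row2 s)"
    using path_chain_nth[OF s(2), of u] s t(1) i by (simp add: path_shape_def)
  then have "gt_vec n k t {} \<in> isotypic n k i (T ! (i - 1))"
    using gt_vec_append_in_isotypic[of u s n k] s t by simp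
  then show "gt_basis n k T \<in> isotypic n k i (T ! (i - 1))"
    unfolding t(1) gt_basis_path_chain isotypic_def by (rule cfun.span_scale)
next
  fix T assume T: "T \<in> gt_chains n k"
  show "johnson_inner n k (gt_basis n k T) (gt_basis n k T) = 1"
    using gt_basis_chains_orthonormal[OF T T] by simp
qed

end

section \<open>Straight-line programs\<close>

text \<open>A computed value is a function of an environment \<open>e\<close> (the unknown input), so that one
  program serves all inputs.\<close>

definition available ::
    "'e set \<Rightarrow> ('e \<Rightarrow> 'x \<Rightarrow> complex option) \<Rightarrow> 'x program \<Rightarrow> ('e \<Rightarrow> complex) \<Rightarrow> 'x operand \<Rightarrow> bool" where
  "available E inp P v q \<longleftrightarrow>
     (\<forall>e\<in>E. \<forall>rs. run (inp e) P [] = Some rs \<longrightarrow> operand_val (inp e) rs q = Some (v e))"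

text \<open>The program is hidden and both \<open>m\<close> and \<open>V\<close> are mere bounds, so
  cost estimates compose by appending instructions and finish with
  \<open>computable_mono\<close>.\<close>

definition computable ::
    "'e set \<Rightarrow> ('e \<Rightarrow> 'x \<Rightarrow> complex option) \<Rightarrow> nat \<Rightarrow> ('e \<Rightarrow> complex) set \<Rightarrow> bool" where
  "computable E inp m V \<longleftrightarrow> (\<exists>P. length P \<le> m \<and> (\<forall>e\<in>E. run (inp e) P [] \<noteq> None) \<and>
     (\<forall>v\<in>V. \<exists>q. available E inp P v q))"

lemma run_append: "run inp (P @ Q) rs = Option.bind (run inp P rs) (run inp Q)"
  by (induction P arbitrary: rs) (auto split: Option.bind_splits)

lemma length_run: "run inp P rs = Some rs' \<Longrightarrow> length rs' = length rs + length P"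
  by (induction P arbitrary: rs) (fastforce split: Option.bind_splits)+

lemma operand_val_append: "operand_val inp rs q = Some x \<Longrightarrow> operand_val inp (rs @ [z]) q = Some x"
  by (cases q) (auto simp: nth_append split: if_splits)

lemma computable_mono:
  "computable E inp m V \<Longrightarrow> V' \<subseteq> V \<Longrightarrow> m \<le> m' \<Longrightarrow> computable E inp m' V'"
  unfolding computable_def by (meson le_trans subsetD)

text \<open>Operands refer to results by absolute index, so an appended instruction leaves earlier
  values available. Assumption \<open>c\<close> ranges over all programs because the place of a
  value depends on the program.\<close>

lemma computable_instr:
  assumes comp: "computable E inp m V"
    and c: "\<And>P. (\<And>v. v \<in> V \<Longrightarrow> \<exists>q. available E inp P v q) \<Longrightarrow>
      \<exists>c. \<forall>e\<in>E. \<forall>rs. run (inp e) P [] = Some rs \<longrightarrow> instr_val (inp e) rs c = Some (v e)"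
  shows "computable E inp (Suc m) (insert v V)"
proof -
  obtain P where P: "length P \<le> m" "\<forall>e\<in>E. run (inp e) P [] \<noteq> None"
    "\<And>v. v \<in> V \<Longrightarrow> \<exists>q. available E inp P v q"
    using comp unfolding computable_def by blast
  obtain c where c: "\<forall>e\<in>E. \<forall>rs. run (inp e) P [] = Some rs \<longrightarrow> instr_val (inp e) rs c = Some (v e)"
    using c[OF P(3)] by blast
  have run: "run (inp e) (P @ [c]) [] = Some rs' \<longleftrightarrow>
      (\<exists>rs. run (inp e) P [] = Some rs \<and> rs' = rs @ [v e])" if "e \<in> E" for e rs'
    using P(2) c that by (cases "run (inp e) P []") (auto simp: run_append)
  have "available E inp (P @ [c]) v (Result (length P))"
    unfolding available_def
  proof (intro ballI allI impI)
    fix e rs' assume "e \<in> E" "run (inp e) (P @ [c]) [] = Some rs'"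
    then obtain rs where rs: "run (inp e) P [] = Some rs" "rs' = rs @ [v e]"
      using run by blast
    then have "length rs = length P" using length_run by fastforce
    then show "operand_val (inp e) rs' (Result (length P)) = Some (v e)"
      by (simp add: rs(2) nth_append)
  qed
  moreover have "available E inp (P @ [c]) u q" if "available E inp P u q" for u q
    using that unfolding available_def by (auto simp: run operand_val_append)
  moreover have "\<forall>e\<in>E. run (inp e) (P @ [c]) [] \<noteq> None"
    using P(2) c by (auto simp: run_append)
  ultimately show ?thesis
    unfolding computable_def using P(1,3)
    by (intro exI[of _ "P @ [c]"]) (fastforce simp del: run.simps)
qed

lemma computable_MulAdd:
  assumes "computable E inp m V" "x \<in> V" "y \<in> V" "z \<in> V"
  shows "computable E inp (Suc m) (insert (\<lambda>e. x e * y e + z e) V)"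
proof (rule computable_instr[OF assms(1)])
  fix P assume "\<And>v. v \<in> V \<Longrightarrow> \<exists>q. available E inp P v q"
  then obtain p q r where "available E inp P x p" "available E inp P y q" "available E inp P z r"
    using assms by meson
  then show "\<exists>c. \<forall>e\<in>E. \<forall>rs. run (inp e) P [] = Some rs \<longrightarrow> instr_val (inp e) rs c = Some (x e * y e + z e)"
    unfolding available_def by (intro exI[of _ "MulAdd p q r"]) auto
qed

lemma computable_Sub:
  assumes "computable E inp m V" "x \<in> V" "y \<in> V"
  shows "computable E inp (Suc m) (insert (\<lambda>e. x e - y e) V)"
proof (rule computable_instr[OF assms(1)])
  fix P assume "\<And>v. v \<in> V \<Longrightarrow> \<exists>q. available E inp P v q"
  then obtain p q where "available E inp P x p" "available E inp P y q"
    using assms by meson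
  then show "\<exists>c. \<forall>e\<in>E. \<forall>rs. run (inp e) P [] = Some rs \<longrightarrow> instr_val (inp e) rs c = Some (x e - y e)"
    unfolding available_def by (intro exI[of _ "Sub p q"]) auto
qed

lemma computable_Div:
  assumes "computable E inp m V" "x \<in> V" "y \<in> V" "\<And>e. e \<in> E \<Longrightarrow> y e \<noteq> 0"
  shows "computable E inp (Suc m) (insert (\<lambda>e. x e / y e) V)"
proof (rule computable_instr[OF assms(1)])
  fix P assume "\<And>v. v \<in> V \<Longrightarrow> \<exists>q. available E inp P v q"
  then obtain p q where "available E inp P x p" "available E inp P y q"
    using assms by meson
  then show "\<exists>c. \<forall>e\<in>E. \<forall>rs. run (inp e) P [] = Some rs \<longrightarrow> instr_val (inp e) rs c = Some (x e / y e)"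
    unfolding available_def using assms(4) by (intro exI[of _ "Div p q"]) auto
qed

lemma computable_Sqrt:
  assumes "computable E inp m V" "x \<in> V"
  shows "computable E inp (Suc m) (insert (\<lambda>e. csqrt (x e)) V)"
proof (rule computable_instr[OF assms(1)])
  fix P assume "\<And>v. v \<in> V \<Longrightarrow> \<exists>q. available E inp P v q"
  then obtain p where "available E inp P x p"
    using assms by meson
  then show "\<exists>c. \<forall>e\<in>E. \<forall>rs. run (inp e) P [] = Some rs \<longrightarrow> instr_val (inp e) rs c = Some (csqrt (x e))"
    unfolding available_def by (intro exI[of _ "Sqrt p"]) auto
qed

lemma computable_inputs:
  assumes "\<And>v. v \<in> V \<Longrightarrow> v = (\<lambda>e. 0) \<or> v = (\<lambda>e. 1) \<or> (\<exists>l. \<forall>e\<in>E. inp e l = Some (v e))"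
  shows "computable E inp 0 V"
  unfolding computable_def
proof (intro exI[of _ "[]"] conjI ballI)
  fix v assume "v \<in> V"
  then consider "v = (\<lambda>e. 0)" | "v = (\<lambda>e. 1)" | l where "\<forall>e\<in>E. inp e l = Some (v e)"
    using assms by blast
  then show "\<exists>q. available E inp [] v q"
  proof cases
    case 1
    then show ?thesis by (intro exI[of _ Zero]) (simp add: available_def)
  next
    case 2
    then show ?thesis by (intro exI[of _ One]) (simp add: available_def)
  next
    case 3
    then show ?thesis by (intro exI[of _ "Input l"]) (simp add: available_def)
  qed
qed simp_all

text \<open>Each item must be computable over any larger set \<open>V'\<close>, since the items
  treated before it have already been added.\<close>

lemma computable_batch:
  assumes "finite J" "computable E inp m V"
    and "\<And>j V' m'. j \<in> J \<Longrightarrow> V \<subseteq> V' \<Longrightarrow> computable E inp m' V' \<Longrightarrow> computable E inp (m' + c) (insert (g j) V')"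
  shows "computable E inp (m + c * card J) (V \<union> g ` J)"
  using assms
proof (induction J rule: finite_induct)
  case (insert j J)
  have "computable E inp (m + c * card J) (V \<union> g ` J)"
    using insert.prems by (intro insert.IH) auto
  then have "computable E inp (m + c * card J + c) (insert (g j) (V \<union> g ` J))"
    by (intro insert.prems(2)) auto
  then show ?case using insert.hyps by (simp add: algebra_simps)
qed simp

lemma computable_of_nat:
  assumes "computable E inp m V" "(\<lambda>e. 0) \<in> V" "(\<lambda>e. 1) \<in> V"
  shows "computable E inp (m + N) (V \<union> {\<lambda>e. of_nat j |j. j \<le> N})"
proof (induction N)
  case 0
  have "V \<union> {\<lambda>e. of_nat j |j. j \<le> 0} = V" using assms(2) by auto
  then show ?case using assms(1) by simp
next
  case (Suc N)
  let ?V = "V \<union> {\<lambda>e. of_nat j |j. j \<le> N}"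
  have "computable E inp (Suc (m + N)) (insert (\<lambda>e. (\<lambda>e. 1) e * (\<lambda>e. 1) e + (\<lambda>e. of_nat N) e) ?V)"
    by (rule computable_MulAdd[OF Suc]) (use assms in auto)
  moreover have "V \<union> {\<lambda>e. of_nat j |j. j \<le> Suc N} \<subseteq> insert (\<lambda>e. (\<lambda>e. 1) e * (\<lambda>e. 1) e + (\<lambda>e. of_nat N) e) ?V"
    by (auto simp: le_Suc_eq)
  ultimately show ?case by (rule computable_mono) simp
qed

text \<open>Availability of a value is uniform in the environment, so \<open>out\<close> can be
  fixed before the input is known.\<close>

lemma computable_imp_computes:
  assumes "computable E inp m V"
  shows "\<exists>P out. operation_count P \<le> m \<and>
    (\<forall>e\<in>E. \<forall>J val. (\<forall>j\<in>J. v j \<in> V \<and> v j e = val j) \<longrightarrow> computes P out (inp e) J val)"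
proof -
  obtain P where P: "length P \<le> m" "\<forall>e\<in>E. run (inp e) P [] \<noteq> None"
    "\<forall>v\<in>V. \<exists>q. available E inp P v q"
    using assms unfolding computable_def by blast
  then obtain opnd where opnd: "\<forall>v\<in>V. available E inp P v (opnd v)" by metis
  have "computes P (\<lambda>j. opnd (v j)) (inp e) J val"
    if e: "e \<in> E" and J: "\<forall>j\<in>J. v j \<in> V \<and> v j e = val j" for e J val
  proof -
    obtain rs where "run (inp e) P [] = Some rs" using P(2) e by blast
    then show ?thesis
      using opnd e J unfolding computes_def available_def by (metis (no_types, lifting))
  qed
  then show ?thesis
    unfolding operation_count_def using P(1)
    by (intro exI[of _ P] exI[of _ "\<lambda>j. opnd (v j)"]) auto
qed

section \<open>The fast Fourier transform\<close>

context
  fixes n k :: nat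
  assumes nk: "n \<ge> 1" "k \<le> n"
begin

definition fft_input :: "(nat list \<Rightarrow> complex) \<Rightarrow> johnson_label \<Rightarrow> complex option" where
  "fft_input f = johnson_input n k (coords (johnson_words n k) delta f)"

definition gt_coef :: "bool list \<Rightarrow> nat set \<Rightarrow> (nat list \<Rightarrow> complex) \<Rightarrow> complex" where
  "gt_coef t S f = (\<Sum>w\<in>johnson_words n k. f w * gt_vec n k t S w)"

definition gt_norm2 :: "bool list \<Rightarrow> nat set \<Rightarrow> (nat list \<Rightarrow> complex) \<Rightarrow> complex" where
  "gt_norm2 t S = (\<lambda>f. of_int (gt_ip t t (int k - int (card S))))"

definition numbers :: "((nat list \<Rightarrow> complex) \<Rightarrow> complex) set" where
  "numbers = {\<lambda>f. of_nat j |j. j \<le> n}"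

text \<open>All pairs occur, also those with a zero vector, so that the recursion can refer to both
  of its predecessors unconditionally; the values of the latter are the constant 0 in
  \<open>numbers\<close>.\<close>

definition stage :: "nat \<Rightarrow> ((nat list \<Rightarrow> complex) \<Rightarrow> complex) set" where
  "stage i = numbers \<union> {gt_coef t S |t S. length t = i \<and> S \<subseteq> {i..<n}} \<union>
     {gt_norm2 t S |t S. length t = i \<and> S \<subseteq> {i..<n}}"

abbreviation "computed_in \<equiv> computable (johnson_funs n k) fft_input"

lemma numbersI: "j \<le> n \<Longrightarrow> (\<lambda>f. of_nat j) \<in> numbers"
  by (auto simp: numbers_def)

lemma zero_one_numbers: "(\<lambda>f. 0) \<in> numbers" "(\<lambda>f. 1) \<in> numbers"
  using numbersI[of 0] numbersI[of 1] nk by simp_all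

lemma gt_coef_Cons:
  assumes "S \<subseteq> {Suc (length t)..}"
  shows "gt_coef (b # t) S f =
    of_int (coeff_in b t (int k - int (card S))) * gt_coef t (insert (length t) S) f +
    of_int (coeff_out b t (int k - int (card S))) * gt_coef t S f"
  unfolding gt_coef_def gt_vec_Cons[OF assms]
  by (simp add: fscale_apply algebra_simps sum.distrib sum_distrib_left)

lemma gt_norm2_Cons:
  assumes "S \<subseteq> {Suc (length t)..<n}"
  shows "gt_norm2 (b # t) S f =
    of_int (coeff_in b t (int k - int (card S))) * (of_int (coeff_in b t (int k - int (card S))) *
      gt_norm2 t (insert (length t) S) f) +
    of_int (coeff_out b t (int k - int (card S))) * (of_int (coeff_out b t (int k - int (card S))) *
      gt_norm2 t S f)"
proof -
  have "finite S" "length t \<notin> S" using assms finite_subset by auto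
  then have "int k - int (card (insert (length t) S)) = int k - int (card S) - 1" by simp
  then show ?thesis by (simp add: gt_norm2_def gt_ip_Cons algebra_simps)
qed

lemma gt_vec_zero:
  assumes "gt_vec n k t S = 0" "length t \<le> n" "S \<subseteq> {length t..<n}"
  shows "gt_coef t S = (\<lambda>f. 0)" "gt_norm2 t S = (\<lambda>f. 0)"
proof -
  show "gt_coef t S = (\<lambda>f. 0)" using assms(1) by (simp add: gt_coef_def fun_eq_iff)
  have "(of_int (gt_ip t t (int k - int (card S))) :: complex) = 0"
    using gt_vec_inner[of t "length t" t n S S k] assms by (simp add: johnson_inner_def)
  then show "gt_norm2 t S = (\<lambda>f. 0)" by (simp add: gt_norm2_def)
qed

text \<open>Thus the numbers up to \<open>n\<close>, computed once, provide all coefficients.\<close>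

lemma coeffs_of_nat:
  assumes "gt_vec n k (True # t) S \<noteq> 0" "length t < n"
  obtains p q where "p \<le> n" "q \<le> n" "coeff_in True t (int k - int (card S)) = int p"
    "coeff_out True t (int k - int (card S)) = - int q"
proof
  have *: "card S \<le> k" "Suc (row2 t) \<le> k - card S" "k - card S + row2 t \<le> length t"
    using gt_vec_nonzero(2,4,5)[OF assms(1)] by simp_all
  show "length t + 1 - (row2 t + (k - card S)) \<le> n" "k - card S - row2 t \<le> n"
    using * assms(2) by auto
  show "coeff_in True t (int k - int (card S)) = int (length t + 1 - (row2 t + (k - card S)))"
    "coeff_out True t (int k - int (card S)) = - int (k - card S - row2 t)"
    using * by (auto simp: coeff_in_def coeff_out_def of_nat_diff)
qed

text \<open>A step to the first row is one addition. A step to the second row takes two products and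
  one subtraction, because \<open>coeff_out\<close> is the negative of a natural number.\<close>

lemma computed_in_gt_coef_Cons:
  assumes computed_in: "computed_in m V" and V: "stage i \<subseteq> V"
    and S: "length t = i" "i < n" "S \<subseteq> {Suc i..<n}" and nz: "gt_vec n k (b # t) S \<noteq> 0"
  shows "computed_in (m + 3) (insert (gt_coef (b # t) S) V)"
proof -
  define x y where "x = gt_coef t S" and "y = gt_coef t (insert i S)"
  have S': "S \<subseteq> {Suc (length t)..}" "S \<subseteq> {i..<n}" "insert i S \<subseteq> {i..<n}"
    using S by auto
  then have xy: "x \<in> V" "y \<in> V"
    using V S(1) unfolding x_def y_def stage_def by blast+
  have num: "(\<lambda>f. of_nat j) \<in> V" if "j \<le> n" for j
    using numbersI[OF that] V unfolding stage_def by blast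
  have z: "(\<lambda>f. 0) \<in> V" "(\<lambda>f. 1) \<in> V"
    using zero_one_numbers V unfolding stage_def by blast+
  show ?thesis
  proof (cases b)
    case False
    then have "gt_coef (b # t) S = (\<lambda>f. y f * 1 + x f)"
      using gt_coef_Cons[OF S'(1), of b] S(1)
      by (simp add: x_def y_def coeff_in_def coeff_out_def fun_eq_iff)
    then have "computed_in (Suc m) (insert (gt_coef (b # t) S) V)"
      using computable_MulAdd[OF computed_in xy(2) z(2) xy(1)] by simp
    then show ?thesis by (rule computable_mono) auto
  next
    case True
    then obtain p q where pq: "p \<le> n" "q \<le> n" "coeff_in True t (int k - int (card S)) = int p"
      "coeff_out True t (int k - int (card S)) = - int q"
      using coeffs_of_nat[of t S] nz S by auto
    let ?u = "\<lambda>f. of_nat p * y f + 0" and ?v = "\<lambda>f. of_nat q * x f + 0"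
    have "computed_in (Suc m) (insert ?u V)"
      by (rule computable_MulAdd[OF computed_in num[OF pq(1)] xy(2) z(1)])
    then have "computed_in (Suc (Suc m)) (insert ?v (insert ?u V))"
      by (rule computable_MulAdd) (use num[OF pq(2)] xy z in auto)
    then have "computed_in (Suc (Suc (Suc m))) (insert (\<lambda>f. ?u f - ?v f) (insert ?v (insert ?u V)))"
      by (rule computable_Sub) auto
    moreover have "gt_coef (b # t) S = (\<lambda>f. ?u f - ?v f)"
      using gt_coef_Cons[OF S'(1), of b] S(1) True pq by (simp add: x_def y_def fun_eq_iff)
    ultimately show ?thesis by (elim computable_mono) auto
  qed
qed

text \<open>The squares of the coefficients are applied as two successive multiplications by numbers
  at most \<open>n\<close>: four operations with the final addition fused in. The sign of
  \<open>coeff_out\<close> disappears in the square.\<close>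

lemma computed_in_gt_norm2_Cons:
  assumes computed_in: "computed_in m V" and V: "stage i \<subseteq> V"
    and S: "length t = i" "i < n" "S \<subseteq> {Suc i..<n}" and nz: "gt_vec n k (b # t) S \<noteq> 0"
  shows "computed_in (m + 4) (insert (gt_norm2 (b # t) S) V)"
proof -
  define x y where "x = gt_norm2 t S" and "y = gt_norm2 t (insert i S)"
  have S': "S \<subseteq> {Suc (length t)..<n}" "S \<subseteq> {i..<n}" "insert i S \<subseteq> {i..<n}"
    using S by auto
  then have xy: "x \<in> V" "y \<in> V"
    using V S(1) unfolding x_def y_def stage_def by blast+
  have num: "(\<lambda>f. of_nat j) \<in> V" if "j \<le> n" for j
    using numbersI[OF that] V unfolding stage_def by blast
  have z: "(\<lambda>f. 0) \<in> V" "(\<lambda>f. 1) \<in> V"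
    using zero_one_numbers V unfolding stage_def by blast+
  show ?thesis
  proof (cases b)
    case False
    then have "gt_norm2 (b # t) S = (\<lambda>f. y f * 1 + x f)"
      using gt_norm2_Cons[OF S'(1), of b] S(1)
      by (simp add: x_def y_def coeff_in_def coeff_out_def fun_eq_iff)
    then have "computed_in (Suc m) (insert (gt_norm2 (b # t) S) V)"
      using computable_MulAdd[OF computed_in xy(2) z(2) xy(1)] by simp
    then show ?thesis by (rule computable_mono) auto
  next
    case True
    then obtain p q where pq: "p \<le> n" "q \<le> n" "coeff_in True t (int k - int (card S)) = int p"
      "coeff_out True t (int k - int (card S)) = - int q"
      using coeffs_of_nat[of t S] nz S by auto
    let ?u = "\<lambda>f. of_nat p * y f + 0" and ?v = "\<lambda>f. of_nat q * x f + 0"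
    let ?w = "\<lambda>f. of_nat p * ?u f + 0"
    have "computed_in (Suc m) (insert ?u V)"
      by (rule computable_MulAdd[OF computed_in num[OF pq(1)] xy(2) z(1)])
    then have "computed_in (Suc (Suc m)) (insert ?v (insert ?u V))"
      by (rule computable_MulAdd) (use num[OF pq(2)] xy z in auto)
    then have "computed_in (Suc (Suc (Suc m))) (insert ?w (insert ?v (insert ?u V)))"
      by (rule computable_MulAdd) (use num[OF pq(1)] z in auto)
    then have "computed_in (Suc (Suc (Suc (Suc m))))
        (insert (\<lambda>f. of_nat q * ?v f + ?w f) (insert ?w (insert ?v (insert ?u V))))"
      by (rule computable_MulAdd) (use num[OF pq(2)] in auto)
    moreover have "gt_norm2 (b # t) S = (\<lambda>f. of_nat q * ?v f + ?w f)"
      using gt_norm2_Cons[OF S'(1), of b] S(1) True pq by (simp add: x_def y_def fun_eq_iff)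
    ultimately show ?thesis by (elim computable_mono) auto
  qed
qed

section \<open>Total cost of the transform\<close>

lemma computed_in_stage_0: "computed_in n (stage 0)"
proof -
  let ?V = "{\<lambda>f. 0, \<lambda>f. 1} \<union> {gt_coef [] S |S. S \<subseteq> {0..<n}}"
  have "gt_coef [] S = (\<lambda>f. 0) \<or> (\<exists>l. \<forall>f\<in>johnson_funs n k. fft_input f l = Some (gt_coef [] S f))" for S
  proof (cases "\<exists>w\<in>johnson_words n k. word_subset w = S")
    case True
    then obtain w where w: "w \<in> johnson_words n k" "word_subset w = S" by blast
    have "gt_coef [] S f = f w" for f
    proof -
      have "gt_coef [] S f = (\<Sum>v\<in>johnson_words n k. if v = w then f w else 0)"
        unfolding gt_coef_def w(2)[symmetric] gt_vec_Nil[OF w(1)]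
        by (intro sum.cong) (auto simp: delta_def)
      then show ?thesis using w(1) by simp
    qed
    then have "\<forall>f\<in>johnson_funs n k. fft_input f (Coord w) = Some (gt_coef [] S f)"
      using w(1) by (simp add: fft_input_def johnson_input_def coords_delta)
    then show ?thesis by blast
  next
    case False
    then have "gt_vec n k [] S w = 0" for w
      by (auto simp: gt_vec_def suffix_lift_def)
    then show ?thesis by (simp add: gt_coef_def fun_eq_iff)
  qed
  \<comment> \<open>At level 0 the coefficients are inputs or zero and the norms are 0 or 1; all
    \<open>n\<close> operations go into the numbers up to \<open>n\<close>.\<close>
  then have "computed_in 0 ?V" by (intro computable_inputs) auto
  then have "computed_in (0 + n) (?V \<union> {\<lambda>f. of_nat j |j. j \<le> n})"
    by (rule computable_of_nat) auto
  moreover have "stage 0 \<subseteq> ?V \<union> {\<lambda>f. of_nat j |j. j \<le> n}"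
    by (auto simp: stage_def numbers_def gt_norm2_def gt_ip_Nil)
  ultimately show ?thesis by (elim computable_mono) auto
qed

lemma computed_in_stage_Suc:
  assumes computed_in: "computed_in m (stage i)" and i: "i < n"
  shows "computed_in (m + 7 * (n choose k)) (stage (Suc i))"
proof -
  let ?J = "gt_index n k (Suc i)"
  let ?c = "\<lambda>(t, S). gt_coef t S" and ?d = "\<lambda>(t, S). gt_norm2 t S"
  have J: "\<exists>b t S. j = (b # t, S) \<and> length t = i \<and> S \<subseteq> {Suc i..<n} \<and> gt_vec n k (b # t) S \<noteq> 0"
    if "j \<in> ?J" for j
    using that by (auto simp: gt_index_def length_Suc_conv)
  have "computed_in (m + 3 * card ?J) (stage i \<union> ?c ` ?J)"
  proof (rule computable_batch[OF finite_gt_index computed_in])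
    fix j V m' assume j: "j \<in> ?J" and V: "stage i \<subseteq> V" "computed_in m' V"
    from J[OF j] obtain b t S where "j = (b # t, S)" "length t = i" "S \<subseteq> {Suc i..<n}" "gt_vec n k (b # t) S \<noteq> 0"
      by blast
    then show "computed_in (m' + 3) (insert (?c j) V)"
      using computed_in_gt_coef_Cons[OF V(2,1) _ i] by simp
  qed
  then have "computed_in (m + 3 * card ?J + 4 * card ?J) ((stage i \<union> ?c ` ?J) \<union> ?d ` ?J)"
  proof (rule computable_batch[OF finite_gt_index])
    fix j V m' assume j: "j \<in> ?J" and V: "stage i \<union> ?c ` ?J \<subseteq> V" "computed_in m' V"
    from J[OF j] obtain b t S where "j = (b # t, S)" "length t = i" "S \<subseteq> {Suc i..<n}" "gt_vec n k (b # t) S \<noteq> 0"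
      by blast
    then show "computed_in (m' + 4) (insert (?d j) V)"
      using computed_in_gt_norm2_Cons[OF V(2) _ _ i] V(1) by simp
  qed
  then show ?thesis
  proof (rule computable_mono)
    have "gt_coef t S \<in> stage i \<union> ?c ` ?J \<union> ?d ` ?J \<and> gt_norm2 t S \<in> stage i \<union> ?c ` ?J \<union> ?d ` ?J"
      if t: "length t = Suc i" "S \<subseteq> {Suc i..<n}" for t S
    proof (cases "gt_vec n k t S = 0")
      case True
      then show ?thesis
        using gt_vec_zero[of t S] t i zero_one_numbers by (simp add: stage_def)
    next
      case False
      then have "(t, S) \<in> ?J" using t by (simp add: gt_index_def)
      then show ?thesis by force
    qed
    then show "stage (Suc i) \<subseteq> stage i \<union> ?c ` ?J \<union> ?d ` ?J"
      unfolding stage_def[of "Suc i"] by (auto simp: stage_def)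
    show "m + 3 * card ?J + 4 * card ?J \<le> m + 7 * (n choose k)"
      using card_gt_index_le[of "Suc i" n k] i by simp
  qed
qed

lemma computed_in_stage: "i \<le> n \<Longrightarrow> computed_in (n + i * (7 * (n choose k))) (stage i)"
proof (induction i)
  case 0
  then show ?case using computed_in_stage_0 by simp
next
  case (Suc i)
  then show ?case
    using computed_in_stage_Suc[of "n + i * (7 * (n choose k))" i] by (simp add: algebra_simps)
qed

definition gt_coord :: "bool list \<Rightarrow> (nat list \<Rightarrow> complex) \<Rightarrow> complex" where
  "gt_coord t f = (\<Sum>w\<in>johnson_words n k. f w * gt_basis n k (path_chain t) w)"

lemma computed_in_gt_coord:
  "computed_in (n + n * (7 * (n choose k)) + 2 * (n choose k))
     (gt_coord ` {t. length t = n \<and> gt_vec n k t {} \<noteq> 0})"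
proof -
  let ?J = "gt_index n k n" and ?g = "\<lambda>(t, S). gt_coord t"
  have "computed_in (n + n * (7 * (n choose k)) + 2 * card ?J) (stage n \<union> ?g ` ?J)"
  proof (rule computable_batch[OF finite_gt_index computed_in_stage[OF order_refl]])
    fix j V m assume j: "j \<in> ?J" and V: "stage n \<subseteq> V" "computed_in m V"
    \<comment> \<open>At level \<open>n\<close> the suffix set is a subset of
      \<open>{n..<n}\<close>. Normalization then costs one square root and one division.\<close>
    then obtain t where t: "j = (t, {})" "length t = n" "gt_vec n k t {} \<noteq> 0"
      by (auto simp: gt_index_def)
    have mem: "gt_coef t {} \<in> V" "gt_norm2 t {} \<in> V"
      using V(1) t(2) unfolding stage_def by blast+
    let ?s = "\<lambda>f. csqrt (gt_norm2 t {} f)"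
    have pos: "gt_ip t t (int k) > 0" using gt_vec_nonzero(1)[OF t(3)] by simp
    have "computed_in (Suc m) (insert ?s V)" by (rule computable_Sqrt[OF V(2) mem(2)])
    then have "computed_in (Suc (Suc m)) (insert (\<lambda>f. gt_coef t {} f / ?s f) (insert ?s V))"
      by (rule computable_Div) (use mem pos in \<open>auto simp: gt_norm2_def\<close>)
    moreover have "gt_coord t = (\<lambda>f. gt_coef t {} f / ?s f)"
      by (simp add: gt_coord_def gt_coef_def gt_norm2_def gt_basis_path_chain fscale_apply
          sum_divide_distrib fun_eq_iff)
    ultimately show "computed_in (m + 2) (insert (?g j) V)"
      by (elim computable_mono) (auto simp: t(1))
  qed
  then show ?thesis
  proof (rule computable_mono)
    show "gt_coord ` {t. length t = n \<and> gt_vec n k t {} \<noteq> 0} \<subseteq> stage n \<union> ?g ` ?J"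
      by (force simp: gt_index_def)
  qed (use card_gt_index_le[of n n k] in simp)
qed

lemma fft_correct:
  "\<exists>P out. operation_count P \<le> n + n * (7 * (n choose k)) + 2 * (n choose k) \<and>
    (\<forall>f\<in>johnson_funs n k.
       computes P out (johnson_input n k (coords (johnson_words n k) delta f))
         (gt_chains n k) (coords (gt_chains n k) (gt_basis n k) f))"
proof -
  let ?v = "\<lambda>T. gt_coord (inv path_chain T)"
  obtain P out where P: "operation_count P \<le> n + n * (7 * (n choose k)) + 2 * (n choose k)"
    and c: "\<forall>f\<in>johnson_funs n k. \<forall>J val.
      (\<forall>T\<in>J. ?v T \<in> gt_coord ` {t. length t = n \<and> gt_vec n k t {} \<noteq> 0} \<and> ?v T f = val T) \<longrightarrow>
      computes P out (fft_input f) J val"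
    using computable_imp_computes[OF computed_in_gt_coord, of ?v] by (elim exE conjE) (rule that)
  have "computes P out (fft_input f) (gt_chains n k) (coords (gt_chains n k) (gt_basis n k) f)"
    if f: "f \<in> johnson_funs n k" for f
  proof (rule c[THEN bspec, OF f, THEN spec, THEN spec, THEN mp], rule ballI)
    fix T assume T: "T \<in> gt_chains n k"
    then obtain t where t: "T = path_chain t" "length t = n" "gt_vec n k t {} \<noteq> 0"
      by (auto simp: gt_chains_eq[OF nk])
    have "inv path_chain T = t" by (simp add: t(1) inv_f_f[OF inj_path_chain])
    moreover have "gt_coord t f = coords (gt_chains n k) (gt_basis n k) f T"
      unfolding coords_gt_basis[OF nk f T] by (simp add: gt_coord_def t(1))
    ultimately show "?v T \<in> gt_coord ` {t. length t = n \<and> gt_vec n k t {} \<noteq> 0} \<and>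
        ?v T f = coords (gt_chains n k) (gt_basis n k) f T"
      using t by auto
  qed
  then show ?thesis using P unfolding fft_input_def by blast
qed

lemma coords_eq_matrix_product:
  assumes f: "f \<in> johnson_funs n k" and T: "T \<in> gt_chains n k"
  shows "coords (gt_chains n k) (gt_basis n k) f T =
    (\<Sum>x\<in>johnson_words n k. change_of_basis (gt_chains n k) (gt_basis n k) delta T x
       * coords (johnson_words n k) delta f x)"
proof -
  have "change_of_basis (gt_chains n k) (gt_basis n k) delta T x = gt_basis n k T x"
    if x: "x \<in> johnson_words n k" for x
  proof -
    have "delta x \<in> johnson_funs n k" using x by (auto simp: johnson_funs_def delta_def)
    then have "change_of_basis (gt_chains n k) (gt_basis n k) delta T x =
        (\<Sum>w\<in>johnson_words n k. delta x w * gt_basis n k T w)"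
      unfolding change_of_basis_def by (rule coords_gt_basis[OF nk _ T])
    also have "\<dots> = (\<Sum>w\<in>johnson_words n k. if w = x then gt_basis n k T x else 0)"
      by (intro sum.cong) (auto simp: delta_def)
    finally show ?thesis using x by simp
  qed
  then show ?thesis
    by (simp add: coords_gt_basis[OF nk f T] coords_delta[OF f] mult.commute)
qed

end

theorem theorem7:
  shows "\<exists>C::real. \<forall>n k::nat. n \<ge> 1 \<longrightarrow> k \<le> n \<longrightarrow>
    (\<exists>(B :: (nat \<times> nat) set list \<Rightarrow> nat list \<Rightarrow> complex)
      (P :: johnson_label program) (out :: (nat \<times> nat) set list \<Rightarrow> johnson_label operand).
       gelfand_tsetlin_basis n k B \<and>
       real (operation_count P) \<le> C * real n * real (n choose k) \<and>
       (\<forall>f\<in>johnson_funs n k.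
          computes P out (johnson_input n k (coords (johnson_words n k) delta f))
            (gt_chains n k) (coords (gt_chains n k) B f) \<and>
          (\<forall>T\<in>gt_chains n k. coords (gt_chains n k) B f T =
             (\<Sum>x\<in>johnson_words n k. change_of_basis (gt_chains n k) B delta T x
                * coords (johnson_words n k) delta f x))))"
proof (intro exI[of _ "10 :: real"] allI impI)
  fix n k :: nat assume nk: "n \<ge> 1" "k \<le> n"
  obtain P :: "johnson_label program" and out
    where P: "operation_count P \<le> n + n * (7 * (n choose k)) + 2 * (n choose k)"
      and c: "\<forall>f\<in>johnson_funs n k.
         computes P out (johnson_input n k (coords (johnson_words n k) delta f))
           (gt_chains n k) (coords (gt_chains n k) (gt_basis n k) f)"
    using fft_correct[OF nk] by blast
  \<comment> \<open>The constant is \<open>10 = 1 + 7 + 2\<close>: since \<open>n\<close> and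
    \<open>n choose k\<close> are at least 1, the cost \<open>n\<close> of the numbers and the
    \<open>2 * (n choose k)\<close> normalizations are absorbed into multiples of
    \<open>n * (n choose k)\<close>.\<close>
  have "n choose k \<ge> 1" using nk(2) by (simp add: Suc_le_eq)
  then have *: "n \<le> n * (n choose k)" "n choose k \<le> n * (n choose k)"
    using nk(1) by auto
  have "n * (7 * (n choose k)) = 7 * (n * (n choose k))" by (rule mult.left_commute)
  then have "operation_count P \<le> 10 * (n * (n choose k))"
    using P * by linarith
  then have "real (operation_count P) \<le> real (10 * (n * (n choose k)))"
    by (simp only: of_nat_le_iff)
  then have count: "real (operation_count P) \<le> 10 * real n * real (n choose k)" by simp
  show "\<exists>B (P :: johnson_label program) out. gelfand_tsetlin_basis n k B \<and>
      real (operation_count P) \<le> 10 * real n * real (n choose k) \<and>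
      (\<forall>f\<in>johnson_funs n k.
         computes P out (johnson_input n k (coords (johnson_words n k) delta f))
           (gt_chains n k) (coords (gt_chains n k) B f) \<and>
         (\<forall>T\<in>gt_chains n k. coords (gt_chains n k) B f T =
            (\<Sum>x\<in>johnson_words n k. change_of_basis (gt_chains n k) B delta T x
               * coords (johnson_words n k) delta f x)))"
    by (intro exI[of _ "gt_basis n k"] exI[of _ P] exI[of _ out] conjI ballI
        gelfand_tsetlin_gt_basis[OF nk] count coords_eq_matrix_product[OF nk] c[rule_format])
qed

end
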